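(* There exists a natural morphism of sheaves of $\mathcal{O}_N$-algebras $$\Xi: s_*(D_M)^{\mathfrak{S}_k}\to D_N$$ such that, for any (local section) $P\in s_*(D_M)^{\mathfrak{S}_k}$ and any $f\in s_*(\mathcal{O}_M)^{\mathfrak{S}_k}$, one has $$\theta(P[f])=\Xi(P)[\theta(f)].$$ Moreover, this morphism is injective, and its restriction to the Zariski open set $\{\sigma\in N \ /\ \Delta(\sigma)\neq 0\}$ of $N$ is an isomorphism of sheaves of $\mathcal{O}_N$-algebras.
   Context: Let $k$ be a positive integer, $M=\mathbb{C}^k$ with coordinates $x=(x_1,\dots,x_k)$, $N=\mathbb{C}^k$ with coordinates $\sigma=(\sigma_1,\dots,\sigma_k)$, and $s:M\to N$, $s(x)=(s_1(x),\dots,s_k(x))$, the map given by the elementary symmetric functions (the quotient map by the permutation action of the symmetric group $\mathfrak{S}_k$ on $M$). $\Delta$ is the discriminant polynomial on $N$: $\Delta(s(x))=\prod_{1\le i<j\le k}(x_i-x_j)^2$. $D_M$, $D_N$ are the sheaves of holomorphic differential operators on $M$, $N$. The group $\mathfrak{S}_k$ acts on the direct image sheaves $s_*(\mathcal{O}_M)$ and $s_*(D_M)$ on $N$, and the superscript $\mathfrak{S}_k$ denotes the subsheaf of invariant sections. $\theta: s_*(\mathcal{O}_M)^{\mathfrak{S}_k}\to\mathcal{O}_N$ is the natural isomorphism whose inverse is the pull-back $g\mapsto g\circ s$; via this pull-back $s_*(D_M)^{\mathfrak{S}_k}$ is an $\mathcal{O}_N$-algebra (not commutative; a morphism of $\mathcal{O}_N$-algebras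 is an $\mathcal{O}_N$-linear morphism of sheaves of rings). *)

theory Defs
  imports "HOL-Analysis.Analysis" "HOL-Algebra.Module" "HOL-Combinatorics.Permutations"
begin

text \<open>
  Both \<open>M\<close> and \<open>N\<close> are \<open>complex ^ 'k\<close>, where the finite linear order \<open>'k\<close> plays the role
  of \<open>{1, \<dots>, k}\<close>; the number belonging to the index \<open>j\<close> is \<open>card {..j}\<close>.
  Sections over \<open>U\<close> are represented by functions that take the value \<^const>\<open>undefined\<close>
  outside of \<open>U\<close>, so that equality of sections is equality in HOL.
\<close>

type_synonym 'k space = "complex ^ 'k"

section \<open>Holomorphic functions\<close>

definition complex_differentiable_at :: "('k::finite space \<Rightarrow> complex) \<Rightarrow> 'k space \<Rightarrow> bool" where
  "complex_differentiable_at f x \<longleftrightarrow>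
     (\<exists>f'. (f has_derivative f') (at x) \<and> (\<forall>c v. f' (c *s v) = c * f' v))"

definition hol :: "('k::finite space) set \<Rightarrow> ('k space \<Rightarrow> complex) ring" where
  "hol U =
     \<lparr>carrier = {f \<in> extensional U. \<forall>x\<in>U. complex_differentiable_at f x},
      mult = (\<lambda>f g. \<lambda>x\<in>U. f x * g x),
      one = (\<lambda>x\<in>U. 1),
      zero = (\<lambda>x\<in>U. 0),
      add = (\<lambda>f g. \<lambda>x\<in>U. f x + g x)\<rparr>"

definition partial :: "'k::finite \<Rightarrow> ('k space \<Rightarrow> complex) \<Rightarrow> 'k space \<Rightarrow> complex" where
  "partial i f x = deriv (\<lambda>t. f (x + axis i t)) 0"

definition partials ::
    "('k::{finite,linorder} \<Rightarrow> nat) \<Rightarrow> ('k space \<Rightarrow> complex) \<Rightarrow> 'k space \<Rightarrow> complex" where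
  "partials \<alpha> f = foldr (\<lambda>i. partial i ^^ \<alpha> i) (sorted_list_of_set UNIV) f"

section \<open>Holomorphic differential operators\<close>

text \<open>
  An operator over \<open>U\<close> is an endomorphism of the sheaf of holomorphic functions on \<open>U\<close>: it assigns
  to an open \<open>V \<subseteq> U\<close> and a holomorphic function \<open>f\<close> on \<open>V\<close> the holomorphic function \<open>P V f\<close> on
  \<open>V\<close>. The default \<open>\<lambda>_. undefined\<close>, rather than \<^const>\<open>undefined\<close>, is fixed by the action of
  permutations below.
\<close>

type_synonym 'k op = "('k space) set \<Rightarrow> ('k space \<Rightarrow> complex) \<Rightarrow> 'k space \<Rightarrow> complex"

definition op_restrict :: "('k::finite space) set \<Rightarrow> 'k op \<Rightarrow> 'k op" where
  "op_restrict U P =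
     (\<lambda>V f. if open V \<and> V \<subseteq> U \<and> f \<in> carrier (hol V) then P V f else (\<lambda>_. undefined))"

definition sheaf_endo :: "('k::finite space) set \<Rightarrow> 'k op \<Rightarrow> bool" where
  "sheaf_endo U P \<longleftrightarrow>
     op_restrict U P = P \<and>
     (\<forall>V f. open V \<and> V \<subseteq> U \<and> f \<in> carrier (hol V) \<longrightarrow>
        P V f \<in> carrier (hol V) \<and>
        (\<forall>W. open W \<and> W \<subseteq> V \<longrightarrow> P W (restrict f W) = restrict (P V f) W))"

text \<open>The order of a differential operator is only locally bounded.\<close>

definition diffop :: "('k::{finite,linorder} space) set \<Rightarrow> 'k op \<Rightarrow> bool" where
  "diffop U P \<longleftrightarrow>
     sheaf_endo U P \<and>
     (\<forall>x\<in>U. \<exists>W m a. open W \<and> x \<in> W \<and> W \<subseteq> U \<and> (\<forall>\<alpha>. a \<alpha> \<in> carrier (hol W)) \<and>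
        (\<forall>V f. open V \<and> V \<subseteq> W \<and> f \<in> carrier (hol V) \<longrightarrow>
           (\<forall>y\<in>V. P V f y = (\<Sum>\<alpha> | sum \<alpha> UNIV \<le> m. a \<alpha> y * partials \<alpha> f y))))"

definition diffops ::
    "('k::{finite,linorder} space) set \<Rightarrow> ('k space \<Rightarrow> complex, 'k op) module" where
  "diffops U =
     \<lparr>carrier = {P. diffop U P},
      mult = (\<lambda>P Q. op_restrict U (\<lambda>V f. P V (Q V f))),
      one = op_restrict U (\<lambda>V f. f),
      zero = op_restrict U (\<lambda>V f. \<lambda>x\<in>V. 0),
      add = (\<lambda>P Q. op_restrict U (\<lambda>V f. \<lambda>x\<in>V. P V f x + Q V f x)),
      smult = (\<lambda>g P. op_restrict U (\<lambda>V f. \<lambda>x\<in>V. g x * P V f x))\<rparr>"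

section \<open>Sheaves of algebras\<close>

text \<open>
  An algebra over the commutative ring \<open>R U\<close> need not be commutative, and the scalars need not be
  central in it. \<open>restriction F U V\<close> is the restriction map from \<open>U\<close> to \<open>V\<close>.
\<close>

record ('x, 'r, 'a) algebra_sheaf =
  sections :: "'x set \<Rightarrow> ('r, 'a) module"
  restriction :: "'x set \<Rightarrow> 'x set \<Rightarrow> 'a \<Rightarrow> 'a"

definition algebra_sheaf_hom ::
    "'x::topological_space set \<Rightarrow> ('x set \<Rightarrow> 'r ring) \<Rightarrow>
     ('x, 'r, 'a) algebra_sheaf \<Rightarrow> ('x, 'r, 'b) algebra_sheaf \<Rightarrow> ('x set \<Rightarrow> 'a \<Rightarrow> 'b) \<Rightarrow> bool" where
  "algebra_sheaf_hom X R F G \<phi> \<longleftrightarrow>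
     (\<forall>U. open U \<and> U \<subseteq> X \<longrightarrow>
        \<phi> U \<in> ring_hom (sections F U) (sections G U) \<and>
        (\<forall>g\<in>carrier (R U). \<forall>P\<in>carrier (sections F U).
           \<phi> U (g \<odot>\<^bsub>sections F U\<^esub> P) = g \<odot>\<^bsub>sections G U\<^esub> \<phi> U P) \<and>
        (\<forall>V. open V \<and> V \<subseteq> U \<longrightarrow> (\<forall>P\<in>carrier (sections F U).
           \<phi> V (restriction F U V P) = restriction G U V (\<phi> U P))))"

definition sheaf_hom_inj ::
    "('x::topological_space, 'r, 'a) algebra_sheaf \<Rightarrow> ('x set \<Rightarrow> 'a \<Rightarrow> 'b) \<Rightarrow> bool" where
  "sheaf_hom_inj F \<phi> \<longleftrightarrow> (\<forall>U. open U \<longrightarrow> inj_on (\<phi> U) (carrier (sections F U)))"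

definition algebra_sheaf_iso ::
    "'x::topological_space set \<Rightarrow> ('x set \<Rightarrow> 'r ring) \<Rightarrow>
     ('x, 'r, 'a) algebra_sheaf \<Rightarrow> ('x, 'r, 'b) algebra_sheaf \<Rightarrow> ('x set \<Rightarrow> 'a \<Rightarrow> 'b) \<Rightarrow> bool" where
  "algebra_sheaf_iso X R F G \<phi> \<longleftrightarrow>
     algebra_sheaf_hom X R F G \<phi> \<and>
     (\<exists>\<psi>. algebra_sheaf_hom X R G F \<psi> \<and>
        (\<forall>U. open U \<and> U \<subseteq> X \<longrightarrow>
           (\<forall>P\<in>carrier (sections F U). \<psi> U (\<phi> U P) = P) \<and>
           (\<forall>Q\<in>carrier (sections G U). \<phi> U (\<psi> U Q) = Q)))"

definition diffop_sheaf ::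
    "('k::{finite,linorder} space, 'k space \<Rightarrow> complex, 'k op) algebra_sheaf" where
  "diffop_sheaf = \<lparr>sections = diffops, restriction = (\<lambda>U V. op_restrict V)\<rparr>"

section \<open>The quotient by the symmetric group\<close>

definition elem_sym :: "'k::{finite,linorder} space \<Rightarrow> 'k space" where
  "elem_sym x = (\<chi> j. \<Sum>S | card S = card {..j}. \<Prod>i\<in>S. x $ i)"

text \<open>Left actions: on points, functions \<open>f \<mapsto> f \<circ> w\<inverse>\<close> and operators \<open>P \<mapsto> w \<circ> P \<circ> w\<inverse>\<close>.\<close>

definition perm_vec :: "('k::finite \<Rightarrow> 'k) \<Rightarrow> 'k space \<Rightarrow> 'k space" where
  "perm_vec w x = (\<chi> i. x $ inv_into UNIV w i)"

definition perm_fun :: "('k::finite \<Rightarrow> 'k) \<Rightarrow> ('k space \<Rightarrow> complex) \<Rightarrow> 'k space \<Rightarrow> complex" where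
  "perm_fun w f = f \<circ> perm_vec (inv_into UNIV w)"

definition perm_op :: "('k::finite \<Rightarrow> 'k) \<Rightarrow> 'k op \<Rightarrow> 'k op" where
  "perm_op w P = (\<lambda>V f. perm_fun w (P (perm_vec (inv_into UNIV w) ` V) (perm_fun (inv_into UNIV w) f)))"

definition inv_hol :: "('k::{finite,linorder} space) set \<Rightarrow> ('k space \<Rightarrow> complex) set" where
  "inv_hol U = {f \<in> carrier (hol (elem_sym -` U)). \<forall>w. w permutes UNIV \<longrightarrow> perm_fun w f = f}"

definition pullback ::
    "('k::{finite,linorder} space) set \<Rightarrow> ('k space \<Rightarrow> complex) \<Rightarrow> 'k space \<Rightarrow> complex" where
  "pullback U g = (\<lambda>x\<in>elem_sym -` U. g (elem_sym x))"

definition \<theta> ::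
    "('k::{finite,linorder} space) set \<Rightarrow> ('k space \<Rightarrow> complex) \<Rightarrow> 'k space \<Rightarrow> complex" where
  "\<theta> U = inv_into (carrier (hol U)) (pullback U)"

definition inv_diffops ::
    "('k::{finite,linorder} space) set \<Rightarrow> ('k space \<Rightarrow> complex, 'k op) module" where
  "inv_diffops U = (diffops (elem_sym -` U))
     \<lparr>carrier := {P \<in> carrier (diffops (elem_sym -` U)). \<forall>w. w permutes UNIV \<longrightarrow> perm_op w P = P},
      smult := (\<lambda>g P. pullback U g \<odot>\<^bsub>diffops (elem_sym -` U)\<^esub> P)\<rparr>"

definition inv_diffop_sheaf ::
    "('k::{finite,linorder} space, 'k space \<Rightarrow> complex, 'k op) algebra_sheaf" where
  "inv_diffop_sheaf =
     \<lparr>sections = inv_diffops, restriction = (\<lambda>U V. op_restrict (elem_sym -` V))\<rparr>"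

text \<open>
  The map \<open>elem_sym\<close> is surjective, and the value at \<open>\<sigma>\<close> is independent of the choice of \<open>x\<close> in
  the fibre over \<open>\<sigma>\<close>: see \<open>discriminant_elem_sym\<close>.
\<close>

definition discriminant :: "'k::{finite,linorder} space \<Rightarrow> complex" where
  "discriminant \<sigma> =
     (THE d. \<exists>x. elem_sym x = \<sigma> \<and> d = (\<Prod>(i, j) | i < j. (x $ i - x $ j)\<^sup>2))"

lemma surj_rank:
  assumes "1 \<le> n" "n \<le> card (UNIV :: 'k set)"
  obtains j :: "'k::{finite,linorder}" where "card {..j} = n"
proof -
  have "inj (\<lambda>j::'k. card {..j})"
  proof (rule linorder_injI)
    fix x y :: 'k assume "x < y"
    then have "{..x} \<subset> {..y}" by auto
    then show "card {..x} \<noteq> card {..y}" by (metis finite nat_neq_iff psubset_card_mono)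
  qed
  moreover have "range (\<lambda>j::'k. card {..j}) \<subseteq> {1..CARD('k)}"
  proof
    fix n assume "n \<in> range (\<lambda>j::'k. card {..j})"
    then obtain j :: 'k where n: "n = card {..j}" by auto
    have "card {..j} > 0" by (auto simp: card_gt_0_iff)
    moreover have "card {..j} \<le> CARD('k)" by (rule card_mono) auto
    ultimately show "n \<in> {1..CARD('k)}" using n by auto
  qed
  ultimately have "range (\<lambda>j::'k. card {..j}) = {1..CARD('k)}"
    by (intro card_subset_eq) (auto simp: card_image)
  with assms show ?thesis using that by (metis atLeastAtMost_iff imageE)
qed

lemma prod_elem_sym:
  fixes x :: "'k::{finite,linorder} space"
  shows "(\<Prod>i\<in>UNIV. t - x $ i) =
    (\<Sum>n\<le>CARD('k). (-1) ^ n * t ^ (CARD('k) - n) * (\<Sum>S | card S = n. \<Prod>i\<in>S. x $ i))"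
proof -
  have "(\<Prod>i\<in>UNIV. t - x $ i) = (\<Prod>i\<in>UNIV. - (x $ i) + t)"
    by simp
  also have "\<dots> = (\<Sum>S\<in>UNIV. (\<Prod>i\<in>S. - (x $ i)) * (\<Prod>i\<in>UNIV - S. t))"
    by (subst prod_add) auto
  also have "\<dots> = (\<Sum>S\<in>UNIV. (-1) ^ card S * t ^ (CARD('k) - card S) * (\<Prod>i\<in>S. x $ i))"
    by (intro sum.cong) (auto simp: prod_uminus card_Diff_subset)
  also have "\<dots> = (\<Sum>n\<le>CARD('k). \<Sum>S | S \<in> UNIV \<and> card S = n.
      (-1) ^ card S * t ^ (CARD('k) - card S) * (\<Prod>i\<in>S. x $ i))"
    by (intro sum.group [symmetric]) (auto intro: card_mono)
  finally show ?thesis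
    by (simp add: sum_distrib_left)
qed

lemma elem_sym_eq_imp_perm:
  fixes x y :: "'k::{finite,linorder} space"
  assumes "elem_sym x = elem_sym y"
  obtains w where "w permutes UNIV" "\<And>i. x $ i = y $ w i"
proof -
  have eq: "(\<Sum>S | card S = n. \<Prod>i\<in>S. x $ i) = (\<Sum>S | card S = n. \<Prod>i\<in>S. y $ i)"
    if "n \<le> CARD('k)" for n
  proof (cases "n = 0")
    case True
    then have "{S :: 'k set. card S = n} = {{}}" by auto
    then show ?thesis by simp
  next
    case False
    then obtain j :: 'k where "card {..j} = n" using \<open>n \<le> _\<close> surj_rank[of n] by auto
    then show ?thesis using arg_cong[OF assms, of "\<lambda>v. v $ j"] by (simp add: elem_sym_def)
  qed
  have "poly (\<Prod>i\<in>UNIV. [:- (x $ i), 1:]) = poly (\<Prod>i\<in>UNIV. [:- (y $ i), 1:])"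
    using eq prod_elem_sym[of _ x] prod_elem_sym[of _ y] by (auto simp: poly_prod)
  then have "proots (\<Prod>i\<in>UNIV. [:- (x $ i), 1:]) = proots (\<Prod>i\<in>UNIV. [:- (y $ i), 1:])"
    by (simp only: poly_eq_poly_eq_iff)
  then have "image_mset (($) x) (mset_set UNIV) = image_mset (($) y) (mset_set UNIV)"
    by (simp add: proots_prod sum_unfold_sum_mset)
  then obtain w where "w permutes UNIV" "\<forall>i\<in>UNIV. x $ i = y $ w i"
    using image_mset_eq_implies_permutes[of UNIV "($) x" "($) y"] by auto
  then show ?thesis using that by auto
qed

lemma prod_pairs_eq:
  fixes x :: "'k::{finite,linorder} space"
  shows "(\<Prod>(i, j) | i \<noteq> j. x $ i - x $ j) =
    (-1) ^ card {(i::'k, j). i < j} * (\<Prod>(i, j) | i < j. (x $ i - x $ j)\<^sup>2)"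
proof -
  have split: "{(i::'k, j). i \<noteq> j} = {(i, j). i < j} \<union> {(i, j). j < i}"
    by auto
  have "(\<Prod>(i, j) | i \<noteq> j. x $ i - x $ j) =
      (\<Prod>(i, j) | i < j. x $ i - x $ j) * (\<Prod>(i, j) | j < i. x $ i - x $ j)"
    unfolding split by (intro prod.union_disjoint) auto
  also have "(\<Prod>(i, j) | j < i. x $ i - x $ j) = (\<Prod>(i, j) | i < j. - (x $ i - x $ j))"
    by (rule prod.reindex_bij_witness[of _ prod.swap prod.swap]) auto
  also have "\<dots> = (-1) ^ card {(i::'k, j). i < j} * (\<Prod>(i, j) | i < j. x $ i - x $ j)"
    unfolding case_prod_unfold by (subst prod_uminus) simp
  finally show ?thesis
    by (simp add: power2_eq_square case_prod_unfold prod.distrib)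
qed

lemma discriminant_elem_sym:
  "discriminant (elem_sym x) = (\<Prod>(i, j) | i < j. (x $ i - x $ j)\<^sup>2)"
  unfolding discriminant_def
proof (rule the_equality)
  fix d assume "\<exists>y. elem_sym y = elem_sym x \<and> d = (\<Prod>(i, j) | i < j. (y $ i - y $ j)\<^sup>2)"
  then obtain y where y: "elem_sym y = elem_sym x" "d = (\<Prod>(i, j) | i < j. (y $ i - y $ j)\<^sup>2)"
    by blast
  obtain w where w: "w permutes UNIV" "\<And>i. y $ i = x $ w i"
    using elem_sym_eq_imp_perm[OF y(1)] by blast
  have "(\<Prod>(i, j) | i \<noteq> j. y $ i - y $ j) = (\<Prod>(i, j) | i \<noteq> j. x $ i - x $ j)"
    by (rule prod.reindex_bij_witness[of _ "map_prod (inv_into UNIV w) (inv_into UNIV w)" "map_prod w w"])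
      (auto simp: w permutes_inverses[OF w(1)] inj_eq[OF permutes_inj[OF w(1)]]
        inj_eq[OF permutes_inj[OF permutes_inv[OF w(1)]]])
  then show "d = (\<Prod>(i, j) | i < j. (x $ i - x $ j)\<^sup>2)"
    unfolding prod_pairs_eq y(2) by simp
qed blast

end

theory Submission
  imports Defs "HOL-Complex_Analysis.Complex_Analysis"
    "HOL-Computational_Algebra.Fundamental_Theorem_Algebra"
begin

text \<open>
  An invariant operator \<open>P\<close> over \<open>elem_sym -` U\<close> maps invariant functions to
  invariant functions. Invariant functions over \<open>elem_sym -` V\<close> are exactly the pull-backs of
  holomorphic functions on \<open>V\<close> (\<open>inv_hol_descends\<close>), so there is a unique endomorphism \<open>Q\<close> of the
  sheaf of holomorphic functions on \<open>U\<close> with \<open>P (g \<circ> elem_sym) = Q g \<circ> elem_sym\<close>. This relation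
  between \<open>P\<close> and \<open>Q\<close> is called \<open>related\<close>; the morphism \<open>\<Xi>\<close> sends \<open>P\<close> to the \<open>Q\<close> related to it. Since
  \<open>related\<close> is visibly compatible with sums, products, scalars and restrictions, so is \<open>\<Xi>\<close>.

  The point that needs an argument is that \<open>Q\<close> is a differential operator also along the
  discriminant, where \<open>elem_sym\<close> is not a local isomorphism and coefficients cannot be transported.
  It is settled by a description of differential operators without coefficients (\<open>diffop_iff\<close>):
  they are the linear endomorphisms \<open>Q\<close> such that, locally for some \<open>m\<close>, the value \<open>Q f y\<close> is zero
  whenever \<open>f\<close> vanishes at \<open>y\<close> to order greater than \<open>m\<close>, in the sense
  \<open>f x = O(norm (x - y) ^ (m + 1))\<close>. The coefficients of such a \<open>Q\<close> are recovered as
  \<open>Q ((x - y) ^ \<alpha>) (y) / \<alpha>!\<close>, by Taylor's formula. This growth condition is obviously stable under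
  composition with a differentiable map, so it passes from \<open>P\<close> to \<open>Q\<close> through \<open>elem_sym\<close>
  (\<open>related_diffop_right\<close>), and from \<open>Q\<close> to \<open>P\<close> through local inverses of \<open>elem_sym\<close> where these exist
  (\<open>related_diffop_left\<close>).

  Near a point with pairwise distinct coordinates \<open>elem_sym\<close> is biholomorphic, every holomorphic
  function is locally a pull-back, and so \<open>P\<close> is determined there by \<open>Q\<close> (\<open>related_chart\<close>). Such points
  are dense, so \<open>P\<close> is determined by \<open>Q\<close> everywhere (\<open>related_unique_left\<close>): \<open>\<Xi>\<close> is injective. Over
  the complement of the discriminant the same formula defines, for every \<open>Q\<close>, an operator \<open>P\<close> related
  to it (\<open>related_exists_left\<close>); uniqueness makes \<open>P\<close> invariant, and \<open>\<Xi>\<close> is an isomorphism there.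

  What is needed from the theory of several complex variables comes from one tool, Cauchy
  integrals over a circle in one coordinate: partial derivatives of holomorphic functions are
  holomorphic, and a continuous function that is holomorphic off the discriminant is holomorphic.
\<close>

section \<open>Holomorphic functions of several variables\<close>

text \<open>
  Unlike membership in \<open>carrier (hol U)\<close>, this leaves the values outside of \<open>U\<close> arbitrary, so that it
  can be combined with ordinary terms.
\<close>

definition hol_on :: "('k::finite space \<Rightarrow> complex) \<Rightarrow> 'k space set \<Rightarrow> bool" (infix "hol'_on" 50)
  where "f hol_on U \<longleftrightarrow> (\<forall>x\<in>U. complex_differentiable_at f x)"

lemma axis_conv_smult: "axis i (t::complex) = t *s axis i 1"
  by (simp add: vec_eq_iff axis_def)

lemma norm_axis_complex [simp]: "norm (axis i t :: complex ^ 'k::finite) = norm t"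
proof -
  have "(norm ((axis i t :: complex ^ 'k) $ j))\<^sup>2 = (if j = i then (norm t)\<^sup>2 else 0)" for j
    by (simp add: axis_def)
  then show ?thesis by (simp add: norm_vec_def L2_set_def)
qed

lemma norm_smult_complex: "norm (t *s v :: complex ^ 'k::finite) = norm t * norm v"
proof -
  have "(\<Sum>j\<in>UNIV. (norm ((t *s v) $ j))\<^sup>2) = (norm t)\<^sup>2 * (\<Sum>j\<in>UNIV. (norm (v $ j))\<^sup>2)"
    by (simp add: norm_mult power_mult_distrib sum_distrib_left)
  then show ?thesis by (simp add: norm_vec_def L2_set_def real_sqrt_mult)
qed

lemma bounded_linear_smult_left: "bounded_linear (\<lambda>t::complex. t *s (v :: complex ^ 'k::finite))"
  by (rule bounded_linear_intro[of _ "norm v"])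
     (auto simp: vec_eq_iff norm_smult_complex algebra_simps)

lemma bounded_linear_axis: "bounded_linear (axis i :: complex \<Rightarrow> complex ^ 'k::finite)"
  by (rule bounded_linear_intro[of _ 1]) (auto simp: vec_eq_iff, auto simp: axis_def)

lemmas continuous_on_axis [continuous_intros] = bounded_linear.continuous_on[OF bounded_linear_axis]

lemma complex_differentiable_const: "complex_differentiable_at (\<lambda>x. c) x"
  unfolding complex_differentiable_at_def by (rule exI[of _ "\<lambda>_. 0"]) auto

lemma complex_differentiable_coord: "complex_differentiable_at (\<lambda>x. x $ i) x"
  unfolding complex_differentiable_at_def
  by (rule exI[of _ "\<lambda>v. v $ i"]) (auto intro!: bounded_linear_imp_has_derivative bounded_linear_vec_nth)

lemma complex_differentiable_add:
  assumes "complex_differentiable_at f x" "complex_differentiable_at g x"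
  shows "complex_differentiable_at (\<lambda>x. f x + g x) x"
proof -
  obtain f' g' where "(f has_derivative f') (at x)" "\<forall>c v. f' (c *s v) = c * f' v"
    "(g has_derivative g') (at x)" "\<forall>c v. g' (c *s v) = c * g' v"
    using assms unfolding complex_differentiable_at_def by blast
  then show ?thesis unfolding complex_differentiable_at_def
    by (intro exI[of _ "\<lambda>v. f' v + g' v"]) (auto intro: has_derivative_add simp: algebra_simps)
qed

lemma complex_differentiable_mult:
  assumes "complex_differentiable_at f x" "complex_differentiable_at g x"
  shows "complex_differentiable_at (\<lambda>x. f x * g x) x"
proof -
  obtain f' g' where "(f has_derivative f') (at x)" "\<forall>c v. f' (c *s v) = c * f' v"
    "(g has_derivative g') (at x)" "\<forall>c v. g' (c *s v) = c * g' v"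
    using assms unfolding complex_differentiable_at_def by blast
  then show ?thesis unfolding complex_differentiable_at_def
    by (intro exI[of _ "\<lambda>v. f x * g' v + f' v * g x"]) (auto intro: has_derivative_mult simp: algebra_simps)
qed

lemma complex_differentiable_diff:
  assumes "complex_differentiable_at f x" "complex_differentiable_at g x"
  shows "complex_differentiable_at (\<lambda>x. f x - g x) x"
  using complex_differentiable_add[OF assms(1) complex_differentiable_mult[OF complex_differentiable_const[of "-1"] assms(2)]] by simp

lemma complex_differentiable_sum:
  assumes "\<And>i. i \<in> I \<Longrightarrow> complex_differentiable_at (f i) x"
  shows "complex_differentiable_at (\<lambda>x. \<Sum>i\<in>I. f i x) x"
  using assms by (induction I rule: infinite_finite_induct) (auto intro: complex_differentiable_add complex_differentiable_const)

lemma complex_differentiable_prod: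
  assumes "\<And>i. i \<in> I \<Longrightarrow> complex_differentiable_at (f i) x"
  shows "complex_differentiable_at (\<lambda>x. \<Prod>i\<in>I. f i x) x"
  using assms by (induction I rule: infinite_finite_induct) (auto intro: complex_differentiable_mult complex_differentiable_const)

lemma complex_differentiable_power:
  assumes "complex_differentiable_at f x"
  shows "complex_differentiable_at (\<lambda>x. f x ^ n) x"
  using assms by (induction n) (auto intro: complex_differentiable_mult complex_differentiable_const)

lemmas complex_differentiable_intros = complex_differentiable_const complex_differentiable_coord complex_differentiable_add complex_differentiable_mult complex_differentiable_diff complex_differentiable_sum complex_differentiable_prod complex_differentiable_power

lemma complex_differentiable_cong:
  assumes "open U" "x \<in> U" "\<And>y. y \<in> U \<Longrightarrow> f y = g y"
  shows "complex_differentiable_at f x \<longleftrightarrow> complex_differentiable_at g x"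
  using has_derivative_transform_within_open[of f _ x UNIV U g]
    has_derivative_transform_within_open[of g _ x UNIV U f] assms
  unfolding complex_differentiable_at_def by (metis)

lemma complex_differentiable_compose:
  assumes "(H has_derivative H') (at x)" "\<And>c v. H' (c *s v) = c *s H' v"
    and "complex_differentiable_at f (H x)"
  shows "complex_differentiable_at (\<lambda>x. f (H x)) x"
proof -
  obtain f' where "(f has_derivative f') (at (H x))" "\<forall>c v. f' (c *s v) = c * f' v"
    using assms(3) unfolding complex_differentiable_at_def by blast
  then show ?thesis unfolding complex_differentiable_at_def
    using has_derivative_compose[OF assms(1), of f f'] assms(2)
    by (intro exI[of _ "\<lambda>v. f' (H' v)"]) auto
qed

lemma complex_differentiable_continuous: "complex_differentiable_at f x \<Longrightarrow> isCont f x"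
  unfolding complex_differentiable_at_def using has_derivative_continuous by blast

text \<open>
  Complex linearity reduces the derivative to its values on the unit vectors, and by the chain rule
  these are the partial derivatives.
\<close>

lemma complex_differentiable_has_derivative:
  assumes "complex_differentiable_at f x"
  shows "(f has_derivative (\<lambda>v. \<Sum>i\<in>UNIV. v $ i * partial i f x)) (at x)"
proof -
  obtain f' where f': "(f has_derivative f') (at x)" "\<And>c v. f' (c *s v) = c * f' v"
    using assms unfolding complex_differentiable_at_def by blast
  have part: "partial i f x = f' (axis i 1)" for i
  proof -
    have "((\<lambda>t. x + axis i t) has_derivative axis i) (at 0)"
      using has_derivative_add[OF has_derivative_const bounded_linear_imp_has_derivative[OF bounded_linear_axis]]
      by force
    then have "((\<lambda>t. f (x + axis i t)) has_derivative (\<lambda>t. f' (axis i t))) (at 0)"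
      using has_derivative_compose[of "\<lambda>t. x + axis i t" "axis i" 0 UNIV f f'] f'(1)
      by (simp add: axis_conv_smult[of i 0])
    moreover have "(\<lambda>t. f' (axis i t)) = (*) (f' (axis i 1))"
      by (rule ext, subst axis_conv_smult) (simp add: f' mult.commute)
    ultimately show ?thesis
      unfolding partial_def by (intro DERIV_imp_deriv) (simp add: has_field_derivative_def)
  qed
  have "f' v = (\<Sum>i\<in>UNIV. v $ i * partial i f x)" for v
  proof -
    have "f' (\<Sum>i\<in>UNIV. v $ i *s axis i 1) = (\<Sum>i\<in>UNIV. f' (v $ i *s axis i 1))"
      using linear_sum[OF has_derivative_linear[OF f'(1)]] .
    then show ?thesis by (simp add: basis_expansion f' part)
  qed
  then have "f' = (\<lambda>v. \<Sum>i\<in>UNIV. v $ i * partial i f x)" by blast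
  with f' show ?thesis by simp
qed

lemma complex_differentiable_line:
  assumes "complex_differentiable_at f (x + t *s v)"
  shows "((\<lambda>t. f (x + t *s v)) has_field_derivative (\<Sum>i\<in>UNIV. v $ i * partial i f (x + t *s v))) (at t)"
proof -
  have "((\<lambda>t. x + t *s v) has_derivative (\<lambda>t. t *s v)) (at t)"
    using has_derivative_add[OF has_derivative_const bounded_linear_imp_has_derivative[OF bounded_linear_smult_left]]
    by force
  from has_derivative_compose[OF this complex_differentiable_has_derivative[OF assms]]
  show ?thesis
    unfolding has_field_derivative_def
    by (rule has_derivative_eq_rhs) (auto simp: sum_distrib_right sum_distrib_left mult_ac)
qed

lemma complex_differentiable_axis:
  assumes "complex_differentiable_at f (x + axis i t)"
  shows "((\<lambda>t. f (x + axis i t)) has_field_derivative partial i f (x + axis i t)) (at t)"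
proof -
  have "(\<Sum>j\<in>UNIV. axis i 1 $ j * partial j f (x + axis i t)) = partial i f (x + axis i t)"
    by (simp add: axis_def if_distrib[of "\<lambda>x. x * _"] cong: if_cong)
  then show ?thesis
    using complex_differentiable_line[of f x t "axis i 1"] assms by (simp add: axis_conv_smult[symmetric])
qed

lemma hol_on_const: "(\<lambda>x. c) hol_on U"
  by (simp add: hol_on_def complex_differentiable_const)

lemma hol_on_add: "f hol_on U \<Longrightarrow> g hol_on U \<Longrightarrow> (\<lambda>x. f x + g x) hol_on U"
  unfolding hol_on_def by (intro ballI complex_differentiable_add) auto

lemma hol_on_mult: "f hol_on U \<Longrightarrow> g hol_on U \<Longrightarrow> (\<lambda>x. f x * g x) hol_on U"
  unfolding hol_on_def by (intro ballI complex_differentiable_mult) auto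

lemma hol_on_coord: "(\<lambda>x. x $ i) hol_on U"
  by (simp add: hol_on_def complex_differentiable_coord)

lemma hol_on_linear: "f hol_on U \<Longrightarrow> g hol_on U \<Longrightarrow> (\<lambda>x. f x + c * g x) hol_on U"
  unfolding hol_on_def by (intro ballI complex_differentiable_add complex_differentiable_mult complex_differentiable_const) auto

lemma hol_on_sum:
  assumes "\<And>j. j \<in> J \<Longrightarrow> g j hol_on U"
  shows "(\<lambda>x. \<Sum>j\<in>J. c j * g j x) hol_on U"
  using assms unfolding hol_on_def by (intro ballI complex_differentiable_sum complex_differentiable_mult complex_differentiable_const) auto

lemma hol_on_subset: "f hol_on U \<Longrightarrow> V \<subseteq> U \<Longrightarrow> f hol_on V"
  by (auto simp: hol_on_def)

lemma hol_on_continuous: "f hol_on U \<Longrightarrow> continuous_on U f"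
  by (auto simp: hol_on_def intro!: continuous_at_imp_continuous_on complex_differentiable_continuous)

lemma hol_on_cong:
  assumes "open U" "\<And>y. y \<in> U \<Longrightarrow> f y = g y" "f hol_on U"
  shows "g hol_on U"
  using assms complex_differentiable_cong unfolding hol_on_def by metis

lemma hol_on_axis_holomorphic:
  assumes "f hol_on U" "\<And>t. t \<in> T \<Longrightarrow> x + axis i t \<in> U"
  shows "(\<lambda>t. f (x + axis i t)) holomorphic_on T"
  unfolding holomorphic_on_def
  using assms complex_differentiable_axis field_differentiable_at_within field_differentiable_def
  unfolding hol_on_def by blast

section \<open>Cauchy integrals in one coordinate\<close>

text \<open>
  With the weight \<open>1 / t\<close> or \<open>1 / t\<^sup>2\<close> this is, up to the factor \<open>2 * pi * \<i>\<close>, Cauchy's formula for \<open>f\<close>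
  or for its \<open>i\<close>-th partial derivative. It depends on the values of \<open>f\<close> on the translated
  circle only, so it can be regular in \<open>x\<close> where nothing is known about \<open>f\<close>.
\<close>

definition circle_mean :: "'k::finite \<Rightarrow> real \<Rightarrow> (complex \<Rightarrow> complex) \<Rightarrow> ('k space \<Rightarrow> complex) \<Rightarrow> 'k space \<Rightarrow> complex"
  where "circle_mean i r \<phi> f x = contour_integral (circlepath 0 r) (\<lambda>t. f (x + axis i t) * \<phi> t)"

lemma circle_mean_integral:
  "circle_mean i r \<phi> f x = integral (cbox 0 1)
     (\<lambda>u. f (x + axis i (circlepath 0 r u)) * (\<phi> (circlepath 0 r u) * vector_derivative (circlepath 0 r) (at u)))"
  unfolding circle_mean_def contour_integral_integral by (simp add: mult.assoc)

lemma circlepath_in_sphere: "0 \<le> r \<Longrightarrow> circlepath 0 r u \<in> sphere 0 r"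
  by (simp add: circlepath norm_mult)

lemma continuous_on_circlepath: "continuous_on S (circlepath z r)"
  unfolding circlepath_def part_circlepath_def by (intro continuous_intros)

lemma continuous_on_circle_weight:
  assumes "0 \<le> r" "continuous_on (sphere 0 r) \<phi>"
  shows "continuous_on S (\<lambda>u. \<phi> (circlepath 0 r u) * vector_derivative (circlepath 0 r) (at u))"
proof (rule continuous_on_mult)
  show "continuous_on S (\<lambda>u. \<phi> (circlepath 0 r u))"
    using circlepath_in_sphere[OF assms(1)]
    by (intro continuous_on_compose2[OF assms(2) continuous_on_circlepath]) blast
  show "continuous_on S (\<lambda>u. vector_derivative (circlepath 0 r) (at u))"
    unfolding vector_derivative_circlepath by (intro continuous_intros)
qed

lemma continuous_on_circle_shift:
  assumes "continuous_on O' f" "0 \<le> r" "\<And>x t. x \<in> B \<Longrightarrow> norm t = r \<Longrightarrow> x + axis i t \<in> O'"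
  shows "continuous_on (B \<times> S) (\<lambda>p. f (fst p + axis i (circlepath 0 r (snd p))))"
proof (rule continuous_on_compose2[OF assms(1)])
  show "continuous_on (B \<times> S) (\<lambda>p. fst p + axis i (circlepath 0 r (snd p)))"
    by (intro continuous_on_add continuous_on_axis continuous_on_fst continuous_on_id
        continuous_on_compose2[OF continuous_on_circlepath[of UNIV 0 r], of _ snd] continuous_on_snd) auto
  show "(\<lambda>p. fst p + axis i (circlepath 0 r (snd p))) ` (B \<times> S) \<subseteq> O'"
    using assms(3) circlepath_in_sphere[OF assms(2)] by auto
qed

lemma circle_mean_continuous:
  assumes "continuous_on O' f" "0 \<le> r" "continuous_on (sphere 0 r) \<phi>"
    and "\<And>x t. x \<in> B \<Longrightarrow> norm t = r \<Longrightarrow> x + axis i t \<in> O'"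
  shows "continuous_on B (circle_mean i r \<phi> f)"
proof -
  define w where "w = (\<lambda>u. \<phi> (circlepath 0 r u) * vector_derivative (circlepath 0 r) (at u))"
  have "continuous_on (B \<times> cbox 0 1) (\<lambda>p. w (snd p))"
    by (rule continuous_on_compose2[of UNIV w])
      (auto simp: w_def intro!: continuous_on_circle_weight[OF assms(2,3)] continuous_on_snd continuous_on_id)
  then have "continuous_on (B \<times> cbox 0 1) (\<lambda>p. f (fst p + axis i (circlepath 0 r (snd p))) * w (snd p))"
    by (intro continuous_on_mult continuous_on_circle_shift[OF assms(1,2,4)]) auto
  then have "continuous_on B (\<lambda>x. integral (cbox 0 1) (\<lambda>u. f (x + axis i (circlepath 0 r u)) * w u))"
    by (intro integral_continuous_on_param) (simp add: case_prod_unfold)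
  then show ?thesis by (simp add: circle_mean_integral[abs_def] w_def)
qed

lemma cauchy_partial:
  assumes "f hol_on U" "0 < r" "cball x r \<subseteq> U"
  shows "partial i f x = 1 / (2 * of_real pi * \<i>) * circle_mean i r (\<lambda>t. 1 / t ^ 2) f x"
proof -
  have "(\<lambda>t. f (x + axis i t)) holomorphic_on cball 0 r"
    using assms by (intro hol_on_axis_holomorphic[of f U]) (auto simp: subset_iff dist_norm)
  then have "contour_integral (circlepath 0 r) (\<lambda>t. f (x + axis i t) / (t - 0) ^ 2)
     = 2 * pi * \<i> * deriv (\<lambda>t. f (x + axis i t)) 0"
    using assms(2) ball_subset_cball
    by (intro Cauchy_contour_integral_circlepath_2) (auto intro: holomorphic_on_imp_continuous_on holomorphic_on_subset)
  then show ?thesis unfolding partial_def circle_mean_def by simp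
qed

lemma partial_continuous_on:
  assumes "f hol_on U" "open U"
  shows "continuous_on U (partial i f)"
proof (rule continuous_at_imp_continuous_on, rule ballI)
  fix a assume "a \<in> U"
  then obtain e where e: "e > 0" "cball a e \<subseteq> U" using assms(2) open_contains_cball by blast
  define r where "r = e / 2"
  have r: "r > 0" and sub: "cball x r \<subseteq> U" if "x \<in> ball a r" for x
  proof -
    show "r > 0" using e r_def by simp
    have "cball x r \<subseteq> cball a e" using that unfolding r_def cball_subset_cball_iff
      by (simp add: dist_commute)
    then show "cball x r \<subseteq> U" using e by blast
  qed
  have "continuous_on (ball a r) (circle_mean i r (\<lambda>t. 1 / t ^ 2) f)"
    using e(1) r_def sub
    by (intro circle_mean_continuous[OF hol_on_continuous[OF assms(1)]] continuous_intros)
       (auto simp: subset_iff dist_norm)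
  then have "continuous_on (ball a r) (\<lambda>x. 1 / (2 * of_real pi * \<i>) * circle_mean i r (\<lambda>t. 1 / t ^ 2) f x)"
    by (intro continuous_intros)
  then have "continuous_on (ball a r) (partial i f)"
    using cauchy_partial[OF assms(1) r sub] by (subst continuous_on_cong[OF refl]) auto
  moreover have "a \<in> ball a r" using e r_def by simp
  ultimately show "isCont (partial i f) a"
    by (simp add: continuous_on_eq_continuous_at)
qed

text \<open>
  Differentiation under the integral sign; the \<open>C\<^sup>1\<close> hypothesis of that theorem is supplied by the
  continuity of the partial derivatives. The derivative of the integral is an integral of complex
  linear maps, hence complex linear.
\<close>

lemma circle_mean_hol_on:
  assumes hol: "f hol_on O'" and op: "open O'" and r: "0 \<le> r" and \<phi>: "continuous_on (sphere 0 r) \<phi>"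
    and sub: "\<And>x t. x \<in> ball a d \<Longrightarrow> norm t = r \<Longrightarrow> x + axis i t \<in> O'"
  shows "circle_mean i r \<phi> f hol_on ball a d"
  unfolding hol_on_def
proof
  fix x0 assume x0: "x0 \<in> ball a d"
  define w where "w = (\<lambda>u. \<phi> (circlepath 0 r u) * vector_derivative (circlepath 0 r) (at u))"
  define F where "F = (\<lambda>x u. f (x + axis i (circlepath 0 r u)) * w u)"
  define L where "L = (\<lambda>x u v. (\<Sum>j\<in>UNIV. v $ j * partial j f (x + axis i (circlepath 0 r u))) * w u)"
  define F' where "F' = (\<lambda>x u. Blinfun (L x u))"
  have cont_w: "continuous_on S w" for S
    unfolding w_def by (rule continuous_on_circle_weight[OF r \<phi>])
  have bl: "bounded_linear (L x u)" for x u
    unfolding L_def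
    by (intro bounded_linear_mult_const bounded_linear_sum bounded_linear_vec_nth)
  have F'[simp]: "blinfun_apply (F' x u) = L x u" for x u
    unfolding F'_def by (rule bounded_linear_Blinfun_apply[OF bl])
  have L_smult: "L x u (c *s v) = c * L x u v" for x u c v
    unfolding L_def by (simp add: sum_distrib_right sum_distrib_left mult_ac)
  have cont_L: "continuous_on (ball a d \<times> cbox 0 1) (\<lambda>p. L (fst p) (snd p) v)" for v
    unfolding L_def
    by (intro continuous_on_mult continuous_on_sum continuous_on_const
        continuous_on_circle_shift[OF partial_continuous_on[OF hol op] r sub]
        continuous_on_compose2[OF cont_w[of UNIV], of _ snd] continuous_on_snd continuous_on_id) auto
  have cont_F': "continuous_on (ball a d \<times> cbox 0 1) (\<lambda>(x, u). F' x u)"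
    by (rule continuous_on_blinfun_componentwise) (use cont_L in \<open>simp add: case_prod_unfold\<close>)
  have cont_sec: "continuous_on (cbox 0 1) (F' x0)"
  proof -
    have "continuous_on (cbox 0 1) (\<lambda>u. (\<lambda>(x, u). F' x u) (x0, u))"
      using x0 by (intro continuous_on_compose2[OF cont_F'] continuous_on_Pair continuous_on_const
          continuous_on_id) auto
    then show ?thesis by simp
  qed
  have "((\<lambda>x. integral (cbox 0 1) (F x)) has_derivative integral (cbox 0 1) (F' x0)) (at x0 within ball a d)"
  proof (rule leibniz_rule[OF _ _ cont_F' x0 convex_ball])
    fix x u assume x: "x \<in> ball a d" and u: "u \<in> cbox 0 (1::real)"
    have "complex_differentiable_at f (x + axis i (circlepath 0 r u))"
      using hol sub[OF x] circlepath_in_sphere[OF r] unfolding hol_on_def by simp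
    then have "((\<lambda>x. f (x + axis i (circlepath 0 r u))) has_derivative
       (\<lambda>v. \<Sum>j\<in>UNIV. v $ j * partial j f (x + axis i (circlepath 0 r u)))) (at x within ball a d)"
      by (intro has_derivative_compose[OF has_derivative_add_const[OF has_derivative_ident] complex_differentiable_has_derivative])
    then show "((\<lambda>x. F x u) has_derivative blinfun_apply (F' x u)) (at x within ball a d)"
      unfolding F_def F' L_def by (rule has_derivative_mult_left)
  next
    fix x assume x: "x \<in> ball a d"
    have "continuous_on ({x} \<times> cbox 0 1) (\<lambda>p. f (fst p + axis i (circlepath 0 r (snd p))))"
      using x by (intro continuous_on_circle_shift[OF hol_on_continuous[OF hol] r]) (auto simp: sub)
    then have "continuous_on (cbox 0 1) (\<lambda>u. f (fst (x, u) + axis i (circlepath 0 r (snd (x, u)))))"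
      by (rule continuous_on_compose2) (auto intro: continuous_on_Pair continuous_on_const continuous_on_id)
    then show "F x integrable_on cbox 0 1"
      unfolding F_def by (intro integrable_continuous continuous_on_mult cont_w) simp
  qed
  moreover have "blinfun_apply (integral (cbox 0 1) (F' x0)) (c *s v) = c * blinfun_apply (integral (cbox 0 1) (F' x0)) v" for c v
    using blinfun_apply_integral[OF integrable_continuous[OF cont_sec]] L_smult by simp
  moreover have "circle_mean i r \<phi> f = (\<lambda>x. integral (cbox 0 1) (F x))"
    unfolding F_def w_def by (rule ext) (rule circle_mean_integral)
  ultimately show "complex_differentiable_at (circle_mean i r \<phi> f) x0"
    unfolding complex_differentiable_at_def at_within_open[OF x0 open_ball]
    by (intro exI[of _ "blinfun_apply (integral (cbox 0 1) (F' x0))"]) simp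
qed

lemma partial_hol_on:
  assumes "f hol_on U" "open U"
  shows "partial i f hol_on U"
  unfolding hol_on_def
proof
  fix a assume "a \<in> U"
  then obtain e where e: "e > 0" "cball a e \<subseteq> U" using assms(2) open_contains_cball by blast
  define r where "r = e / 2"
  have sub: "cball x r \<subseteq> U" if "x \<in> ball a r" for x
  proof -
    have "cball x r \<subseteq> cball a e" using that unfolding r_def cball_subset_cball_iff
      by (simp add: dist_commute)
    then show "cball x r \<subseteq> U" using e by blast
  qed
  have r: "r > 0" using e r_def by simp
  have "circle_mean i r (\<lambda>t. 1 / t ^ 2) f hol_on ball a r"
  proof (rule circle_mean_hol_on[OF assms])
    show "continuous_on (sphere 0 r) (\<lambda>t::complex. 1 / t ^ 2)"
      using r by (intro continuous_intros) auto
    show "x + axis i t \<in> U" if "x \<in> ball a r" "norm t = r" for x t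
      using sub[OF that(1)] that(2) by (auto simp: subset_iff dist_norm)
  qed (use r in simp)
  then have "(\<lambda>x. 1 / (2 * of_real pi * \<i>) * circle_mean i r (\<lambda>t. 1 / t ^ 2) f x) hol_on ball a r"
    unfolding hol_on_def using complex_differentiable_mult[OF complex_differentiable_const, of "circle_mean i r (\<lambda>t. 1 / t ^ 2) f"] by blast
  then have "partial i f hol_on ball a r"
    by (rule hol_on_cong[OF open_ball, rotated]) (simp only: cauchy_partial[OF assms(1) r sub])
  then show "complex_differentiable_at (partial i f) a"
    using r unfolding hol_on_def by simp
qed

section \<open>Order of vanishing and Taylor expansion\<close>

text \<open>
  A growth condition instead of the vanishing of partial derivatives: it is evidently stable
  under composition with differentiable maps. For holomorphic functions the two
  are linked by \<open>vanishes_imp_partials_zero\<close> and \<open>taylor_vanishes\<close>.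
\<close>

definition vanishes :: "nat \<Rightarrow> ('k::finite space \<Rightarrow> complex) \<Rightarrow> 'k space \<Rightarrow> bool" where
  "vanishes n f y \<longleftrightarrow> (\<exists>C r. 0 < r \<and> (\<forall>x\<in>ball y r. norm (f x) \<le> C * norm (x - y) ^ n))"

lemma vanishes_cong:
  assumes "open V" "y \<in> V" "\<And>x. x \<in> V \<Longrightarrow> f x = g x" "vanishes n f y"
  shows "vanishes n g y"
proof -
  obtain e where e: "e > 0" "ball y e \<subseteq> V" using assms(1,2) open_contains_ball by blast
  obtain C r where r: "0 < r" "\<And>x. x \<in> ball y r \<Longrightarrow> norm (f x) \<le> C * norm (x - y) ^ n"
    using assms(4) unfolding vanishes_def by blast
  show ?thesis unfolding vanishes_def
  proof (rule exI[of _ C], rule exI[of _ "min e r"], intro conjI ballI)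
    fix x assume "x \<in> ball y (min e r)"
    then show "norm (g x) \<le> C * norm (x - y) ^ n" using r(2)[of x] e assms(3)[of x] by auto
  qed (use e r in auto)
qed

lemma vanishes_Suc_imp_zero: "vanishes (Suc n) f y \<Longrightarrow> f y = 0"
  unfolding vanishes_def by (metis centre_in_ball cancel_comm_monoid_add_class.diff_cancel
      mult_zero_right norm_le_zero_iff norm_zero power_0_Suc)

lemma vanishes_compose:
  assumes H: "(H has_derivative H') (at x)" and f: "vanishes n f (H x)"
  shows "vanishes n (\<lambda>z. f (H z)) x"
proof -
  obtain C r where r: "0 < r" "\<And>z. z \<in> ball (H x) r \<Longrightarrow> norm (f z) \<le> C * norm (z - H x) ^ n"
    using f unfolding vanishes_def by blast
  obtain d where d: "d > 0" "\<And>z. norm (z - x) < d \<Longrightarrow> norm (H z - H x - H' (z - x)) \<le> norm (z - x)"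
    using H unfolding has_derivative_at_alt by (metis mult_1 zero_less_one)
  obtain K where K: "\<And>v. norm (H' v) \<le> norm v * K"
    using bounded_linear.bounded has_derivative_bounded_linear[OF H] by blast
  have lip: "norm (H z - H x) \<le> (1 + \<bar>K\<bar>) * norm (z - x)" if "norm (z - x) < d" for z
  proof -
    have "norm (H z - H x) \<le> norm (H z - H x - H' (z - x)) + norm (H' (z - x))"
      by (metis diff_add_cancel norm_triangle_ineq)
    also have "\<dots> \<le> norm (z - x) + norm (z - x) * K" using d(2)[OF that] K by (meson add_mono)
    also have "\<dots> \<le> (1 + \<bar>K\<bar>) * norm (z - x)"
      by (simp add: algebra_simps mult_right_mono)
    finally show ?thesis .
  qed
  show ?thesis unfolding vanishes_def
  proof (rule exI[of _ "\<bar>C\<bar> * (1 + \<bar>K\<bar>) ^ n"], rule exI[of _ "min d (r / (1 + \<bar>K\<bar>))"], intro conjI ballI)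
    show "0 < min d (r / (1 + \<bar>K\<bar>))" using d r by simp
    fix z assume z: "z \<in> ball x (min d (r / (1 + \<bar>K\<bar>)))"
    then have zd: "norm (z - x) < d" and zr: "(1 + \<bar>K\<bar>) * norm (z - x) < r"
      by (auto simp: dist_norm norm_minus_commute pos_less_divide_eq mult.commute)
    have "norm (f (H z)) \<le> C * norm (H z - H x) ^ n"
      using r(2)[of "H z"] lip[OF zd] zr by (auto simp: dist_norm norm_minus_commute)
    also have "\<dots> \<le> \<bar>C\<bar> * ((1 + \<bar>K\<bar>) * norm (z - x)) ^ n"
      using lip[OF zd] by (intro mult_mono power_mono) auto
    finally show "norm (f (H z)) \<le> \<bar>C\<bar> * (1 + \<bar>K\<bar>) ^ n * norm (z - x) ^ n"
      by (simp add: power_mult_distrib mult.assoc)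
  qed
qed

text \<open>
  Cauchy's inequality at \<open>x\<close> on a circle of radius \<open>norm (x - y)\<close>: on it \<open>f\<close> is at most a multiple of
  \<open>norm (x - y) ^ (n + 1)\<close>, and division by the radius costs one power. At \<open>x = y\<close> there is no such
  circle, and the bound follows by continuity.
\<close>

lemma vanishes_partial:
  fixes f :: "'k::finite space \<Rightarrow> complex"
  assumes hol: "f hol_on U" and op: "open U" and y: "y \<in> U" and van: "vanishes (Suc n) f y"
  shows "vanishes n (partial i f) y"
proof -
  obtain C r where r: "0 < r" "\<And>x. x \<in> ball y r \<Longrightarrow> norm (f x) \<le> C * norm (x - y) ^ Suc n"
    using van unfolding vanishes_def by blast
  obtain e where e: "e > 0" "ball y e \<subseteq> U" using op y open_contains_ball by blast
  \<comment> \<open>half of the radius, so that circles around points of the ball that reach \<open>y\<close> stay in the domain\<close>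
  define s where "s = min e r / 2"
  \<comment> \<open>points of the circle of radius \<open>norm (x - y)\<close> around \<open>x\<close> have at most twice this distance from \<open>y\<close>\<close>
  define D where "D = \<bar>C\<bar> * 2 ^ Suc n"
  have s: "s > 0" using r e s_def by simp
  have bound: "norm (partial i f x) \<le> D * norm (x - y) ^ n" if x: "x \<in> ball y s" "x \<noteq> y" for x
  proof -
    define \<rho> where "\<rho> = norm (x - y)"
    have \<rho>: "0 < \<rho>" "\<rho> < s" using x by (auto simp: \<rho>_def dist_norm norm_minus_commute)
    have near: "x + axis i t \<in> ball y (2 * s)" "norm (x + axis i t - y) \<le> 2 * \<rho>" if "norm t \<le> \<rho>" for t
    proof -
      have "norm (x + axis i t - y) \<le> norm (x - y) + norm (axis i t)"
        by (metis add_diff_eq add.commute norm_triangle_ineq)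
      then show "norm (x + axis i t - y) \<le> 2 * \<rho>" using that by (simp add: \<rho>_def)
      then show "x + axis i t \<in> ball y (2 * s)" using \<rho> by (simp add: dist_norm norm_minus_commute)
    qed
    have hol_t: "(\<lambda>t. f (x + axis i t)) holomorphic_on cball 0 \<rho>"
    proof (rule hol_on_axis_holomorphic[OF hol])
      fix t :: complex assume "t \<in> cball 0 \<rho>"
      then have "x + axis i t \<in> ball y (2 * s)" using near(1)[of t] by simp
      moreover have "2 * s \<le> e" by (simp add: s_def)
      ultimately show "x + axis i t \<in> U" using e(2) by auto
    qed
    have "norm ((deriv ^^ 1) (\<lambda>t. f (x + axis i t)) 0) \<le> fact 1 * (\<bar>C\<bar> * (2 * \<rho>) ^ Suc n) / \<rho> ^ 1"
    proof (rule Cauchy_inequality[OF _ _ \<rho>(1)])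
      show "(\<lambda>t. f (x + axis i t)) holomorphic_on ball 0 \<rho>"
        using hol_t ball_subset_cball by (rule holomorphic_on_subset)
      show "continuous_on (cball 0 \<rho>) (\<lambda>t. f (x + axis i t))"
        using hol_t by (rule holomorphic_on_imp_continuous_on)
      fix t :: complex assume "norm (0 - t) = \<rho>"
      then have t: "norm t \<le> \<rho>" by simp
      have "norm (f (x + axis i t)) \<le> C * norm (x + axis i t - y) ^ Suc n"
        using near(1)[OF t] by (intro r(2)) (auto simp: s_def)
      also have "\<dots> \<le> \<bar>C\<bar> * (2 * \<rho>) ^ Suc n"
        using near(2)[OF t] by (intro mult_mono power_mono) auto
      finally show "norm (f (x + axis i t)) \<le> \<bar>C\<bar> * (2 * \<rho>) ^ Suc n" .
    qed
    then show ?thesis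
      using \<rho> unfolding partial_def D_def \<rho>_def by (simp add: power_mult_distrib field_simps)
  qed
  have "isCont (partial i f) y"
    using partial_continuous_on[OF hol op] op y by (simp add: continuous_on_eq_continuous_at)
  then have "((\<lambda>x. D * norm (x - y) ^ n - norm (partial i f x)) \<longlongrightarrow> D * norm (y - y) ^ n - norm (partial i f y)) (at y)"
    unfolding isCont_def by (intro tendsto_intros)
  moreover have "\<forall>\<^sub>F x in at y. 0 \<le> D * norm (x - y) ^ n - norm (partial i f x)"
    unfolding eventually_at using s bound by (intro exI[of _ s]) (auto simp: dist_commute)
  ultimately have "0 \<le> D * norm (y - y) ^ n - norm (partial i f y)"
    by (rule tendsto_lowerbound) simp
  then have "\<forall>x\<in>ball y s. norm (partial i f x) \<le> D * norm (x - y) ^ n"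
  proof (intro ballI)
    fix x assume "x \<in> ball y s"
    then show "norm (partial i f x) \<le> D * norm (x - y) ^ n"
      using bound[of x] \<open>0 \<le> D * norm (y - y) ^ n - norm (partial i f y)\<close> by (cases "x = y") auto
  qed
  then show ?thesis unfolding vanishes_def using s by blast
qed

lemma foldr_partial_hol_on:
  assumes "f hol_on U" "open U"
  shows "foldr (\<lambda>i. partial i ^^ \<alpha> i) xs f hol_on U"
proof (induction xs)
  case (Cons i xs)
  have "(partial i ^^ k) g hol_on U" if "g hol_on U" for g k
    using that by (induction k) (auto intro: partial_hol_on assms(2))
  with Cons show ?case by simp
qed (simp add: assms)

lemma sum_list_sorted_UNIV:
  "sum_list (map \<alpha> (sorted_list_of_set UNIV)) = sum \<alpha> (UNIV :: 'k::{finite,linorder} set)"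
  by (simp add: sum.distinct_set_conv_list[symmetric])

lemma vanishes_foldr_partial:
  assumes "f hol_on U" "open U" "y \<in> U" "vanishes (n + sum_list (map \<alpha> xs)) f y"
  shows "vanishes n (foldr (\<lambda>i. partial i ^^ \<alpha> i) xs f) y"
  using assms(4)
proof (induction xs arbitrary: n)
  case (Cons i xs)
  have *: "vanishes n ((partial i ^^ k) g) y" if "g hol_on U" "vanishes (n + k) g y" for g k n
    using that
  proof (induction k arbitrary: g)
    case (Suc k)
    then have "vanishes n ((partial i ^^ k) (partial i g)) y"
      using assms(2,3) by (intro Suc.IH partial_hol_on vanishes_partial) auto
    then show ?case by (simp add: funpow_Suc_right del: funpow.simps)
  qed simp
  have "vanishes (n + \<alpha> i) (foldr (\<lambda>i. partial i ^^ \<alpha> i) xs f) y"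
    using Cons by (simp add: add.assoc)
  then show ?case using *[OF foldr_partial_hol_on[OF assms(1,2)]] by simp
qed simp

lemma vanishes_imp_partials_zero:
  fixes f :: "'k::{finite,linorder} space \<Rightarrow> complex"
  assumes "f hol_on U" "open U" "y \<in> U" "vanishes (Suc m) f y" "sum \<alpha> UNIV \<le> m"
  shows "partials \<alpha> f y = 0"
proof -
  have "Suc m = Suc (m - sum \<alpha> UNIV) + sum_list (map \<alpha> (sorted_list_of_set UNIV))"
    using assms(5) by (simp add: sum_list_sorted_UNIV)
  then have "vanishes (Suc (m - sum \<alpha> UNIV)) (partials \<alpha> f) y"
    unfolding partials_def using assms(4) by (intro vanishes_foldr_partial[OF assms(1-3)]) simp
  then show ?thesis by (rule vanishes_Suc_imp_zero)
qed

lemma partial_cong: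
  assumes "open V" "\<And>x. x \<in> V \<Longrightarrow> f x = g x" "x \<in> V"
  shows "partial i f x = partial i g x"
proof -
  have "((\<lambda>t. x + axis i t) \<longlongrightarrow> x + axis i 0) (at (0::complex))"
    by (intro tendsto_intros bounded_linear.tendsto[OF bounded_linear_axis])
  moreover have "x + axis i 0 = x" by (simp add: vec_eq_iff axis_def)
  ultimately have "\<forall>\<^sub>F t in at (0::complex). x + axis i t \<in> V"
    using assms(1,3) topological_tendstoD by metis
  then have "\<forall>\<^sub>F t in nhds (0::complex). x + axis i t \<in> V"
    using assms(3) \<open>x + axis i 0 = x\<close> by (metis eventually_nhds_conv_at)
  then have "\<forall>\<^sub>F t in nhds (0::complex). f (x + axis i t) = g (x + axis i t)"
    by (rule eventually_mono) (use assms in auto)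
  then show ?thesis unfolding partial_def by (rule deriv_cong_ev) simp
qed

lemma funpow_partial_cong:
  assumes "open V" "\<And>x. x \<in> V \<Longrightarrow> f x = g x" "x \<in> V"
  shows "(partial i ^^ k) f x = (partial i ^^ k) g x"
  using assms(3) by (induction k arbitrary: x) (auto intro: assms partial_cong[OF assms(1)])

lemma foldr_partial_cong:
  assumes "open V" "\<And>x. x \<in> V \<Longrightarrow> f x = g x" "x \<in> V"
  shows "foldr (\<lambda>i. partial i ^^ \<alpha> i) xs f x = foldr (\<lambda>i. partial i ^^ \<alpha> i) xs g x"
  using assms(3) by (induction xs arbitrary: x) (auto intro: assms funpow_partial_cong[OF assms(1)])

text \<open>
  Partial derivatives only see germs. This is needed because sections are extended by
  \<^const>\<open>undefined\<close>.
\<close>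

lemma partials_cong:
  assumes "open V" "\<And>x. x \<in> V \<Longrightarrow> f x = g x" "x \<in> V"
  shows "partials \<alpha> f x = partials \<alpha> g x"
  unfolding partials_def using assms by (rule foldr_partial_cong)

lemma partial_linear:
  assumes "complex_differentiable_at f x" "complex_differentiable_at g x"
  shows "partial i (\<lambda>x. f x + c * g x) x = partial i f x + c * partial i g x"
proof -
  have [simp]: "axis i (0::complex) = 0" by (simp add: vec_eq_iff axis_def)
  show ?thesis
    using complex_differentiable_axis[of f x i 0] complex_differentiable_axis[of g x i 0] assms
    unfolding partial_def[of i "\<lambda>x. f x + c * g x"]
    by (intro DERIV_imp_deriv derivative_eq_intros) auto
qed

lemma funpow_partial_linear:
  assumes "f hol_on U" "g hol_on U" "open U" "x \<in> U"
  shows "(partial i ^^ k) (\<lambda>x. f x + c * g x) x = (partial i ^^ k) f x + c * (partial i ^^ k) g x"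
  using assms
proof (induction k arbitrary: f g)
  case (Suc k)
  have "(partial i ^^ k) (partial i (\<lambda>x. f x + c * g x)) x
      = (partial i ^^ k) (\<lambda>x. partial i f x + c * partial i g x) x"
    using Suc.prems by (intro funpow_partial_cong[of U] partial_linear) (auto simp: hol_on_def)
  then show ?case
    using Suc by (simp add: funpow_Suc_right partial_hol_on del: funpow.simps)
qed simp

lemma foldr_partial_linear:
  assumes "f hol_on U" "g hol_on U" "open U" "x \<in> U"
  shows "foldr (\<lambda>i. partial i ^^ \<alpha> i) xs (\<lambda>x. f x + c * g x) x =
    foldr (\<lambda>i. partial i ^^ \<alpha> i) xs f x + c * foldr (\<lambda>i. partial i ^^ \<alpha> i) xs g x"
  using assms(4)
proof (induction xs arbitrary: x)
  case (Cons i xs)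
  let ?D = "foldr (\<lambda>i. partial i ^^ \<alpha> i) xs"
  have "(partial i ^^ \<alpha> i) (?D (\<lambda>x. f x + c * g x)) x = (partial i ^^ \<alpha> i) (\<lambda>x. ?D f x + c * ?D g x) x"
    using Cons by (intro funpow_partial_cong[OF assms(3)]) auto
  also have "\<dots> = (partial i ^^ \<alpha> i) (?D f) x + c * (partial i ^^ \<alpha> i) (?D g) x"
    using assms Cons.prems by (intro funpow_partial_linear[of _ U] foldr_partial_hol_on)
  finally show ?case by simp
qed simp

lemma partials_linear:
  assumes "f hol_on U" "g hol_on U" "open U" "x \<in> U"
  shows "partials \<alpha> (\<lambda>x. f x + c * g x) x = partials \<alpha> f x + c * partials \<alpha> g x"
  unfolding partials_def using assms by (rule foldr_partial_linear)

lemma partials_sum: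
  assumes "finite J" "f hol_on U" "\<And>j. j \<in> J \<Longrightarrow> g j hol_on U" "open U" "x \<in> U"
  shows "partials \<alpha> (\<lambda>x. f x - (\<Sum>j\<in>J. c j * g j x)) x = partials \<alpha> f x - (\<Sum>j\<in>J. c j * partials \<alpha> (g j) x)"
  using assms(1,3)
proof (induction J rule: finite_induct)
  case (insert j J)
  have "(\<lambda>x. f x + (-1) * (\<Sum>j\<in>J. c j * g j x)) hol_on U"
    using insert by (intro hol_on_linear assms(2) hol_on_sum) auto
  then have "partials \<alpha> (\<lambda>x. (f x - (\<Sum>j\<in>J. c j * g j x)) + (- c j) * g j x) x =
      partials \<alpha> (\<lambda>x. f x - (\<Sum>j\<in>J. c j * g j x)) x + (- c j) * partials \<alpha> (g j) x"
    using insert assms by (intro partials_linear[of _ U]) auto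
  then show ?case using insert by (simp add: algebra_simps)
qed simp

definition monomial_at :: "('k::finite \<Rightarrow> nat) \<Rightarrow> 'k space \<Rightarrow> 'k space \<Rightarrow> complex" where
  "monomial_at \<alpha> y x = (\<Prod>i\<in>UNIV. (x $ i - y $ i) ^ \<alpha> i)"

lemma monomial_at_hol_on: "monomial_at \<alpha> y hol_on U"
  unfolding hol_on_def monomial_at_def[abs_def] by (auto intro!: complex_differentiable_intros)

text \<open>
  Monomials are differentiated as products of functions of one variable each; this class is closed
  under partial derivatives, whereas the class of monomials is so only up to factors.
\<close>

lemma partial_product_form:
  fixes u :: "'k::finite \<Rightarrow> complex \<Rightarrow> complex"
  assumes "u i holomorphic_on UNIV"
  shows "partial i (\<lambda>x. \<Prod>j\<in>UNIV. u j (x $ j)) = (\<lambda>x. \<Prod>j\<in>UNIV. (u (i := deriv (u i))) j (x $ j))"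
proof
  fix x :: "'k space"
  define c where "c = (\<Prod>j\<in>UNIV - {i}. u j (x $ j))"
  have split: "(\<Prod>j\<in>UNIV. v j) = v i * (\<Prod>j\<in>UNIV - {i}. v j)" for v :: "'k \<Rightarrow> complex"
    by (rule prod.remove) auto
  have "(u i has_field_derivative deriv (u i) (x $ i)) (at (x $ i + 0))"
    using assms holomorphic_derivI[of "u i" UNIV "x $ i"] by simp
  then have "((\<lambda>t. u i (x $ i + t)) has_field_derivative deriv (u i) (x $ i)) (at 0)"
    by (simp only: DERIV_shift add.commute[of _ "0::complex"] add.commute[of "x $ i"])
  then have "((\<lambda>t. u i (x $ i + t) * c) has_field_derivative deriv (u i) (x $ i) * c) (at 0)"
    by (rule DERIV_cmult_right)
  moreover have "(\<lambda>t. \<Prod>j\<in>UNIV. u j ((x + axis i t) $ j)) = (\<lambda>t. u i (x $ i + t) * c)"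
    by (subst split) (auto simp: c_def axis_def fun_eq_iff intro!: prod.cong)
  ultimately have "partial i (\<lambda>x. \<Prod>j\<in>UNIV. u j (x $ j)) x = deriv (u i) (x $ i) * c"
    unfolding partial_def by (intro DERIV_imp_deriv) simp
  also have "\<dots> = (\<Prod>j\<in>UNIV. (u (i := deriv (u i))) j (x $ j))"
    by (subst split) (auto simp: c_def intro!: prod.cong)
  finally show "partial i (\<lambda>x. \<Prod>j\<in>UNIV. u j (x $ j)) x = (\<Prod>j\<in>UNIV. (u (i := deriv (u i))) j (x $ j))" .
qed

lemma funpow_partial_product_form:
  fixes u :: "'k::finite \<Rightarrow> complex \<Rightarrow> complex"
  assumes "u i holomorphic_on UNIV"
  shows "(partial i ^^ n) (\<lambda>x. \<Prod>j\<in>UNIV. u j (x $ j)) = (\<lambda>x. \<Prod>j\<in>UNIV. (u (i := (deriv ^^ n) (u i))) j (x $ j))"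
proof (induction n)
  case (Suc n)
  have "(u (i := (deriv ^^ n) (u i))) i holomorphic_on UNIV"
    using assms by (simp add: holomorphic_higher_deriv)
  from partial_product_form[of "u (i := (deriv ^^ n) (u i))" i, OF this] Suc show ?case by simp
qed simp

lemma foldr_partial_product_form:
  fixes u :: "'k::finite \<Rightarrow> complex \<Rightarrow> complex"
  assumes "\<And>i. u i holomorphic_on UNIV" "distinct xs"
  shows "foldr (\<lambda>i. partial i ^^ \<alpha> i) xs (\<lambda>x. \<Prod>j\<in>UNIV. u j (x $ j)) =
    (\<lambda>x. \<Prod>j\<in>UNIV. (if j \<in> set xs then (deriv ^^ \<alpha> j) (u j) else u j) (x $ j))"
  using assms(2)
proof (induction xs)
  case (Cons i xs)
  let ?v = "\<lambda>j. if j \<in> set xs then (deriv ^^ \<alpha> j) (u j) else u j"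
  have "?v i holomorphic_on UNIV" using assms by (simp add: holomorphic_higher_deriv)
  from funpow_partial_product_form[of ?v i, OF this]
  have "(partial i ^^ \<alpha> i) (\<lambda>x. \<Prod>j\<in>UNIV. ?v j (x $ j)) =
      (\<lambda>x. \<Prod>j\<in>UNIV. (?v (i := (deriv ^^ \<alpha> i) (?v i))) j (x $ j))" .
  also have "?v (i := (deriv ^^ \<alpha> i) (?v i)) = (\<lambda>j. if j \<in> set (i # xs) then (deriv ^^ \<alpha> j) (u j) else u j)"
    using Cons.prems by auto
  finally show ?case using Cons by simp
qed simp

lemma partials_monomial_at:
  fixes y :: "'k::{finite,linorder} space"
  shows "partials \<beta> (monomial_at \<alpha> y) y = (if \<alpha> = \<beta> then \<Prod>i\<in>UNIV. fact (\<beta> i) else 0)"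
proof -
  have "partials \<beta> (monomial_at \<alpha> y) y = (\<Prod>j\<in>UNIV. (deriv ^^ \<beta> j) (\<lambda>z. (z - y $ j) ^ \<alpha> j) (y $ j))"
    unfolding partials_def monomial_at_def[abs_def]
    by (subst foldr_partial_product_form[where u = "\<lambda>j z. (z - y $ j) ^ \<alpha> j"])
      (auto intro!: holomorphic_intros)
  also have "\<dots> = (\<Prod>j\<in>UNIV. if \<alpha> j = \<beta> j then fact (\<beta> j) else 0)"
  proof (rule prod.cong[OF refl])
    fix j
    consider "\<alpha> j < \<beta> j" | "\<alpha> j = \<beta> j" | "\<alpha> j > \<beta> j" by linarith
    then show "(deriv ^^ \<beta> j) (\<lambda>z. (z - y $ j) ^ \<alpha> j) (y $ j) = (if \<alpha> j = \<beta> j then fact (\<beta> j) else 0)"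
      by cases (auto simp: higher_deriv_power pochhammer_fact pochhammer_0_left)
  qed
  also have "(\<Prod>j\<in>UNIV. if \<alpha> j = \<beta> j then fact (\<beta> j) else 0) = (if \<alpha> = \<beta> then \<Prod>i\<in>UNIV. fact (\<beta> i) else (0::complex))"
    by (auto simp: fun_eq_iff)
  finally show ?thesis .
qed

lemma finite_multi_indices: "finite {\<alpha> :: 'k::finite \<Rightarrow> nat. sum \<alpha> UNIV \<le> n}"
proof (rule finite_subset)
  show "{\<alpha> :: 'k \<Rightarrow> nat. sum \<alpha> UNIV \<le> n} \<subseteq> PiE UNIV (\<lambda>_. {..n})"
  proof
    fix \<alpha> :: "'k \<Rightarrow> nat" assume "\<alpha> \<in> {\<alpha>. sum \<alpha> UNIV \<le> n}"
    moreover have "\<alpha> i \<le> sum \<alpha> UNIV" for i by (rule member_le_sum) auto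
    ultimately have "\<alpha> i \<le> n" for i using le_trans by blast
    then show "\<alpha> \<in> PiE UNIV (\<lambda>_. {..n})" by auto
  qed
  show "finite (PiE (UNIV :: 'k set) (\<lambda>_. {..n}))" by (intro finite_PiE) auto
qed

lemma monomial_at_scale: "monomial_at \<alpha> y (y + t *s h) = t ^ sum \<alpha> UNIV * (\<Prod>i\<in>UNIV. h $ i ^ \<alpha> i)"
  by (simp add: monomial_at_def power_mult_distrib prod.distrib power_sum)

text \<open>
  Induction on \<open>n\<close>: expand all partial derivatives of \<open>f\<close>, and integrate the resulting polynomials
  along the rays from \<open>y\<close>. For \<open>q\<close> homogeneous of degree \<open>d\<close>, the integral of
  \<open>h $ i * q (t * h)\<close> over \<open>t\<close> from \<open>0\<close> to \<open>1\<close> is \<open>h $ i * q h / (d + 1)\<close>, which gives the coefficients \<open>c'\<close>. The remainder \<open>\<phi>\<close> then is zero at \<open>y\<close>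
  and its derivative along rays is bounded by the remainders of the partial derivatives.
\<close>

lemma taylor_exists:
  fixes f :: "'k::{finite,linorder} space \<Rightarrow> complex"
  assumes "f hol_on U" "open U" "y \<in> U"
  shows "\<exists>c. vanishes n (\<lambda>x. f x - (\<Sum>\<alpha> | sum \<alpha> UNIV < n. c \<alpha> * monomial_at \<alpha> y x)) y"
  using assms(1)
proof (induction n arbitrary: f)
  case 0
  have "isCont f y" using 0 assms(3) by (auto simp: hol_on_def complex_differentiable_continuous)
  then have "\<forall>\<^sub>F x in nhds y. dist (f x) (f y) < 1"
    unfolding isCont_def tendsto_iff by (auto simp: eventually_nhds_conv_at)
  then obtain d where d: "d > 0" "\<And>x. dist x y < d \<Longrightarrow> dist (f x) (f y) < 1"
    unfolding eventually_nhds_metric by blast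
  have "norm (f x) \<le> (1 + norm (f y)) * norm (x - y) ^ 0" if "x \<in> ball y d" for x
  proof -
    have "norm (f x) \<le> norm (f x - f y) + norm (f y)" by (metis diff_add_cancel norm_triangle_ineq)
    then show ?thesis using d(2)[of x] that by (simp add: dist_commute dist_norm)
  qed
  then have "vanishes 0 f y" unfolding vanishes_def using d(1) by blast
  then show ?case by simp
next
  case (Suc n)
  let ?A = "{\<alpha> :: 'k \<Rightarrow> nat. sum \<alpha> UNIV < n}"
  let ?B = "{\<beta> :: 'k \<Rightarrow> nat. sum \<beta> UNIV < Suc n}"
  have fin: "finite ?A" "finite ?B"
    by (rule finite_subset[OF _ finite_multi_indices[of n]], force)+
  have "\<forall>i. \<exists>c. vanishes n (\<lambda>x. partial i f x - (\<Sum>\<alpha>\<in>?A. c \<alpha> * monomial_at \<alpha> y x)) y"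
    using Suc.IH[OF partial_hol_on[OF Suc.prems assms(2)]] by blast
  from choice[OF this] obtain c where
    c: "\<And>i. vanishes n (\<lambda>x. partial i f x - (\<Sum>\<alpha>\<in>?A. c i \<alpha> * monomial_at \<alpha> y x)) y"
    by blast
  define R where "R i x = partial i f x - (\<Sum>\<alpha>\<in>?A. c i \<alpha> * monomial_at \<alpha> y x)" for i x
  have "\<forall>i. \<exists>C r. 0 < r \<and> (\<forall>x\<in>ball y r. norm (R i x) \<le> C * norm (x - y) ^ n)"
    using c unfolding R_def[abs_def] vanishes_def by simp
  then obtain C r where Cr: "\<And>i. 0 < r i" "\<And>i x. x \<in> ball y (r i) \<Longrightarrow> norm (R i x) \<le> C i * norm (x - y) ^ n"
    by metis
  obtain e where e: "e > 0" "ball y e \<subseteq> U" using assms open_contains_ball by blast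
  define s where "s = Min (insert e (range r))"
  have s: "0 < s" "s \<le> e" "\<And>i. s \<le> r i"
    unfolding s_def using e Cr(1) by (auto intro: Min_le simp del: Min_insert)
  \<comment> \<open>division by the degree integrates along rays; the first case is the constant of integration\<close>
  define c' where "c' \<beta> = (if sum \<beta> UNIV = 0 then f y else
      (\<Sum>i | 0 < \<beta> i. c i (\<beta>(i := \<beta> i - 1))) / of_nat (sum \<beta> UNIV))" for \<beta>
  define \<phi> where "\<phi> x = f x - (\<Sum>\<beta>\<in>?B. c' \<beta> * monomial_at \<beta> y x)" for x
  \<comment> \<open>the derivative of the chosen polynomial along the ray from \<open>y\<close> in the direction \<open>h\<close>\<close>
  have poly_deriv: "(\<Sum>\<beta>\<in>?B. c' \<beta> * (of_nat (sum \<beta> UNIV) * t ^ (sum \<beta> UNIV - 1) * (\<Prod>i\<in>UNIV. h $ i ^ \<beta> i)))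
      = (\<Sum>i\<in>UNIV. h $ i * (\<Sum>\<alpha>\<in>?A. c i \<alpha> * monomial_at \<alpha> y (y + t *s h)))" (is "?l = ?r") for t and h :: "'k space"
  proof -
    have "?l = (\<Sum>\<beta>\<in>?B. \<Sum>i | 0 < \<beta> i. c i (\<beta>(i := \<beta> i - 1)) * t ^ (sum \<beta> UNIV - 1) * (\<Prod>i\<in>UNIV. h $ i ^ \<beta> i))"
    proof (rule sum.cong[OF refl])
      fix \<beta> :: "'k \<Rightarrow> nat" assume "\<beta> \<in> ?B"
      show "c' \<beta> * (of_nat (sum \<beta> UNIV) * t ^ (sum \<beta> UNIV - 1) * (\<Prod>i\<in>UNIV. h $ i ^ \<beta> i)) =
          (\<Sum>i | 0 < \<beta> i. c i (\<beta>(i := \<beta> i - 1)) * t ^ (sum \<beta> UNIV - 1) * (\<Prod>i\<in>UNIV. h $ i ^ \<beta> i))"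
      proof (cases "sum \<beta> UNIV = 0")
        case True
        then have "{i. 0 < \<beta> i} = {}" by auto
        then show ?thesis using True by simp
      next
        case False
        then have nz: "of_nat (sum \<beta> UNIV) \<noteq> (0 :: complex)" by (metis of_nat_eq_0_iff)
        have "c' \<beta> * of_nat (sum \<beta> UNIV) = (\<Sum>i | 0 < \<beta> i. c i (\<beta>(i := \<beta> i - 1)))"
          unfolding c'_def using False nz by (simp del: of_nat_sum)
        then show ?thesis by (simp only: mult.assoc[symmetric] sum_distrib_right)
      qed
    qed
    also have "\<dots> = (\<Sum>(\<beta>, i)\<in>Sigma ?B (\<lambda>\<beta>. {i. 0 < \<beta> i}).
        c i (\<beta>(i := \<beta> i - 1)) * t ^ (sum \<beta> UNIV - 1) * (\<Prod>i\<in>UNIV. h $ i ^ \<beta> i))"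
      using fin by (intro sum.Sigma) auto
    also have "\<dots> = (\<Sum>(i, \<alpha>)\<in>UNIV \<times> ?A. h $ i * (c i \<alpha> * monomial_at \<alpha> y (y + t *s h)))"
    proof (rule sum.reindex_bij_witness[of _ "\<lambda>(i, \<alpha>). (\<alpha>(i := Suc (\<alpha> i)), i)" "\<lambda>(\<beta>, i). (i, \<beta>(i := \<beta> i - 1))"])
      have split: "sum \<alpha> UNIV = \<alpha> i + (\<Sum>j\<in>UNIV - {i}. \<alpha> j)" for \<alpha> :: "'k \<Rightarrow> nat" and i
        by (rule sum.remove) auto
      have upd: "sum (\<alpha>(i := k)) UNIV = k + (\<Sum>j\<in>UNIV - {i}. \<alpha> j)" for \<alpha> :: "'k \<Rightarrow> nat" and i k
        by (subst split[of _ i]) (auto intro!: sum.cong)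
      have splitp: "(\<Prod>j\<in>UNIV. v j) = v i * (\<Prod>j\<in>UNIV - {i}. v j)" for v :: "'k \<Rightarrow> complex" and i
        by (rule prod.remove) auto
      have dec: "sum (\<beta>(i := \<beta> i - 1)) UNIV = sum \<beta> UNIV - 1" if "0 < \<beta> i" for \<beta> :: "'k \<Rightarrow> nat" and i
        using that upd[of \<beta> i "\<beta> i - 1"] split[of \<beta> i] by linarith
      fix a assume "a \<in> Sigma ?B (\<lambda>\<beta>. {i. 0 < \<beta> i})"
      then obtain \<beta> i where a: "a = (\<beta>, i)" "0 < \<beta> i" "sum \<beta> UNIV < Suc n" by auto
      have "sum \<beta> UNIV > 0" using a(2) split[of \<beta> i] by linarith
      then show "(case a of (\<beta>, i) \<Rightarrow> (i, \<beta>(i := \<beta> i - 1))) \<in> UNIV \<times> ?A"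
        using a(3) dec[of \<beta> i, OF a(2)] by (simp only: a(1) prod.case mem_Times_iff fst_conv snd_conv mem_Collect_eq UNIV_I simp_thms)
      show "(case case a of (\<beta>, i) \<Rightarrow> (i, \<beta>(i := \<beta> i - 1)) of (i, \<alpha>) \<Rightarrow> h $ i * (c i \<alpha> * monomial_at \<alpha> y (y + t *s h))) =
        (case a of (\<beta>, i) \<Rightarrow> c i (\<beta>(i := \<beta> i - 1)) * t ^ (sum \<beta> UNIV - 1) * (\<Prod>i\<in>UNIV. h $ i ^ \<beta> i))"
      proof -
        have eq: "h $ i * (\<Prod>j\<in>UNIV. h $ j ^ (\<beta>(i := \<beta> i - 1)) j) = (\<Prod>j\<in>UNIV. h $ j ^ \<beta> j)"
        proof -
          have "(\<Prod>j\<in>UNIV - {i}. h $ j ^ (\<beta>(i := \<beta> i - 1)) j) = (\<Prod>j\<in>UNIV - {i}. h $ j ^ \<beta> j)"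
            by (rule prod.cong) auto
          moreover have "h $ i * h $ i ^ (\<beta> i - 1) = h $ i ^ \<beta> i"
            using a(2) by (simp add: power_eq_if)
          ultimately show ?thesis
            unfolding splitp[of "\<lambda>j. h $ j ^ (\<beta>(i := \<beta> i - 1)) j" i] splitp[of "\<lambda>j. h $ j ^ \<beta> j" i]
            by (simp add: mult.assoc[symmetric])
        qed
        have "h $ i * (c i (\<beta>(i := \<beta> i - 1)) * (t ^ (sum \<beta> UNIV - 1) * (\<Prod>j\<in>UNIV. h $ j ^ (\<beta>(i := \<beta> i - 1)) j)))
            = c i (\<beta>(i := \<beta> i - 1)) * t ^ (sum \<beta> UNIV - 1) * (\<Prod>j\<in>UNIV. h $ j ^ \<beta> j)"
          unfolding eq[symmetric] by (simp only: mult_ac)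
        then show ?thesis by (simp only: a(1) prod.case monomial_at_scale dec[of \<beta> i, OF a(2)])
      qed
    next
      fix b :: "'k \<times> ('k \<Rightarrow> nat)" assume "b \<in> UNIV \<times> ?A"
      then obtain i \<alpha> where b: "b = (i, \<alpha>)" "sum \<alpha> UNIV < n" by auto
      have "sum (\<alpha>(i := Suc (\<alpha> i))) UNIV = Suc (sum \<alpha> UNIV)"
        using sum.remove[of UNIV i "\<alpha>(i := Suc (\<alpha> i))"] sum.remove[of UNIV i \<alpha>]
          sum.cong[of "UNIV - {i}" "UNIV - {i}" "\<alpha>(i := Suc (\<alpha> i))" \<alpha>] by simp
      then show "(case b of (i, \<alpha>) \<Rightarrow> (\<alpha>(i := Suc (\<alpha> i)), i)) \<in> Sigma ?B (\<lambda>\<beta>. {i. 0 < \<beta> i})"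
        using b(2) by (simp only: b(1) prod.case mem_Sigma_iff mem_Collect_eq) simp
    qed auto
    also have "\<dots> = ?r"
      by (simp add: sum.cartesian_product sum_distrib_left)
    finally show ?thesis .
  qed
  have \<phi>_y: "\<phi> y = 0"
  proof -
    have "monomial_at \<beta> y y = (if \<beta> = (\<lambda>_. 0) then 1 else 0)" for \<beta>
      by (auto simp: monomial_at_def fun_eq_iff)
    then have "(\<Sum>\<beta>\<in>?B. c' \<beta> * monomial_at \<beta> y y) = (\<Sum>\<beta>\<in>?B. if \<beta> = (\<lambda>_. 0) then c' (\<lambda>_. 0) else 0)"
      by (intro sum.cong) auto
    also have "\<dots> = c' (\<lambda>_. 0)" by (simp only: sum.delta[OF fin(2)]) simp
    finally have "(\<Sum>\<beta>\<in>?B. c' \<beta> * monomial_at \<beta> y y) = c' (\<lambda>_. 0)" .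
    then show ?thesis by (simp add: \<phi>_def c'_def)
  qed
  define K where "K = (\<Sum>i\<in>UNIV. \<bar>C i\<bar>)"
  have bound: "norm (\<phi> x) \<le> K * norm (x - y) ^ Suc n" if x: "x \<in> ball y s" for x
  proof -
    define h where "h = x - y"
    have near: "y + t *s h \<in> ball y s" if "t \<in> cball 0 1" for t
    proof -
      have "norm (t *s h) \<le> norm h" using that by (simp add: norm_smult_complex mult_left_le_one_le)
      then show ?thesis using x by (simp add: dist_norm h_def norm_minus_commute)
    qed
    have "norm (\<phi> (y + 1 *s h) - \<phi> (y + 0 *s h)) \<le> (K * norm h ^ Suc n) * norm (1 - 0 :: complex)"
    proof (rule field_differentiable_bound[OF convex_cball[of 0 1]])
      fix t :: complex assume t: "t \<in> cball 0 1"
      have "((\<lambda>t. f (y + t *s h)) has_field_derivative (\<Sum>i\<in>UNIV. h $ i * partial i f (y + t *s h))) (at t)"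
      proof (rule complex_differentiable_line)
        have "y + t *s h \<in> U" using near[OF t] s(2) e(2) subset_ball[of s e y] by blast
        then show "complex_differentiable_at f (y + t *s h)" using Suc.prems by (simp add: hol_on_def)
      qed
      moreover have "((\<lambda>t. \<Sum>\<beta>\<in>?B. c' \<beta> * monomial_at \<beta> y (y + t *s h)) has_field_derivative
          (\<Sum>\<beta>\<in>?B. c' \<beta> * (of_nat (sum \<beta> UNIV) * t ^ (sum \<beta> UNIV - 1) * (\<Prod>i\<in>UNIV. h $ i ^ \<beta> i)))) (at t)"
        unfolding monomial_at_scale
        by (intro DERIV_sum DERIV_cmult DERIV_cmult_right)
          (rule DERIV_power[OF DERIV_ident, THEN DERIV_cong], simp)
      ultimately have "((\<lambda>t. \<phi> (y + t *s h)) has_field_derivative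
          (\<Sum>i\<in>UNIV. h $ i * partial i f (y + t *s h)) -
          (\<Sum>i\<in>UNIV. h $ i * (\<Sum>\<alpha>\<in>?A. c i \<alpha> * monomial_at \<alpha> y (y + t *s h)))) (at t)"
        unfolding \<phi>_def poly_deriv by (rule DERIV_diff)
      then have "((\<lambda>t. \<phi> (y + t *s h)) has_field_derivative (\<Sum>i\<in>UNIV. h $ i * R i (y + t *s h))) (at t)"
        by (simp add: R_def right_diff_distrib sum_subtractf)
      then show "((\<lambda>t. \<phi> (y + t *s h)) has_field_derivative (\<Sum>i\<in>UNIV. h $ i * R i (y + t *s h))) (at t within cball 0 1)"
        by (rule has_field_derivative_at_within)
      have "norm (\<Sum>i\<in>UNIV. h $ i * R i (y + t *s h)) \<le> (\<Sum>i\<in>UNIV. norm h * (\<bar>C i\<bar> * norm h ^ n))"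
      proof (rule sum_norm_le)
        fix i
        have "norm (R i (y + t *s h)) \<le> C i * norm (t *s h) ^ n"
          using Cr(2)[of "y + t *s h" i] near[OF t] s(3)[of i] by simp
        also have "\<dots> \<le> \<bar>C i\<bar> * norm h ^ n"
          using t by (intro mult_mono power_mono) (auto simp: norm_smult_complex mult_left_le_one_le)
        finally show "norm (h $ i * R i (y + t *s h)) \<le> norm h * (\<bar>C i\<bar> * norm h ^ n)"
          unfolding norm_mult by (intro mult_mono Finite_Cartesian_Product.norm_nth_le) auto
      qed
      then show "norm (\<Sum>i\<in>UNIV. h $ i * R i (y + t *s h)) \<le> K * norm h ^ Suc n"
        by (simp add: K_def sum_distrib_left sum_distrib_right mult_ac)
    qed auto
    then show ?thesis using \<phi>_y by (simp add: h_def)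
  qed
  then have "vanishes (Suc n) \<phi> y" unfolding vanishes_def using s(1) by blast
  then show ?case unfolding \<phi>_def[abs_def] by blast
qed

text \<open>
  The coefficients of an expansion are forced: the remainder has vanishing partial derivatives at \<open>y\<close>
  by \<open>vanishes_imp_partials_zero\<close>, and those of the monomials are known.
\<close>

theorem taylor_vanishes:
  fixes f :: "'k::{finite,linorder} space \<Rightarrow> complex"
  assumes "f hol_on U" "open U" "y \<in> U"
  shows "vanishes (Suc m) (\<lambda>x. f x - (\<Sum>\<alpha> | sum \<alpha> UNIV \<le> m.
    partials \<alpha> f y / (\<Prod>i\<in>UNIV. fact (\<alpha> i)) * monomial_at \<alpha> y x)) y"
proof -
  let ?A = "{\<alpha> :: 'k \<Rightarrow> nat. sum \<alpha> UNIV \<le> m}"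
  obtain c where c: "vanishes (Suc m) (\<lambda>x. f x - (\<Sum>\<alpha>\<in>?A. c \<alpha> * monomial_at \<alpha> y x)) y"
    using taylor_exists[OF assms, of "Suc m"] by (auto simp: less_Suc_eq_le)
  have "c \<beta> = partials \<beta> f y / (\<Prod>i\<in>UNIV. fact (\<beta> i))" if \<beta>: "\<beta> \<in> ?A" for \<beta>
  proof -
    have "(\<lambda>x. f x + (-1) * (\<Sum>\<alpha>\<in>?A. c \<alpha> * monomial_at \<alpha> y x)) hol_on U"
      by (intro hol_on_linear assms(1) hol_on_sum monomial_at_hol_on)
    then have "partials \<beta> (\<lambda>x. f x - (\<Sum>\<alpha>\<in>?A. c \<alpha> * monomial_at \<alpha> y x)) y = 0"
      using c \<beta> by (intro vanishes_imp_partials_zero[of _ U _ m] assms(2,3)) auto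
    moreover have "partials \<beta> (\<lambda>x. f x - (\<Sum>\<alpha>\<in>?A. c \<alpha> * monomial_at \<alpha> y x)) y
        = partials \<beta> f y - (\<Sum>\<alpha>\<in>?A. c \<alpha> * partials \<beta> (monomial_at \<alpha> y) y)"
      by (rule partials_sum[OF finite_multi_indices assms(1) monomial_at_hol_on assms(2,3)])
    moreover have "(\<Sum>\<alpha>\<in>?A. c \<alpha> * partials \<beta> (monomial_at \<alpha> y) y) = c \<beta> * (\<Prod>i\<in>UNIV. fact (\<beta> i))"
    proof -
      have "(\<Sum>\<alpha>\<in>?A. c \<alpha> * partials \<beta> (monomial_at \<alpha> y) y) =
          (\<Sum>\<alpha>\<in>?A. if \<alpha> = \<beta> then c \<beta> * (\<Prod>i\<in>UNIV. fact (\<beta> i)) else 0)"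
        by (intro sum.cong) (auto simp: partials_monomial_at)
      then show ?thesis using \<beta> by (simp only: sum.delta[OF finite_multi_indices] if_True)
    qed
    ultimately show ?thesis by simp
  qed
  then have "(\<lambda>x. f x - (\<Sum>\<alpha>\<in>?A. c \<alpha> * monomial_at \<alpha> y x)) = (\<lambda>x. f x - (\<Sum>\<alpha>\<in>?A.
      partials \<alpha> f y / (\<Prod>i\<in>UNIV. fact (\<alpha> i)) * monomial_at \<alpha> y x))"
    by (intro ext arg_cong2[of _ _ _ _ "(-)"] sum.cong) auto
  with c show ?thesis by (simp only:)
qed

section \<open>Differential operators without coefficients\<close>

lemma carrier_hol_iff: "f \<in> carrier (hol U) \<longleftrightarrow> f \<in> extensional U \<and> f hol_on U"
  by (simp add: hol_def hol_on_def)

lemma restrict_carrier_hol: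
  assumes "open U" "f hol_on U"
  shows "restrict f U \<in> carrier (hol U)"
  using hol_on_cong[OF assms(1) _ assms(2), of "restrict f U"] by (simp add: carrier_hol_iff)

lemma carrier_hol_restrict:
  assumes "f \<in> carrier (hol U)" "open W" "W \<subseteq> U"
  shows "restrict f W \<in> carrier (hol W)"
  using assms restrict_carrier_hol[OF assms(2), of f] hol_on_subset[of f U W] by (simp add: carrier_hol_iff)

lemma carrier_hol_hol_on: "f \<in> carrier (hol U) \<Longrightarrow> f hol_on U"
  by (simp add: carrier_hol_iff)

lemma carrier_hol_extensional: "f \<in> carrier (hol U) \<Longrightarrow> f \<in> extensional U"
  by (simp add: carrier_hol_iff)

lemma sheaf_endo_carrier:
  "sheaf_endo U P \<Longrightarrow> open V \<Longrightarrow> V \<subseteq> U \<Longrightarrow> f \<in> carrier (hol V) \<Longrightarrow> P V f \<in> carrier (hol V)"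
  unfolding sheaf_endo_def by blast

lemma sheaf_endo_restrict:
  assumes "sheaf_endo U P" "open V" "V \<subseteq> U" "f \<in> carrier (hol V)" "open W" "W \<subseteq> V"
  shows "P W (restrict f W) = restrict (P V f) W"
  using assms unfolding sheaf_endo_def by blast

lemma sheaf_endo_local:
  assumes "sheaf_endo U P" "open V" "V \<subseteq> U" "f \<in> carrier (hol V)" "open W" "W \<subseteq> V" "x \<in> W"
  shows "P W (restrict f W) x = P V f x"
  using sheaf_endo_restrict[OF assms(1-6)] assms(7) by simp

lemma sheaf_endo_eqI:
  assumes P: "sheaf_endo U P" and Q: "sheaf_endo U Q"
    and eq: "\<And>V f x. open V \<Longrightarrow> V \<subseteq> U \<Longrightarrow> f \<in> carrier (hol V) \<Longrightarrow> x \<in> V \<Longrightarrow> P V f x = Q V f x"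
  shows "P = Q"
proof (intro ext)
  fix V f x
  show "P V f x = Q V f x"
  proof (cases "open V \<and> V \<subseteq> U \<and> f \<in> carrier (hol V)")
    case True
    then have "P V f \<in> extensional V" "Q V f \<in> extensional V"
      using carrier_hol_extensional[OF sheaf_endo_carrier[OF P, of V f]]
        carrier_hol_extensional[OF sheaf_endo_carrier[OF Q, of V f]] by blast+
    then show ?thesis using eq[of V f x] True extensional_arb[of "P V f" V x] extensional_arb[of "Q V f" V x]
      by (cases "x \<in> V") simp_all
  next
    case False
    then have "op_restrict U P V f = op_restrict U Q V f"
      by (simp only: op_restrict_def if_False)
    moreover have "op_restrict U P = P" "op_restrict U Q = Q" using P Q by (simp_all only: sheaf_endo_def)
    ultimately show ?thesis by simp
  qed
qed

lemma op_restrict_apply: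
  "open V \<Longrightarrow> V \<subseteq> U \<Longrightarrow> f \<in> carrier (hol V) \<Longrightarrow> op_restrict U P V f = P V f"
  by (simp add: op_restrict_def)

lemma sheaf_endo_op_restrictI:
  assumes "\<And>V f. open V \<Longrightarrow> V \<subseteq> U \<Longrightarrow> f \<in> carrier (hol V) \<Longrightarrow> P V f \<in> carrier (hol V)"
    and "\<And>V f W. open V \<Longrightarrow> V \<subseteq> U \<Longrightarrow> f \<in> carrier (hol V) \<Longrightarrow> open W \<Longrightarrow> W \<subseteq> V \<Longrightarrow>
      P W (restrict f W) = restrict (P V f) W"
  shows "sheaf_endo U (op_restrict U P)"
  unfolding sheaf_endo_def
proof (intro conjI allI impI)
  show "op_restrict U (op_restrict U P) = op_restrict U P" by (simp add: op_restrict_def fun_eq_iff)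
  fix V f assume V: "open V \<and> V \<subseteq> U \<and> f \<in> carrier (hol V)"
  then show "op_restrict U P V f \<in> carrier (hol V)" using assms(1) by (simp add: op_restrict_apply)
  fix W assume W: "open W \<and> W \<subseteq> V"
  then have "restrict f W \<in> carrier (hol W)" using V carrier_hol_restrict by blast
  then show "op_restrict U P W (restrict f W) = restrict (op_restrict U P V f) W"
    using V W assms(2)[of V f W] op_restrict_apply[of W U "restrict f W" P] op_restrict_apply[of V U f P] by auto
qed

definition op_linear :: "('k::finite space) set \<Rightarrow> 'k op \<Rightarrow> bool" where
  "op_linear U P \<longleftrightarrow> (\<forall>V f g c x. open V \<and> V \<subseteq> U \<and> f \<in> carrier (hol V) \<and> g \<in> carrier (hol V) \<and> x \<in> V \<longrightarrow>
     P V (\<lambda>x\<in>V. f x + c * g x) x = P V f x + c * P V g x)"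

text \<open>
  On \<open>W\<close> the operator has order at most \<open>m\<close>: the value at \<open>y\<close> only depends on the terms up to order \<open>m\<close>
  of the Taylor expansion at \<open>y\<close>.
\<close>

definition locally_finite_order :: "('k::finite space) set \<Rightarrow> 'k op \<Rightarrow> bool" where
  "locally_finite_order U P \<longleftrightarrow> (\<forall>x\<in>U. \<exists>W m. open W \<and> x \<in> W \<and> W \<subseteq> U \<and>
     (\<forall>V f y. open V \<and> V \<subseteq> W \<and> f \<in> carrier (hol V) \<and> y \<in> V \<and> vanishes (Suc m) f y \<longrightarrow> P V f y = 0))"

lemma op_linearD:
  assumes "op_linear U P" "open V" "V \<subseteq> U" "f \<in> carrier (hol V)" "g \<in> carrier (hol V)" "x \<in> V"
  shows "P V (\<lambda>x\<in>V. f x + c * g x) x = P V f x + c * P V g x"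
  using assms unfolding op_linear_def by simp

lemma op_linear_sum:
  assumes lin: "op_linear U P" and "finite J" "open V" "V \<subseteq> U" "\<And>j. j \<in> J \<Longrightarrow> g j hol_on V" "x \<in> V"
  shows "P V (\<lambda>x\<in>V. \<Sum>j\<in>J. c j * g j x) x = (\<Sum>j\<in>J. c j * P V (restrict (g j) V) x)"
  using assms(2,5)
proof (induction J rule: finite_induct)
  case empty
  define z where "z = (\<lambda>x\<in>V. 0 :: complex)"
  have z: "z \<in> carrier (hol V)" unfolding z_def using assms(3) hol_on_const by (rule restrict_carrier_hol)
  have "P V (\<lambda>x\<in>V. z x + (-1) * z x) x = P V z x + (-1) * P V z x"
    by (rule op_linearD[OF lin assms(3,4) z z assms(6)])
  moreover have "(\<lambda>x\<in>V. z x + (-1) * z x) = z" unfolding z_def by (intro restrict_ext) simp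
  ultimately have "P V z x = 0" by simp
  then show ?case by (simp only: z_def sum.empty)
next
  case (insert j J)
  define S where "S = (\<lambda>x\<in>V. \<Sum>j\<in>J. c j * g j x)"
  define g' where "g' = restrict (g j) V"
  have "(\<lambda>x. \<Sum>j\<in>J. c j * g j x) hol_on V"
    by (rule hol_on_sum) (simp add: insert.prems)
  then have S: "S \<in> carrier (hol V)" unfolding S_def by (rule restrict_carrier_hol[OF assms(3)])
  have g': "g' \<in> carrier (hol V)"
    unfolding g'_def using insert.prems by (intro restrict_carrier_hol[OF assms(3)]) simp
  have "P V (\<lambda>x\<in>V. S x + c j * g' x) x = P V S x + c j * P V g' x"
    by (rule op_linearD[OF lin assms(3,4) S g' assms(6)])
  moreover have "(\<lambda>x\<in>V. S x + c j * g' x) = (\<lambda>x\<in>V. \<Sum>j\<in>insert j J. c j * g j x)"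
    using insert.hyps by (intro restrict_ext) (simp add: S_def g'_def add.commute)
  moreover have S_eq: "P V S x = (\<Sum>j\<in>J. c j * P V (restrict (g j) V) x)"
    unfolding S_def using insert.prems by (intro insert.IH) auto
  ultimately have "P V (\<lambda>x\<in>V. \<Sum>j\<in>insert j J. c j * g j x) x =
      (\<Sum>j\<in>J. c j * P V (restrict (g j) V) x) + c j * P V g' x"
    by (simp only:)
  then show ?case unfolding g'_def sum.insert[OF insert.hyps] by (simp only: add.commute)
qed

text \<open>
  The point \<open>y\<close> enters twice, as the point of evaluation and through the function operated on. By
  linearity, a factor \<open>x $ i - y $ i\<close> can be split into one that only depends on \<open>x\<close>, which is absorbed
  into a function \<open>u\<close> independent of \<open>y\<close>, and a scalar \<open>y $ i\<close>, which can be pulled out. Thus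
  the property \<open>good\<close>, which allows an arbitrary \<open>u\<close>, survives multiplication by such factors.
\<close>

lemma sheaf_endo_monomial_at_hol_on:
  assumes P: "sheaf_endo U P" and lin: "op_linear U P" and W: "open W" "W \<subseteq> U"
  shows "(\<lambda>y. P W (\<lambda>x\<in>W. monomial_at \<alpha> y x) y) hol_on W"
proof -
  define good where "good G \<longleftrightarrow> (\<forall>y. G y hol_on W) \<and>
    (\<forall>u. u hol_on W \<longrightarrow> (\<lambda>y. P W (\<lambda>x\<in>W. u x * G y x) y) hol_on W)" for G
  have one: "good (\<lambda>y x. 1)"
    unfolding good_def
  proof (intro conjI allI impI)
    fix u :: "'a space \<Rightarrow> complex" assume "u hol_on W"
    then have "P W (restrict u W) hol_on W"
      by (rule carrier_hol_hol_on[OF sheaf_endo_carrier[OF P W restrict_carrier_hol[OF W(1)]]])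
    then show "(\<lambda>y. P W (\<lambda>x\<in>W. u x * 1) y) hol_on W" by (simp only: mult_1_right)
  qed (rule hol_on_const)
  have coord: "good (\<lambda>y x. (x $ i - y $ i) * G y x)" if G: "good G" for i G
    unfolding good_def
  proof (intro conjI allI impI)
    have Gy: "G y hol_on W" for y using G unfolding good_def by (rule conjunct1[THEN spec])
    have Gu: "(\<lambda>y. P W (\<lambda>x\<in>W. u x * G y x) y) hol_on W" if "u hol_on W" for u
      using G that unfolding good_def by simp
    have "(\<lambda>x. x $ i + - (y $ i)) hol_on W" for y
      by (intro hol_on_add hol_on_coord hol_on_const)
    from hol_on_mult[OF this Gy] show "(\<lambda>x. (x $ i - y $ i) * G y x) hol_on W" for y
      by simp
    fix u :: "'a space \<Rightarrow> complex" assume u: "u hol_on W"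
    have ux: "(\<lambda>x. u x * x $ i) hol_on W"
      by (rule hol_on_mult[OF u hol_on_coord])
    define A where "A y = (\<lambda>x\<in>W. (u x * x $ i) * G y x)" for y
    define B where "B y = (\<lambda>x\<in>W. u x * G y x)" for y
    have AB: "A y \<in> carrier (hol W)" "B y \<in> carrier (hol W)" for y
      unfolding A_def B_def by (intro restrict_carrier_hol W hol_on_mult ux u Gy)+
    have sum: "P W (\<lambda>x\<in>W. u x * ((x $ i - y $ i) * G y x)) y = P W (A y) y + (- (y $ i)) * P W (B y) y"
      if y: "y \<in> W" for y
    proof -
      have "(\<lambda>x\<in>W. u x * ((x $ i - y $ i) * G y x)) = (\<lambda>x\<in>W. A y x + (- (y $ i)) * B y x)"
        by (intro restrict_ext) (simp add: A_def B_def algebra_simps)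
      then show ?thesis using op_linearD[OF lin W AB y, of y "- (y $ i)" y] by simp
    qed
    have "(\<lambda>y. (-1) * y $ i) hol_on W"
      by (intro hol_on_mult hol_on_const hol_on_coord)
    then have "(\<lambda>y. - (y $ i)) hol_on W" by simp
    then have "(\<lambda>y. P W (A y) y + (- (y $ i)) * P W (B y) y) hol_on W"
      unfolding A_def B_def by (intro hol_on_add hol_on_mult Gu ux u)
    then show "(\<lambda>y. P W (\<lambda>x\<in>W. u x * ((x $ i - y $ i) * G y x)) y) hol_on W"
      by (rule hol_on_cong[OF W(1), rotated]) (simp only: sum)
  qed
  have power: "good (\<lambda>y x. (x $ i - y $ i) ^ n * G y x)" if G: "good G" for i n G
  proof (induction n)
    case 0
    show ?case using G by (simp only: power_0 mult_1_left)
  next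
    case (Suc n)
    from coord[OF this, of i] show ?case by (simp only: power_Suc mult.assoc)
  qed
  have prod: "good (\<lambda>y x. \<Prod>i\<in>A. (x $ i - y $ i) ^ \<alpha> i)" if "finite A" for A
    using that
  proof (induction A rule: finite_induct)
    case empty
    show ?case using one by (simp only: prod.empty)
  next
    case (insert i A)
    from power[OF insert.IH, of i "\<alpha> i"] show ?case by (simp only: prod.insert[OF insert.hyps])
  qed
  have "good (\<lambda>y x. monomial_at \<alpha> y x)" unfolding monomial_at_def by (rule prod) simp
  then have "(\<lambda>y. P W (\<lambda>x\<in>W. 1 * monomial_at \<alpha> y x) y) hol_on W"
    unfolding good_def using hol_on_const[of 1 W] by blast
  then show ?thesis by (simp only: mult_1_left)
qed

lemma diffop_imp_linear:
  assumes "diffop U P" shows "op_linear U P"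
  unfolding op_linear_def
proof (intro allI impI)
  fix V f g c x assume A: "open V \<and> V \<subseteq> U \<and> f \<in> carrier (hol V) \<and> g \<in> carrier (hol V) \<and> x \<in> V"
  have P: "sheaf_endo U P" using assms by (simp add: diffop_def)
  have "x \<in> U" using A by blast
  then obtain W m a where W: "open W" "x \<in> W" "W \<subseteq> U"
    and formula: "\<And>V f y. open V \<Longrightarrow> V \<subseteq> W \<Longrightarrow> f \<in> carrier (hol V) \<Longrightarrow> y \<in> V \<Longrightarrow>
      P V f y = (\<Sum>\<alpha> | sum \<alpha> UNIV \<le> m. a \<alpha> y * partials \<alpha> f y)"
    using assms unfolding diffop_def by meson
  define V' where "V' = V \<inter> W"
  have V': "open V'" "V' \<subseteq> V" "V' \<subseteq> W" "x \<in> V'" using A W by (auto simp: V'_def)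
  have loc: "P V h x = (\<Sum>\<alpha> | sum \<alpha> UNIV \<le> m. a \<alpha> x * partials \<alpha> h x)" if h: "h \<in> carrier (hol V)" for h
  proof -
    have "P V h x = P V' (restrict h V') x"
      using sheaf_endo_local[OF P _ _ h V'(1,2,4)] A by simp
    also have "\<dots> = (\<Sum>\<alpha> | sum \<alpha> UNIV \<le> m. a \<alpha> x * partials \<alpha> (restrict h V') x)"
      using formula V' carrier_hol_restrict[OF h V'(1,2)] by blast
    also have "\<dots> = (\<Sum>\<alpha> | sum \<alpha> UNIV \<le> m. a \<alpha> x * partials \<alpha> h x)"
      using V' by (intro sum.cong refl arg_cong2[of _ _ _ _ "(*)"] partials_cong[of V']) auto
    finally show ?thesis .
  qed
  have lin: "partials \<alpha> (\<lambda>x\<in>V. f x + c * g x) x = partials \<alpha> f x + c * partials \<alpha> g x" for \<alpha>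
  proof -
    have "partials \<alpha> (\<lambda>x\<in>V. f x + c * g x) x = partials \<alpha> (\<lambda>x. f x + c * g x) x"
      using A by (intro partials_cong[of V]) auto
    also have "\<dots> = partials \<alpha> f x + c * partials \<alpha> g x"
      using A carrier_hol_hol_on by (intro partials_linear[of _ V]) auto
    finally show ?thesis .
  qed
  have "(\<lambda>x\<in>V. f x + c * g x) \<in> carrier (hol V)"
    using A carrier_hol_hol_on by (intro restrict_carrier_hol hol_on_linear) auto
  then show "P V (\<lambda>x\<in>V. f x + c * g x) x = P V f x + c * P V g x"
    using A by (simp add: loc lin algebra_simps sum.distrib sum_distrib_left)
qed

lemma diffop_imp_finite_order:
  assumes "diffop U P" shows "locally_finite_order U P"
  unfolding locally_finite_order_def
proof
  fix x assume "x \<in> U"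
  then obtain W m a where W: "open W" "x \<in> W" "W \<subseteq> U"
    and formula: "\<And>V f y. open V \<Longrightarrow> V \<subseteq> W \<Longrightarrow> f \<in> carrier (hol V) \<Longrightarrow> y \<in> V \<Longrightarrow>
      P V f y = (\<Sum>\<alpha> | sum \<alpha> UNIV \<le> m. a \<alpha> y * partials \<alpha> f y)"
    using assms unfolding diffop_def by meson
  have "P V f y = 0" if "open V" "V \<subseteq> W" "f \<in> carrier (hol V)" "y \<in> V" "vanishes (Suc m) f y" for V f y
    unfolding formula[OF that(1-4)]
    using vanishes_imp_partials_zero[OF carrier_hol_hol_on[OF that(3)] that(1,4,5)] by (intro sum.neutral) auto
  then show "\<exists>W m. open W \<and> x \<in> W \<and> W \<subseteq> U \<and>
     (\<forall>V f y. open V \<and> V \<subseteq> W \<and> f \<in> carrier (hol V) \<and> y \<in> V \<and> vanishes (Suc m) f y \<longrightarrow> P V f y = 0)"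
    using W by blast
qed

text \<open>
  This is Grothendieck's description of differential operators, with the powers of the maximal ideal
  at \<open>y\<close> replaced by an order of vanishing. From right to left, the difference of \<open>f\<close> and its
  Taylor polynomial at \<open>y\<close> is killed at \<open>y\<close>, so \<open>P f y\<close> is the value of \<open>P\<close> on this polynomial, a
  linear combination of the values on the monomials centred at \<open>y\<close>.
\<close>

theorem diffop_iff:
  fixes P :: "'k::{finite,linorder} op"
  shows "diffop U P \<longleftrightarrow> sheaf_endo U P \<and> op_linear U P \<and> locally_finite_order U P"
proof (intro iffI conjI)
  assume "diffop U P"
  then show "sheaf_endo U P" "op_linear U P" "locally_finite_order U P"
    by (simp_all add: diffop_imp_linear diffop_imp_finite_order) (simp add: diffop_def)
next
  assume "sheaf_endo U P \<and> op_linear U P \<and> locally_finite_order U P"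
  then have P: "sheaf_endo U P" and lin: "op_linear U P" and fin: "locally_finite_order U P" by auto
  show "diffop U P" unfolding diffop_def
  proof (intro conjI ballI P)
    fix x assume "x \<in> U"
    then obtain W m where W: "open W" "x \<in> W" "W \<subseteq> U" and
      kill: "\<And>V f y. open V \<Longrightarrow> V \<subseteq> W \<Longrightarrow> f \<in> carrier (hol V) \<Longrightarrow> y \<in> V \<Longrightarrow> vanishes (Suc m) f y \<Longrightarrow> P V f y = 0"
      using fin unfolding locally_finite_order_def by meson
    define b where "b \<alpha> y = P W (\<lambda>x\<in>W. monomial_at \<alpha> y x) y" for \<alpha> y
    define F where "F \<alpha> = (\<Prod>i\<in>UNIV. fact (\<alpha> i) :: complex)" for \<alpha> :: "'k \<Rightarrow> nat"
    define a where "a \<alpha> = (\<lambda>y\<in>W. (1 / F \<alpha>) * b \<alpha> y)" for \<alpha>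
    have "a \<alpha> \<in> carrier (hol W)" for \<alpha>
      unfolding a_def b_def[abs_def]
      by (intro restrict_carrier_hol W hol_on_mult hol_on_const sheaf_endo_monomial_at_hol_on[OF P lin])
    moreover have "P V f y = (\<Sum>\<alpha> | sum \<alpha> UNIV \<le> m. a \<alpha> y * partials \<alpha> f y)"
      if V: "open V" "V \<subseteq> W" and f: "f \<in> carrier (hol V)" and y: "y \<in> V" for V f y
    proof -
      have VU: "V \<subseteq> U" using V W by blast
      let ?A = "{\<alpha> :: 'k \<Rightarrow> nat. sum \<alpha> UNIV \<le> m}"
      define c where "c \<alpha> = partials \<alpha> f y / F \<alpha>" for \<alpha>
      define T where "T = (\<lambda>x\<in>V. \<Sum>\<alpha>\<in>?A. c \<alpha> * monomial_at \<alpha> y x)"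
      have T: "T \<in> carrier (hol V)"
        unfolding T_def by (intro restrict_carrier_hol V hol_on_sum monomial_at_hol_on)
      have "vanishes (Suc m) (\<lambda>x. f x - (\<Sum>\<alpha>\<in>?A. c \<alpha> * monomial_at \<alpha> y x)) y"
        unfolding c_def F_def by (rule taylor_vanishes[OF carrier_hol_hol_on[OF f] V(1) y])
      then have "vanishes (Suc m) (\<lambda>x\<in>V. f x + (-1) * T x) y"
        by (rule vanishes_cong[OF V(1) y, rotated]) (simp add: T_def)
      then have "P V (\<lambda>x\<in>V. f x + (-1) * T x) y = 0"
        using f T carrier_hol_hol_on by (intro kill V y restrict_carrier_hol hol_on_linear) auto
      moreover have "P V (\<lambda>x\<in>V. f x + (-1) * T x) y = P V f y + (-1) * P V T y"
        by (rule op_linearD[OF lin V(1) VU f T y])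
      ultimately have "P V f y = P V T y" by simp
      also have "P V T y = (\<Sum>\<alpha>\<in>?A. c \<alpha> * P V (\<lambda>x\<in>V. monomial_at \<alpha> y x) y)"
        unfolding T_def using op_linear_sum[OF lin finite_multi_indices V(1) VU monomial_at_hol_on y] .
      also have "\<dots> = (\<Sum>\<alpha>\<in>?A. a \<alpha> y * partials \<alpha> f y)"
      proof (rule sum.cong[OF refl])
        fix \<alpha>
        have "(\<lambda>x\<in>V. monomial_at \<alpha> y x) = restrict (\<lambda>x\<in>W. monomial_at \<alpha> y x) V"
          using V by (simp add: restrict_restrict Int_absorb1)
        moreover have "(\<lambda>x\<in>W. monomial_at \<alpha> y x) \<in> carrier (hol W)"
          by (intro restrict_carrier_hol W monomial_at_hol_on)
        ultimately have "P V (\<lambda>x\<in>V. monomial_at \<alpha> y x) y = b \<alpha> y"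
          unfolding b_def using sheaf_endo_local[OF P W(1,3) _ V y] by metis
        then show "c \<alpha> * P V (\<lambda>x\<in>V. monomial_at \<alpha> y x) y = a \<alpha> y * partials \<alpha> f y"
          using V y by (auto simp: a_def c_def)
      qed
      finally show ?thesis .
    qed
    ultimately show "\<exists>W m a. open W \<and> x \<in> W \<and> W \<subseteq> U \<and> (\<forall>\<alpha>. a \<alpha> \<in> carrier (hol W)) \<and>
        (\<forall>V f. open V \<and> V \<subseteq> W \<and> f \<in> carrier (hol V) \<longrightarrow>
           (\<forall>y\<in>V. P V f y = (\<Sum>\<alpha> | sum \<alpha> UNIV \<le> m. a \<alpha> y * partials \<alpha> f y)))"
      using W by (intro exI[of _ W] exI[of _ m] exI[of _ a]) blast
  qed
qed

section \<open>The monic polynomial with given elementary symmetric functions\<close>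

lemma rank_inj: "inj (\<lambda>j::'k::{finite,linorder}. card {..j})"
proof (rule linorder_injI)
  fix x y :: 'k assume "x < y"
  then have "{..x} \<subset> {..y}" by auto
  then show "card {..x} \<noteq> card {..y}" by (metis finite nat_neq_iff psubset_card_mono)
qed

lemma rank_bounds: "0 < card {..j::'k::{finite,linorder}}" "card {..j} \<le> CARD('k)"
  by (auto simp: card_gt_0_iff intro: card_mono)

lemma bij_betw_rank: "bij_betw (\<lambda>j::'k::{finite,linorder}. card {..j}) UNIV {1..CARD('k)}"
  unfolding bij_betw_def
proof (intro conjI rank_inj)
  show "range (\<lambda>j::'k. card {..j}) = {1..CARD('k)}"
  proof (intro equalityI subsetI)
    fix n assume "n \<in> range (\<lambda>j::'k. card {..j})"
    then obtain j :: 'k where "n = card {..j}" by auto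
    then show "n \<in> {1..CARD('k)}" using rank_bounds[of j] by simp
  next
    fix n assume "n \<in> {1..CARD('k)}"
    then obtain j :: 'k where "card {..j} = n" using surj_rank[of n] by auto
    then show "n \<in> range (\<lambda>j::'k. card {..j})" by auto
  qed
qed

text \<open>
  The polynomial with the elementary symmetric functions \<open>\<sigma>\<close> of its roots; on \<open>elem_sym x\<close> it is the
  product of the factors \<open>t - x $ i\<close>.
\<close>

definition monic_poly :: "'k::{finite,linorder} space \<Rightarrow> complex poly" where
  "monic_poly \<sigma> = monom 1 CARD('k) + (\<Sum>j\<in>UNIV. monom ((-1) ^ card {..j} * \<sigma> $ j) (CARD('k) - card {..j}))"

lemma coeff_monic_poly:
  fixes \<sigma> :: "'k::{finite,linorder} space"
  shows "coeff (monic_poly \<sigma>) (CARD('k) - card {..j}) = (-1) ^ card {..j} * \<sigma> $ j"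
proof -
  have eq: "CARD('k) - card {..i} = CARD('k) - card {..j} \<longleftrightarrow> i = j" for i :: 'k
    using rank_bounds[of i] rank_bounds[of j] injD[OF rank_inj, of i j] by auto
  have "CARD('k) \<noteq> CARD('k) - card {..j}"
    using rank_bounds[of j] by simp
  then show ?thesis unfolding monic_poly_def by (simp add: coeff_sum eq)
qed

lemma monic_poly_inject: "monic_poly \<sigma> = monic_poly \<tau> \<Longrightarrow> \<sigma> = \<tau>"
  using coeff_monic_poly[of \<sigma>] coeff_monic_poly[of \<tau>] by (auto simp: vec_eq_iff)

lemma degree_monic_poly:
  fixes \<sigma> :: "'k::{finite,linorder} space"
  shows "degree (monic_poly \<sigma>) = CARD('k)" "lead_coeff (monic_poly \<sigma>) = 1"
proof -
  have *: "coeff (monic_poly \<sigma>) n = (if n = CARD('k) then 1 else 0)" if "n \<ge> CARD('k)" for n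
  proof -
    have "CARD('k) - card {..j} \<noteq> n" for j :: 'k using that rank_bounds[of j] by simp
    then show ?thesis using that unfolding monic_poly_def by (simp add: coeff_sum)
  qed
  then show "degree (monic_poly \<sigma>) = CARD('k)"
    by (intro antisym degree_le le_degree) auto
  then show "lead_coeff (monic_poly \<sigma>) = 1" using * by simp
qed

lemma poly_monic_poly:
  fixes \<sigma> :: "'k::{finite,linorder} space"
  shows "poly (monic_poly \<sigma>) t =
    t ^ CARD('k) + (\<Sum>j\<in>UNIV. (-1) ^ card {..j} * \<sigma> $ j * t ^ (CARD('k) - card {..j}))"
  unfolding monic_poly_def by (simp add: poly_sum poly_monom)

lemma poly_monic_poly_elem_sym:
  fixes x :: "'k::{finite,linorder} space"
  shows "poly (monic_poly (elem_sym x)) t = (\<Prod>i\<in>UNIV. t - x $ i)"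
proof -
  define a where "a n = (-1) ^ n * t ^ (CARD('k) - n) * (\<Sum>S | card S = n. \<Prod>i\<in>S. x $ i)" for n
  have "{S :: 'k set. card S = 0} = {{}}" by auto
  then have a0: "a 0 = t ^ CARD('k)" by (simp add: a_def)
  have "(\<Prod>i\<in>UNIV. t - x $ i) = (\<Sum>n\<le>CARD('k). a n)"
    unfolding prod_elem_sym a_def ..
  also have "\<dots> = a 0 + (\<Sum>n\<in>{1..CARD('k)}. a n)"
  proof -
    have "{..CARD('k)} = insert 0 {1..CARD('k)}" by auto
    then show ?thesis by simp
  qed
  also have "(\<Sum>n\<in>{1..CARD('k)}. a n) = (\<Sum>j\<in>(UNIV::'k set). a (card {..j}))"
    by (rule sum.reindex_bij_betw[OF bij_betw_rank, symmetric])
  finally show ?thesis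
    by (simp add: poly_monic_poly a0) (simp add: a_def elem_sym_def mult_ac)
qed

lemma monic_poly_elem_sym: "monic_poly (elem_sym x) = (\<Prod>i\<in>UNIV. [:- (x $ i), 1:])"
  unfolding poly_eq_poly_eq_iff[symmetric] by (rule ext) (simp add: poly_monic_poly_elem_sym poly_prod)

text \<open>
  The fundamental theorem of algebra: take the roots of the monic polynomial of \<open>\<sigma>\<close>.
\<close>

lemma surj_elem_sym: "\<exists>x. elem_sym x = (\<sigma> :: 'k::{finite,linorder} space)"
proof -
  have "monic_poly \<sigma> \<noteq> 0" using degree_monic_poly(2)[of \<sigma>] by auto
  then obtain A where A: "size A = CARD('k)" "monic_poly \<sigma> = (\<Prod>x\<in>#A. [:- x, 1:])"
    using alg_closed_imp_factorization[of "monic_poly \<sigma>"] degree_monic_poly[of \<sigma>] by auto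
  obtain xs where xs: "mset xs = A" using ex_mset by blast
  obtain h where h: "bij_betw h (UNIV :: 'k set) {0..<CARD('k)}"
    using ex_bij_betw_finite_nat[of "UNIV :: 'k set"] by auto
  have len: "length xs = CARD('k)" using A(1) xs by auto
  have "monic_poly \<sigma> = prod_list (map (\<lambda>x. [:- x, 1:]) xs)"
    unfolding A(2) xs[symmetric] by (simp flip: mset_map prod_mset_prod_list)
  also have "\<dots> = (\<Prod>n\<in>{0..<CARD('k)}. [:- (xs ! n), 1:])"
    by (subst prod.list_conv_set_nth) (simp add: len)
  also have "\<dots> = (\<Prod>i\<in>UNIV. [:- (xs ! h i), 1:])"
    by (rule prod.reindex_bij_betw[OF h, symmetric])
  also have "\<dots> = monic_poly (elem_sym (\<chi> i. xs ! h i))"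
    by (simp add: monic_poly_elem_sym)
  finally show ?thesis using monic_poly_inject by metis
qed

text \<open>
  The monic polynomial of the image, a product over the coordinates, does not see their order.
\<close>

lemma elem_sym_perm:
  fixes x :: "'k::{finite,linorder} space"
  assumes w: "w permutes UNIV"
  shows "elem_sym (\<chi> i. x $ w i) = elem_sym x"
proof -
  have "monic_poly (elem_sym (\<chi> i. x $ w i)) = (\<Prod>i\<in>UNIV. [:- (x $ w i), 1:])"
    by (simp add: monic_poly_elem_sym)
  also have "\<dots> = (\<Prod>i\<in>UNIV. [:- (x $ i), 1:])"
    by (rule prod.reindex_bij_betw[OF permutes_imp_bij[OF w]])
  also have "\<dots> = monic_poly (elem_sym x)" by (simp add: monic_poly_elem_sym)
  finally show ?thesis by (rule monic_poly_inject)
qed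

lemma elem_sym_perm_vec: "w permutes UNIV \<Longrightarrow> elem_sym (perm_vec w x) = elem_sym x"
  unfolding perm_vec_def by (rule elem_sym_perm[OF permutes_inv])

lemma elem_sym_eq_perm_vec:
  assumes "elem_sym x = elem_sym y"
  obtains w where "w permutes UNIV" "x = perm_vec w y"
proof -
  obtain w where w: "w permutes UNIV" "\<And>i. x $ i = y $ w i"
    using elem_sym_eq_imp_perm[OF assms] by blast
  have "x = perm_vec (inv_into UNIV w) y"
    using w by (simp add: vec_eq_iff perm_vec_def permutes_inv_inv)
  then show ?thesis using that permutes_inv[OF w(1)] by blast
qed

section \<open>The quotient map\<close>

lemma has_derivative_vec_components:
  fixes H :: "'k::finite space \<Rightarrow> 'l::finite space"
  assumes "\<And>j. complex_differentiable_at (\<lambda>x. H x $ j) x"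
  shows "(H has_derivative (\<lambda>v. \<chi> j. \<Sum>i\<in>UNIV. v $ i * partial i (\<lambda>x. H x $ j) x)) (at x)"
proof (subst has_derivative_componentwise_within, rule ballI)
  fix b :: "'l space" assume "b \<in> Basis"
  then obtain j u where b: "b = axis j u" by (auto simp: Basis_vec_def)
  have "((\<lambda>x. H x $ j \<bullet> u) has_derivative (\<lambda>v. (\<Sum>i\<in>UNIV. v $ i * partial i (\<lambda>x. H x $ j) x) \<bullet> u)) (at x)"
    by (rule has_derivative_inner_left[OF complex_differentiable_has_derivative[OF assms]])
  then show "((\<lambda>x. H x \<bullet> b) has_derivative
      (\<lambda>v. (\<chi> j. \<Sum>i\<in>UNIV. v $ i * partial i (\<lambda>x. H x $ j) x) \<bullet> b)) (at x)"
    by (simp add: b inner_axis)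
qed

lemma complex_differentiable_elem_sym: "complex_differentiable_at (\<lambda>x. elem_sym x $ j) x"
  unfolding elem_sym_def by (simp, intro complex_differentiable_sum complex_differentiable_prod complex_differentiable_coord)

definition elem_sym_deriv :: "'k::{finite,linorder} space \<Rightarrow> 'k space \<Rightarrow> 'k space" where
  "elem_sym_deriv x v = (\<chi> j. \<Sum>i\<in>UNIV. v $ i * partial i (\<lambda>x. elem_sym x $ j) x)"

lemma elem_sym_has_derivative: "(elem_sym has_derivative elem_sym_deriv x) (at x)"
  using has_derivative_vec_components[of elem_sym, OF complex_differentiable_elem_sym] by (simp add: elem_sym_deriv_def[abs_def])

lemma elem_sym_deriv_smult: "elem_sym_deriv x (c *s v) = c *s elem_sym_deriv x v"
  by (simp add: elem_sym_deriv_def vec_eq_iff sum_distrib_left mult.assoc)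

lemma continuous_on_elem_sym: "continuous_on S elem_sym"
  using elem_sym_has_derivative has_derivative_continuous
  by (blast intro: continuous_at_imp_continuous_on)

lemma open_vimage_elem_sym: "open V \<Longrightarrow> open (elem_sym -` V)"
  by (rule open_vimage[OF _ continuous_on_elem_sym])

abbreviation simple_roots :: "'k::finite space \<Rightarrow> bool" where
  "simple_roots x \<equiv> inj (\<lambda>i. x $ i)"

lemma discriminant_nonzero_iff: "discriminant (elem_sym x) \<noteq> 0 \<longleftrightarrow> simple_roots x"
proof -
  have "finite {(i::'a, j). i < j}" by (rule finite_subset[of _ UNIV]) auto
  then have "discriminant (elem_sym x) \<noteq> 0 \<longleftrightarrow> (\<forall>i j. i < j \<longrightarrow> x $ i \<noteq> x $ j)"
    unfolding discriminant_elem_sym by (auto simp: prod_zero_iff)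
  also have "\<dots> \<longleftrightarrow> simple_roots x"
    unfolding inj_def by (metis linorder_less_linear less_irrefl)
  finally show ?thesis .
qed

text \<open>
  Differentiate the product of the factors \<open>t - y $ i\<close> in \<open>y\<close> in the direction \<open>v\<close>. In terms of the
  elementary symmetric functions, the result is zero for all \<open>t\<close>; at \<open>t = x $ l\<close> the product rule
  leaves only the term with \<open>v $ l\<close>, whose cofactor is nonzero as the roots are simple.
\<close>

lemma elem_sym_deriv_injective:
  fixes x :: "'k::{finite,linorder} space"
  assumes simple: "simple_roots x" and zero: "elem_sym_deriv x v = 0"
  shows "v = 0"
proof -
  have "v $ l = 0" for l
  proof -
    define t where "t = x $ l"
    have "((\<lambda>y. t ^ CARD('k) + (\<Sum>j\<in>UNIV. (-1) ^ card {..j} * elem_sym y $ j * t ^ (CARD('k) - card {..j})))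
        has_derivative (\<lambda>v. 0 + (\<Sum>j\<in>UNIV. (-1) ^ card {..j} * elem_sym_deriv x v $ j * t ^ (CARD('k) - card {..j})))) (at x)"
      by (intro has_derivative_add has_derivative_const has_derivative_sum has_derivative_mult_left has_derivative_mult_right
          bounded_linear.has_derivative[OF bounded_linear_vec_nth] elem_sym_has_derivative)
    moreover have "((\<lambda>y. \<Prod>i\<in>UNIV. t - y $ i) has_derivative
        (\<lambda>v. \<Sum>i\<in>UNIV. (0 - v $ i) * (\<Prod>j\<in>UNIV - {i}. t - x $ j))) (at x)"
      by (intro has_derivative_prod has_derivative_diff has_derivative_const
          bounded_linear_imp_has_derivative bounded_linear_vec_nth)
    ultimately have "(\<lambda>v. 0 + (\<Sum>j\<in>UNIV. (-1) ^ card {..j} * elem_sym_deriv x v $ j * t ^ (CARD('k) - card {..j}))) =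
        (\<lambda>v. \<Sum>i\<in>UNIV. (0 - v $ i) * (\<Prod>j\<in>UNIV - {i}. t - x $ j))"
      unfolding poly_monic_poly[symmetric] poly_monic_poly_elem_sym by (rule has_derivative_unique)
    from fun_cong[OF this, of v] have "0 = (\<Sum>i\<in>UNIV. (0 - v $ i) * (\<Prod>j\<in>UNIV - {i}. t - x $ j))"
      by (simp add: zero)
    also have "\<dots> = (\<Sum>i\<in>UNIV. if i = l then - (v $ l) * (\<Prod>j\<in>UNIV - {l}. t - x $ j) else 0)"
    proof (rule sum.cong[OF refl])
      fix i
      have "(\<Prod>j\<in>UNIV - {i}. t - x $ j) = 0" if "i \<noteq> l"
        using that by (intro prod_zero) (auto simp: t_def)
      then show "(0 - v $ i) * (\<Prod>j\<in>UNIV - {i}. t - x $ j) =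
          (if i = l then - (v $ l) * (\<Prod>j\<in>UNIV - {l}. t - x $ j) else 0)" by auto
    qed
    also have "\<dots> = - (v $ l) * (\<Prod>j\<in>UNIV - {l}. t - x $ j)" by simp
    finally have "v $ l = 0 \<or> (\<Prod>j\<in>UNIV - {l}. t - x $ j) = 0" by simp
    moreover have "(\<Prod>j\<in>UNIV - {l}. t - x $ j) \<noteq> 0"
      using simple by (auto simp: t_def inj_def)
    ultimately show ?thesis by blast
  qed
  then show ?thesis by (simp add: vec_eq_iff)
qed

text \<open>
  Solve the polynomial equation of a root for its leading term.
\<close>

lemma root_bound:
  fixes x :: "'k::{finite,linorder} space"
  shows "norm (x $ i) \<le> 1 + (\<Sum>j\<in>UNIV. norm (elem_sym x $ j))"
proof (cases "norm (x $ i) \<le> 1")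
  case True
  then show ?thesis by (simp add: add_increasing2 sum_nonneg)
next
  case False
  define z where "z = x $ i"
  define K where "K = CARD('k)"
  have K: "K > 0" by (simp add: K_def)
  have z: "norm z > 1" using False by (simp add: z_def)
  have "(\<Prod>l\<in>UNIV. z - x $ l) = 0" by (rule prod_zero) (auto simp: z_def)
  then have "z ^ K = - (\<Sum>j\<in>UNIV. (-1) ^ card {..j} * elem_sym x $ j * z ^ (K - card {..j}))"
    using poly_monic_poly_elem_sym[of x z] unfolding poly_monic_poly K_def by (simp add: eq_neg_iff_add_eq_0)
  then have "norm z ^ K = norm (\<Sum>j\<in>UNIV. (-1) ^ card {..j} * elem_sym x $ j * z ^ (K - card {..j}))"
    by (metis norm_minus_cancel norm_power)
  also have "\<dots> \<le> (\<Sum>j\<in>UNIV. norm (elem_sym x $ j) * norm z ^ (K - 1))"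
  proof (rule sum_norm_le)
    fix j :: 'k
    have "norm z ^ (K - card {..j}) \<le> norm z ^ (K - 1)"
      using z rank_bounds[of j] by (intro power_increasing) auto
    then show "norm ((-1) ^ card {..j} * elem_sym x $ j * z ^ (K - card {..j})) \<le> norm (elem_sym x $ j) * norm z ^ (K - 1)"
      by (simp add: norm_mult norm_power mult_left_mono)
  qed
  also have "\<dots> = (\<Sum>j\<in>UNIV. norm (elem_sym x $ j)) * norm z ^ (K - 1)"
    by (simp add: sum_distrib_right)
  finally have "norm z * norm z ^ (K - 1) \<le> (\<Sum>j\<in>UNIV. norm (elem_sym x $ j)) * norm z ^ (K - 1)"
    using K by (simp add: power_eq_if)
  moreover have "norm z ^ (K - 1) > 0" using z by (intro zero_less_power) linarith
  ultimately have "norm z \<le> (\<Sum>j\<in>UNIV. norm (elem_sym x $ j))"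
    by (rule mult_right_le_imp_le)
  then show ?thesis by (simp add: z_def)
qed

lemma norm_le_sum_components: "norm (x :: 'k::finite space) \<le> (\<Sum>i\<in>UNIV. norm (x $ i))"
  unfolding norm_vec_def by (rule L2_set_le_sum) simp

text \<open>
  By \<open>root_bound\<close>, preimages of a convergent sequence are bounded, so a subsequence of them converges.
\<close>

lemma closed_image_elem_sym:
  fixes C :: "('k::{finite,linorder} space) set"
  assumes C: "closed C"
  shows "closed (elem_sym ` C)"
  unfolding closed_sequential_limits
proof (intro allI impI)
  fix s :: "nat \<Rightarrow> 'k space" and \<sigma> assume s: "(\<forall>n. s n \<in> elem_sym ` C) \<and> s \<longlonglongrightarrow> \<sigma>"
  then have "\<forall>n. \<exists>x. x \<in> C \<and> s n = elem_sym x" by blast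
  from choice[OF this] obtain x where x: "\<And>n. x n \<in> C" "\<And>n. s n = elem_sym (x n)" by blast
  have "bounded (range s)" using s convergent_imp_bounded by blast
  then obtain B where B: "\<And>n. norm (s n) \<le> B" unfolding bounded_iff by auto
  have "norm (x n) \<le> (\<Sum>i\<in>(UNIV :: 'k set). 1 + (\<Sum>j\<in>(UNIV :: 'k set). B))" for n
  proof -
    have "norm (x n $ i) \<le> 1 + (\<Sum>j\<in>(UNIV :: 'k set). B)" for i
    proof -
      have "norm (elem_sym (x n) $ j) \<le> B" for j
        using Finite_Cartesian_Product.norm_nth_le[of "elem_sym (x n)" j] B[of n] x(2)[of n] by simp
      then have "(\<Sum>j\<in>UNIV. norm (elem_sym (x n) $ j)) \<le> (\<Sum>j\<in>(UNIV :: 'k set). B)" by (intro sum_mono)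
      then show ?thesis using root_bound[of "x n" i] by linarith
    qed
    then have "(\<Sum>i\<in>UNIV. norm (x n $ i)) \<le> (\<Sum>i\<in>(UNIV :: 'k set). 1 + (\<Sum>j\<in>(UNIV :: 'k set). B))"
      by (intro sum_mono)
    then show ?thesis using norm_le_sum_components order_trans by blast
  qed
  then have "bounded (range x)" unfolding bounded_iff by blast
  then obtain l r where r: "strict_mono r" "(x \<circ> r) \<longlonglongrightarrow> l"
    using bounded_imp_convergent_subsequence by blast
  have "l \<in> C" using closed_sequentially[OF C _ r(2)] x(1) by simp
  moreover have "(\<lambda>n. elem_sym ((x \<circ> r) n)) \<longlonglongrightarrow> elem_sym l"
    using r(2) elem_sym_has_derivative[of l, THEN has_derivative_continuous]
    by (intro isCont_tendsto_compose[of l elem_sym]) (auto simp: isCont_def comp_def)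
  moreover have "(s \<circ> r) \<longlonglongrightarrow> \<sigma>" using s r(1) LIMSEQ_subseq_LIMSEQ by blast
  moreover have "(s \<circ> r) = (\<lambda>n. elem_sym ((x \<circ> r) n))" using x(2) by (simp add: fun_eq_iff)
  ultimately have "\<sigma> = elem_sym l" using LIMSEQ_unique by metis
  then show "\<sigma> \<in> elem_sym ` C" using \<open>l \<in> C\<close> by blast
qed

lemma perm_vec_inverse:
  assumes "w permutes UNIV"
  shows "perm_vec w (perm_vec (inv_into UNIV w) x) = x" "perm_vec (inv_into UNIV w) (perm_vec w x) = x"
  using permutes_inverses[OF assms] permutes_inv_inv[OF assms] by (simp_all add: perm_vec_def vec_eq_iff)

lemma perm_vec_image_eq_vimage:
  assumes "w permutes UNIV"
  shows "perm_vec w ` V = perm_vec (inv_into UNIV w) -` V"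
proof (intro equalityI subsetI)
  fix x assume "x \<in> perm_vec (inv_into UNIV w) -` V"
  then have "perm_vec w (perm_vec (inv_into UNIV w) x) \<in> perm_vec w ` V" by blast
  then show "x \<in> perm_vec w ` V" by (simp only: perm_vec_inverse[OF assms])
qed (auto simp: perm_vec_inverse[OF assms])

lemma perm_vec_vimage_elem_sym:
  assumes "w permutes UNIV"
  shows "perm_vec w ` (elem_sym -` V) = elem_sym -` V"
  unfolding perm_vec_image_eq_vimage[OF assms] using elem_sym_perm_vec[OF permutes_inv[OF assms]] by auto

lemma bounded_linear_perm_vec: "bounded_linear (perm_vec w)"
  by (simp add: linear_conv_bounded_linear[symmetric] perm_vec_def[abs_def] linear_iff vec_eq_iff)

lemma open_perm_vec_image:
  assumes "w permutes UNIV" "open V"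
  shows "open (perm_vec w ` V)"
  unfolding perm_vec_image_eq_vimage[OF assms(1)]
  by (intro open_vimage assms(2) linear_continuous_on bounded_linear_perm_vec)

text \<open>
  The image of \<open>W\<close> is also the image of the saturated open set \<open>A\<close> of all points that agree with one
  of \<open>W\<close> up to a permutation, and the complement of the image of \<open>A\<close> is the image of the closed
  complement of \<open>A\<close>.
\<close>

lemma open_image_elem_sym:
  fixes W :: "('k::{finite,linorder} space) set"
  assumes "open W"
  shows "open (elem_sym ` W)"
proof -
  define A where "A = (\<Union>w\<in>{w. w permutes UNIV}. perm_vec w ` W)"
  have "open A" unfolding A_def by (intro open_UN ballI open_perm_vec_image assms) simp
  then have "open (- (elem_sym ` (- A)))" using closed_image_elem_sym[of "- A"] by blast
  moreover have "elem_sym ` W = - (elem_sym ` (- A))"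
  proof (intro equalityI subsetI)
    fix \<sigma> assume "\<sigma> \<in> elem_sym ` W"
    then obtain z where z: "z \<in> W" "\<sigma> = elem_sym z" by blast
    have "y \<in> A" if "\<sigma> = elem_sym y" for y
    proof -
      have "elem_sym y = elem_sym z" using that z by simp
      then obtain w where "w permutes UNIV" "y = perm_vec w z" by (rule elem_sym_eq_perm_vec)
      then show ?thesis using z(1) unfolding A_def by blast
    qed
    then show "\<sigma> \<in> - (elem_sym ` (- A))" by blast
  next
    fix \<sigma> assume \<sigma>: "\<sigma> \<in> - (elem_sym ` (- A))"
    obtain x where x: "elem_sym x = \<sigma>" using surj_elem_sym by blast
    then have "x \<in> A" using \<sigma> by blast
    then obtain w z where w: "w permutes UNIV" "z \<in> W" "x = perm_vec w z" unfolding A_def by blast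
    then have "\<sigma> = elem_sym z" using x elem_sym_perm_vec[OF w(1), of z] by simp
    then show "\<sigma> \<in> elem_sym ` W" using w(2) by blast
  qed
  ultimately show ?thesis by simp
qed

lemma open_simple_roots: "open {x :: 'k::finite space. simple_roots x}"
proof -
  have "{x :: 'k space. simple_roots x} = (\<Inter>(i, j)\<in>{(i, j). i \<noteq> j}. {x. x $ i \<noteq> x $ j})"
    by (auto simp: inj_def)
  moreover have "open {x :: 'k space. x $ i \<noteq> x $ j}" for i j
    by (intro open_Collect_neq continuous_intros)
  ultimately show ?thesis by (auto intro!: open_INT)
qed

lemma open_discriminant_nonzero: "open {\<sigma> :: 'k::{finite,linorder} space. discriminant \<sigma> \<noteq> 0}"
proof -
  have "{\<sigma>. discriminant \<sigma> \<noteq> 0} = - (elem_sym ` (- {x :: 'k space. simple_roots x}))"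
  proof (rule Set.set_eqI)
    fix \<sigma> :: "'k space"
    obtain x where x: "elem_sym x = \<sigma>" using surj_elem_sym by blast
    have "simple_roots y \<longleftrightarrow> discriminant \<sigma> \<noteq> 0" if "elem_sym y = \<sigma>" for y
      using discriminant_nonzero_iff[of y] that by simp
    then show "\<sigma> \<in> {\<sigma>. discriminant \<sigma> \<noteq> 0} \<longleftrightarrow> \<sigma> \<in> - (elem_sym ` (- {x. simple_roots x}))"
      using x by blast
  qed
  then show ?thesis
    using open_Compl[OF closed_image_elem_sym[OF closed_Compl[OF open_simple_roots]]] by (simp only:)
qed

section \<open>Local inverses of the quotient map\<close>

definition chart :: "('k::{finite,linorder} space) set \<Rightarrow> bool" where
  "chart W \<longleftrightarrow> open W \<and> inj_on elem_sym W \<and> (\<forall>x\<in>W. simple_roots x)"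

lemma chart_subset: "chart W \<Longrightarrow> open W' \<Longrightarrow> W' \<subseteq> W \<Longrightarrow> chart W'"
  unfolding chart_def by (blast intro: inj_on_subset)

text \<open>
  Points of a small ball around \<open>x\<close> with the same image differ by a permutation of the coordinates.
  Were it not trivial, two coordinates of \<open>x\<close> would be closer to each other than they are.
\<close>

lemma chart_exists:
  fixes x :: "'k::{finite,linorder} space"
  assumes simple: "simple_roots x" and V: "open V" "x \<in> V"
  obtains W where "chart W" "x \<in> W" "W \<subseteq> V"
proof -
  have "finite (range (\<lambda>i. x $ i))" by simp
  from finite_set_avoid[OF this] have "\<forall>i. \<exists>d>0. \<forall>z\<in>range (\<lambda>i. x $ i). z \<noteq> x $ i \<longrightarrow> d \<le> dist (x $ i) z"
    by blast
  from choice[OF this] obtain d where d: "\<And>i. d i > 0"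
    "\<And>i j. x $ j \<noteq> x $ i \<Longrightarrow> d i \<le> dist (x $ i) (x $ j)" by blast
  obtain e where e: "e > 0" "ball x e \<subseteq> V \<inter> {x. simple_roots x}"
    using open_Int[OF V(1) open_simple_roots] V(2) simple open_contains_ball[of "V \<inter> {x. simple_roots x}"] by blast
  \<comment> \<open>two coordinates can move by less than \<open>r\<close> each without meeting\<close>
  define r where "r = min e (Min (range d) / 2)"
  have rd: "2 * r \<le> d i" for i
  proof -
    have "Min (range d) \<le> d i" by (rule Min_le) auto
    moreover have "r \<le> Min (range d) / 2" unfolding r_def by (rule min.cobounded2)
    ultimately show ?thesis by linarith
  qed
  have "Min (range d) > 0" using d(1) by (subst Min_gr_iff) auto
  then have r: "r > 0" using e by (simp add: r_def)
  have "inj_on elem_sym (ball x r)"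
  proof (rule inj_onI)
    fix y z assume y: "y \<in> ball x r" and z: "z \<in> ball x r" and "elem_sym y = elem_sym z"
    then obtain w where w: "\<And>i. y $ i = z $ w i" using elem_sym_eq_imp_perm by blast
    have "w i = i" for i
    proof (rule ccontr)
      assume "w i \<noteq> i"
      then have "d i \<le> dist (x $ i) (x $ w i)" using d(2) simple by (auto simp: inj_def)
      also have "\<dots> \<le> dist (x $ i) (y $ i) + dist (z $ w i) (x $ w i)"
        using dist_triangle[of "x $ i" "x $ w i" "y $ i"] w[of i] by simp
      also have "\<dots> < r + r"
      proof (rule add_strict_mono)
        have "dist (x $ i) (y $ i) \<le> dist x y" "dist (z $ w i) (x $ w i) \<le> dist z x"
          by (rule dist_vec_nth_le)+
        then show "dist (x $ i) (y $ i) < r" "dist (z $ w i) (x $ w i) < r"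
          using y z by (simp_all add: dist_commute)
      qed
      finally show False using rd[of i] by simp
    qed
    then show "y = z" using w by (simp add: vec_eq_iff)
  qed
  moreover have "ball x r \<subseteq> V \<inter> {x. simple_roots x}"
    using e(2) subset_ball[of r e x] by (auto simp: r_def)
  ultimately have "chart (ball x r)" "ball x r \<subseteq> V" unfolding chart_def by auto
  then show ?thesis using that[of "ball x r"] r by simp
qed

lemma chart_open_image: "chart W \<Longrightarrow> open (elem_sym ` W)"
  unfolding chart_def by (intro open_image_elem_sym) simp

lemma chart_inverse_derivative:
  assumes W: "chart W" "x \<in> W"
  obtains D where "(inv_into W elem_sym has_derivative D) (at (elem_sym x))" "\<And>c v. D (c *s v) = c *s D v"
proof -
  let ?L = "elem_sym_deriv x"
  have lin: "linear ?L" using elem_sym_has_derivative has_derivative_linear by blast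
  have inj: "inj ?L"
    using elem_sym_deriv_injective[of x] W linear_injective_0[OF lin] by (auto simp: chart_def)
  obtain D where D: "linear D" "D \<circ> ?L = id" "?L \<circ> D = id"
    using linear_injective_isomorphism[OF lin inj] by (auto simp: fun_eq_iff)
  have "(inv_into W elem_sym has_derivative D) (at (elem_sym x))"
    using W by (intro has_derivative_inverse_strong[OF _ W(2) continuous_on_elem_sym _ elem_sym_has_derivative D(3)])
      (auto simp: chart_def)
  moreover have "D (c *s v) = c *s D v" for c v
  proof -
    have "?L (D (c *s v)) = ?L (c *s D v)"
      using D(3) by (simp add: elem_sym_deriv_smult fun_eq_iff)
    then show ?thesis using inj by (simp add: inj_eq)
  qed
  ultimately show ?thesis using that by blast
qed

text \<open>
  On a chart \<open>W\<close> every function is a pull-back under the quotient map; this is the function that it is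
  the pull-back of.
\<close>

definition push :: "('k::{finite,linorder} space) set \<Rightarrow> ('k space \<Rightarrow> complex) \<Rightarrow> 'k space \<Rightarrow> complex" where
  "push W f = (\<lambda>\<sigma>\<in>elem_sym ` W. f (inv_into W elem_sym \<sigma>))"

lemma push_elem_sym: "chart W \<Longrightarrow> x \<in> W \<Longrightarrow> push W f (elem_sym x) = f x"
  unfolding push_def chart_def by simp

lemma push_carrier:
  assumes W: "chart W" and f: "f hol_on W"
  shows "push W f \<in> carrier (hol (elem_sym ` W))"
  unfolding push_def
proof (rule restrict_carrier_hol[OF chart_open_image[OF W]])
  show "(\<lambda>\<sigma>. f (inv_into W elem_sym \<sigma>)) hol_on elem_sym ` W"
    unfolding hol_on_def
  proof
    fix \<sigma> assume "\<sigma> \<in> elem_sym ` W"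
    then obtain x where x: "x \<in> W" "\<sigma> = elem_sym x" by blast
    obtain D where D: "(inv_into W elem_sym has_derivative D) (at (elem_sym x))" "\<And>c v. D (c *s v) = c *s D v"
      using chart_inverse_derivative[OF W x(1)] by blast
    have "inv_into W elem_sym \<sigma> = x" using W x by (simp add: chart_def)
    moreover have "complex_differentiable_at f x" using f x(1) by (simp add: hol_on_def)
    ultimately show "complex_differentiable_at (\<lambda>\<sigma>. f (inv_into W elem_sym \<sigma>)) \<sigma>"
      unfolding x(2) by (intro complex_differentiable_compose[where H = "inv_into W elem_sym", OF D]) simp
  qed
qed

section \<open>Descent of invariant functions\<close>

text \<open>
  The last coordinate of \<open>\<sigma>\<close> is the constant term of the polynomial up to a sign.
\<close>

lemma monic_poly_add_axis_Max:
  fixes \<sigma> :: "'k::{finite,linorder} space"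
  shows "monic_poly (\<sigma> + axis (Max UNIV) t) = monic_poly \<sigma> + [:(-1) ^ CARD('k) * t:]"
proof -
  have "{..Max (UNIV :: 'k set)} = UNIV" by auto
  then have last: "card {..Max (UNIV :: 'k set)} = CARD('k)" by simp
  have "(\<Sum>j\<in>(UNIV :: 'k set). monom ((-1) ^ card {..j} * axis (Max UNIV) t $ j) (CARD('k) - card {..j})) =
      (\<Sum>j\<in>UNIV. if j = Max (UNIV :: 'k set) then [:(-1) ^ CARD('k) * t:] else 0)"
    by (rule sum.cong[OF refl]) (auto simp: axis_def last monom_0)
  moreover have "(\<Sum>j\<in>(UNIV :: 'k set). monom ((-1) ^ card {..j} * (\<sigma> + axis (Max UNIV) t) $ j) (CARD('k) - card {..j})) =
      (\<Sum>j\<in>(UNIV :: 'k set). monom ((-1) ^ card {..j} * \<sigma> $ j) (CARD('k) - card {..j})) +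
      (\<Sum>j\<in>(UNIV :: 'k set). monom ((-1) ^ card {..j} * axis (Max UNIV) t $ j) (CARD('k) - card {..j}))"
    unfolding sum.distrib[symmetric] by (rule sum.cong[OF refl]) (simp only: add_monom distrib_left vector_add_component)
  ultimately show ?thesis
    unfolding monic_poly_def by (simp add: add.assoc)
qed

lemma not_simple_roots_imp_double_root:
  fixes x :: "'k::{finite,linorder} space"
  assumes "\<not> simple_roots x"
  obtains z where "poly (monic_poly (elem_sym x)) z = 0" "poly (pderiv (monic_poly (elem_sym x))) z = 0"
proof -
  obtain i j where ij: "i \<noteq> j" "x $ i = x $ j" using assms by (auto simp: inj_def)
  define q where "q = (\<Prod>l\<in>UNIV - {i} - {j}. [:- (x $ l), 1:])"
  have "monic_poly (elem_sym x) = [:- (x $ i), 1:] * (\<Prod>l\<in>UNIV - {i}. [:- (x $ l), 1:])"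
    unfolding monic_poly_elem_sym by (rule prod.remove) auto
  also have "(\<Prod>l\<in>UNIV - {i}. [:- (x $ l), 1:]) = [:- (x $ j), 1:] * q"
    unfolding q_def using ij by (intro prod.remove) auto
  finally have eq: "monic_poly (elem_sym x) = [:- (x $ i), 1:] * ([:- (x $ i), 1:] * q)" by (simp only: ij)
  show ?thesis
  proof (rule that[of "x $ i"])
    show "poly (monic_poly (elem_sym x)) (x $ i) = 0" unfolding eq poly_mult by simp
    show "poly (pderiv (monic_poly (elem_sym x))) (x $ i) = 0"
      unfolding eq pderiv_mult[of "[:- (x $ i), 1:]" "[:- (x $ i), 1:] * q"] poly_add poly_mult by simp
  qed
qed

text \<open>
  Lines in the direction of the last coordinate never lie in the discriminant: for a polynomial \<open>p\<close>,
  \<open>p + c\<close> has a multiple root for finitely many constants \<open>c\<close> only, namely for the values \<open>- p z\<close> at the zeros \<open>z\<close> of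
  the derivative of \<open>p\<close>.
\<close>

lemma finite_discriminant_zeros_last:
  fixes \<sigma> :: "'k::{finite,linorder} space"
  shows "finite {t. discriminant (\<sigma> + axis (Max UNIV) t) = 0}"
proof (rule finite_subset)
  define p where "p = monic_poly \<sigma>"
  define e where "e = (-1 :: complex) ^ CARD('k)"
  have e: "e * e = 1" by (simp add: e_def flip: power_mult_distrib)
  show "{t. discriminant (\<sigma> + axis (Max UNIV) t) = 0} \<subseteq> (\<lambda>z. - e * poly p z) ` {z. poly (pderiv p) z = 0}"
  proof
    fix t assume "t \<in> {t. discriminant (\<sigma> + axis (Max UNIV) t) = 0}"
    moreover obtain x where x: "elem_sym x = \<sigma> + axis (Max UNIV) t" using surj_elem_sym by blast
    ultimately have "\<not> simple_roots x" using discriminant_nonzero_iff[of x] by simp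
    then obtain z where z: "poly (monic_poly (elem_sym x)) z = 0" "poly (pderiv (monic_poly (elem_sym x))) z = 0"
      by (rule not_simple_roots_imp_double_root)
    have eq: "monic_poly (elem_sym x) = p + [:e * t:]" unfolding x monic_poly_add_axis_Max p_def e_def ..
    have "poly (pderiv p) z = 0" using z(2) unfolding eq by (simp add: pderiv_add pderiv_pCons)
    moreover have "t = - e * poly p z"
    proof -
      have "poly p z = - (e * t)" using z(1) unfolding eq by (simp add: eq_neg_iff_add_eq_0)
      then have "- e * poly p z = (e * e) * t" by simp
      then show ?thesis using e by simp
    qed
    ultimately show "t \<in> (\<lambda>z. - e * poly p z) ` {z. poly (pderiv p) z = 0}" by blast
  qed
  have "pderiv p \<noteq> 0" unfolding pderiv_eq_0_iff p_def degree_monic_poly by simp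
  then show "finite ((\<lambda>z. - e * poly p z) ` {z. poly (pderiv p) z = 0})"
    using poly_roots_finite by blast
qed

lemma compact_shift_ball:
  fixes K :: "('a::real_normed_vector) set"
  assumes "compact K" "open O'" "K \<subseteq> O'"
  obtains d where "d > 0" "\<And>x y. x \<in> K \<Longrightarrow> norm (y - x) < d \<Longrightarrow> y \<in> O'"
proof -
  obtain d where "d > 0" "(\<Union>x\<in>K. ball x d) \<subseteq> O'"
    using compact_subset_open_imp_ball_epsilon_subset[OF assms] by blast
  then show ?thesis
  proof (intro that[of d])
    fix x y assume "x \<in> K" "norm (y - x) < d"
    then have "y \<in> (\<Union>x\<in>K. ball x d)" by (auto simp: dist_norm norm_minus_commute)
    then show "y \<in> O'" using \<open>(\<Union>x\<in>K. ball x d) \<subseteq> O'\<close> by blast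
  qed
qed

text \<open>
  Riemann's extension theorem for the discriminant. In the last coordinate, \<open>g\<close> is continuous and
  holomorphic off a finite set, so it is given by Cauchy's formula on a circle. The circle around \<open>a\<close> can be
  chosen to avoid the discriminant; then so do its translates to nearby points, and
  the Cauchy integral is holomorphic in all variables.
\<close>

lemma hol_on_if_hol_on_discriminant_nonzero:
  fixes g :: "'k::{finite,linorder} space \<Rightarrow> complex"
  assumes V: "open V" and cont: "continuous_on V g"
    and hol: "g hol_on V \<inter> {\<sigma>. discriminant \<sigma> \<noteq> 0}"
  shows "g hol_on V"
  unfolding hol_on_def
proof
  fix a assume a: "a \<in> V"
  let ?k = "Max (UNIV :: 'k set)"
  let ?O = "V \<inter> {\<sigma> :: 'k space. discriminant \<sigma> \<noteq> 0}"
  have opO: "open ?O" using V open_discriminant_nonzero by (rule open_Int)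
  obtain e where e: "e > 0" "ball a e \<subseteq> V" using V a open_contains_ball by blast
  \<comment> \<open>only finitely many radii are excluded\<close>
  obtain r where r: "0 < r" "r < e" "\<And>t. norm t = r \<Longrightarrow> discriminant (a + axis ?k t) \<noteq> 0"
  proof -
    have "infinite {0<..<e}" using e by (simp add: infinite_Ioo)
    moreover have "finite (norm ` {t. discriminant (a + axis ?k t) = 0})"
      using finite_discriminant_zeros_last by blast
    ultimately have "infinite ({0<..<e} - norm ` {t. discriminant (a + axis ?k t) = 0})"
      by (rule Diff_infinite_finite[rotated])
    then obtain r where "r \<in> {0<..<e} - norm ` {t. discriminant (a + axis ?k t) = 0}"
      using infinite_imp_nonempty by blast
    then show ?thesis using that[of r] by auto
  qed
  have cont_ax: "continuous_on S (\<lambda>t. a + axis ?k t)" for S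
    by (intro continuous_intros)
  have "compact ((\<lambda>t. a + axis ?k t) ` sphere 0 r)"
    by (intro compact_continuous_image cont_ax compact_sphere)
  moreover have "(\<lambda>t. a + axis ?k t) ` sphere 0 r \<subseteq> ?O"
    using r e by (auto simp: subset_iff dist_norm)
  ultimately obtain d where d: "d > 0"
    "\<And>x y. x \<in> (\<lambda>t. a + axis ?k t) ` sphere 0 r \<Longrightarrow> norm (y - x) < d \<Longrightarrow> y \<in> ?O"
    using compact_shift_ball[OF _ opO] by metis
  \<comment> \<open>translates of the circle by less than \<open>d\<close> avoid the discriminant; by less than \<open>e - r\<close>, the translated discs stay in \<open>V\<close>\<close>
  define d' where "d' = min d (e - r)"
  have d': "d' > 0" using d r by (simp add: d'_def)
  have sphere: "x + axis ?k t \<in> ?O" if "x \<in> ball a d'" "norm t = r" for x t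
  proof (rule d(2))
    show "a + axis ?k t \<in> (\<lambda>t. a + axis ?k t) ` sphere 0 r" using that by auto
    have "norm (x + axis ?k t - (a + axis ?k t)) = dist a x" by (simp add: dist_norm norm_minus_commute)
    then show "norm (x + axis ?k t - (a + axis ?k t)) < d" using that by (simp add: d'_def)
  qed
  have disc: "x + axis ?k t \<in> V" if "x \<in> ball a d'" "norm t \<le> r" for x t
  proof -
    have "dist a (x + axis ?k t) \<le> dist a x + norm t"
      using dist_triangle[of a "x + axis ?k t" x] by (simp add: dist_norm)
    then show ?thesis using that e(2) by (auto simp: d'_def)
  qed
  have formula: "g x = 1 / (2 * of_real pi * \<i>) * circle_mean ?k r (\<lambda>t. 1 / t) g x" if x: "x \<in> ball a d'" for x
  proof -
    let ?G = "\<lambda>t. g (x + axis ?k t)"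
    have contG: "continuous_on (cball 0 r) ?G"
    proof (rule continuous_on_compose2[OF cont])
      show "continuous_on (cball 0 r) (\<lambda>t. x + axis ?k t)" by (intro continuous_intros)
      show "(\<lambda>t. x + axis ?k t) ` cball 0 r \<subseteq> V" using disc[OF x] by auto
    qed
    have "?G holomorphic_on ball 0 r"
    proof (rule no_isolated_singularity[OF _ _ open_ball finite_discriminant_zeros_last[of x]])
      show "continuous_on (ball 0 r) ?G" using contG ball_subset_cball by (rule continuous_on_subset)
      show "?G holomorphic_on ball 0 r - {t. discriminant (x + axis ?k t) = 0}"
        by (rule hol_on_axis_holomorphic[OF hol]) (use disc[OF x] in auto)
    qed
    then have "((\<lambda>t. ?G t / (t - 0)) has_contour_integral (2 * of_real pi * \<i> * ?G 0)) (circlepath 0 r)"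
      using contG r(1) by (intro Cauchy_integral_circlepath) auto
    moreover have "axis ?k (0::complex) = 0" by (simp add: vec_eq_iff axis_def)
    ultimately have "circle_mean ?k r (\<lambda>t. 1 / t) g x = 2 * of_real pi * \<i> * g x"
      unfolding circle_mean_def by (intro contour_integral_unique) simp
    then show ?thesis by simp
  qed
  have "circle_mean ?k r (\<lambda>t. 1 / t) g hol_on ball a d'"
  proof (rule circle_mean_hol_on[OF hol opO _ _ sphere])
    show "continuous_on (sphere 0 r) (\<lambda>t::complex. 1 / t)"
      using r by (intro continuous_intros) auto
  qed (use r in simp)
  then have "(\<lambda>x. 1 / (2 * of_real pi * \<i>) * circle_mean ?k r (\<lambda>t. 1 / t) g x) hol_on ball a d'"
    by (intro hol_on_mult hol_on_const)
  then have "g hol_on ball a d'"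
    by (rule hol_on_cong[OF open_ball, rotated]) (simp only: formula)
  then show "complex_differentiable_at g a" using d' by (simp add: hol_on_def)
qed

lemma pullback_apply: "x \<in> elem_sym -` V \<Longrightarrow> pullback V g x = g (elem_sym x)"
  by (simp add: pullback_def)

lemma pullback_carrier:
  assumes V: "open V" and g: "g \<in> carrier (hol V)"
  shows "pullback V g \<in> carrier (hol (elem_sym -` V))"
  unfolding pullback_def
proof (rule restrict_carrier_hol[OF open_vimage_elem_sym[OF V]])
  show "(\<lambda>x. g (elem_sym x)) hol_on elem_sym -` V"
    unfolding hol_on_def
  proof
    fix x assume "x \<in> elem_sym -` V"
    then have "complex_differentiable_at g (elem_sym x)"
      using g by (simp add: carrier_hol_iff hol_on_def)
    then show "complex_differentiable_at (\<lambda>x. g (elem_sym x)) x"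
      by (rule complex_differentiable_compose[OF elem_sym_has_derivative elem_sym_deriv_smult])
  qed
qed

lemma pullback_inject:
  assumes g: "g \<in> carrier (hol V)" and h: "h \<in> carrier (hol V)" and eq: "pullback V g = pullback V h"
  shows "g = h"
proof (rule extensionalityI[OF carrier_hol_extensional[OF g] carrier_hol_extensional[OF h]])
  fix \<sigma> assume "\<sigma> \<in> V"
  moreover obtain x where "elem_sym x = \<sigma>" using surj_elem_sym by blast
  ultimately show "g \<sigma> = h \<sigma>" using fun_cong[OF eq, of x] by (simp add: pullback_apply)
qed

lemma perm_fun_pullback:
  assumes "w permutes UNIV"
  shows "perm_fun w (pullback V g) = pullback V g"
proof
  fix x
  have w: "inv_into UNIV w permutes UNIV" using assms by (rule permutes_inv)
  show "perm_fun w (pullback V g) x = pullback V g x"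
    using elem_sym_perm_vec[OF w, of x] by (simp add: perm_fun_def pullback_def)
qed

text \<open>
  Fibres of the quotient map are orbits.
\<close>

lemma inv_hol_factor:
  assumes f: "f \<in> inv_hol V" and eq: "elem_sym x = elem_sym y"
  shows "f x = f y"
proof -
  obtain w where w: "w permutes UNIV" "x = perm_vec w y" using elem_sym_eq_perm_vec[OF eq] by blast
  have "inv_into UNIV w permutes UNIV" using w(1) by (rule permutes_inv)
  then have "perm_fun (inv_into UNIV w) f = f" using f by (simp add: inv_hol_def)
  from fun_cong[OF this, of y] show ?thesis
    using w by (simp add: perm_fun_def permutes_inv_inv)
qed

text \<open>
  The induced function is continuous since the quotient map is closed, holomorphic off the discriminant by
  means of charts, and hence holomorphic.
\<close>

theorem inv_hol_descends:
  fixes f :: "'k::{finite,linorder} space \<Rightarrow> complex"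
  assumes V: "open V" and f: "f \<in> inv_hol V"
  obtains g where "g \<in> carrier (hol V)" "pullback V g = f"
proof -
  define g where "g = (\<lambda>\<sigma>\<in>V. f (SOME x. elem_sym x = \<sigma>))"
  have fc: "f \<in> carrier (hol (elem_sym -` V))" using f by (simp add: inv_hol_def)
  have g: "g (elem_sym x) = f x" if "elem_sym x \<in> V" for x
  proof -
    have "elem_sym (SOME y. elem_sym y = elem_sym x) = elem_sym x" by (rule someI) (rule refl)
    then show ?thesis using that inv_hol_factor[OF f, of "SOME y. elem_sym y = elem_sym x" x] by (simp add: g_def)
  qed
  have opV: "open (elem_sym -` V :: 'k space set)" by (rule open_vimage_elem_sym[OF V])
  have pb: "pullback V g = f"
  proof (rule extensionalityI[of _ "elem_sym -` V"])
    show "pullback V g \<in> extensional (elem_sym -` V)" by (simp add: pullback_def)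
    show "f \<in> extensional (elem_sym -` V)" by (rule carrier_hol_extensional[OF fc])
    show "pullback V g x = f x" if "x \<in> elem_sym -` V" for x
      using that g[of x] by (simp add: pullback_apply)
  qed
  have cont: "continuous_on V g"
    unfolding continuous_on_open_vimage[OF V]
  proof (intro allI impI)
    fix B :: "complex set" assume B: "open B"
    define A where "A = f -` B \<inter> elem_sym -` V"
    have "continuous_on (elem_sym -` V) f"
      using hol_on_continuous[OF carrier_hol_hol_on[OF fc]] .
    then have "open A" unfolding A_def using B continuous_on_open_vimage[OF opV] by blast
    then have "open (- (elem_sym ` (- A)))" using closed_image_elem_sym[of "- A"] by blast
    moreover have "g -` B \<inter> V = - (elem_sym ` (- A))"
    proof (rule Set.set_eqI)
      fix \<sigma> :: "'k space"
      have "y \<in> A \<longleftrightarrow> \<sigma> \<in> g -` B \<inter> V" if "elem_sym y = \<sigma>" for y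
        using g[of y] that by (auto simp: A_def)
      moreover obtain x where "elem_sym x = \<sigma>" using surj_elem_sym by blast
      ultimately show "\<sigma> \<in> g -` B \<inter> V \<longleftrightarrow> \<sigma> \<in> - (elem_sym ` (- A))" by blast
    qed
    ultimately show "open (g -` B \<inter> V)" by (simp only:)
  qed
  have "g hol_on V \<inter> {\<sigma>. discriminant \<sigma> \<noteq> 0}"
    unfolding hol_on_def
  proof
    fix \<sigma> assume \<sigma>: "\<sigma> \<in> V \<inter> {\<sigma>. discriminant \<sigma> \<noteq> 0}"
    obtain x where x: "elem_sym x = \<sigma>" using surj_elem_sym by blast
    then have "simple_roots x" using \<sigma> discriminant_nonzero_iff[of x] by simp
    then obtain W where W: "chart W" "x \<in> W" "W \<subseteq> elem_sym -` V"
      using chart_exists[OF _ opV] x \<sigma> by blast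
    have "f hol_on W" using hol_on_subset[OF carrier_hol_hol_on[OF fc] W(3)] .
    then have "push W f hol_on elem_sym ` W" by (rule carrier_hol_hol_on[OF push_carrier[OF W(1)]])
    then have "g hol_on elem_sym ` W"
    proof (rule hol_on_cong[OF chart_open_image[OF W(1)], rotated])
      fix \<tau> assume "\<tau> \<in> elem_sym ` W"
      then obtain y where y: "y \<in> W" "\<tau> = elem_sym y" by blast
      then have "elem_sym y \<in> V" using W(3) by blast
      then show "push W f \<tau> = g \<tau>" unfolding y(2) using push_elem_sym[OF W(1) y(1), of f] g[of y] by simp
    qed
    then show "complex_differentiable_at g \<sigma>" using x W(2) by (auto simp: hol_on_def)
  qed
  then have "g hol_on V" by (rule hol_on_if_hol_on_discriminant_nonzero[OF V cont])
  then have "g \<in> carrier (hol V)" by (simp add: carrier_hol_iff g_def)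
  then show ?thesis using pb that by blast
qed

lemma \<theta>_pullback: "g \<in> carrier (hol V) \<Longrightarrow> \<theta> V (pullback V g) = g"
  unfolding \<theta>_def by (rule inv_into_f_f[OF inj_onI]) (erule (2) pullback_inject)

lemma \<theta>_inv_hol:
  assumes "open V" "f \<in> inv_hol V"
  shows "\<theta> V f \<in> carrier (hol V)" "pullback V (\<theta> V f) = f"
proof -
  obtain g where g: "g \<in> carrier (hol V)" "pullback V g = f" by (rule inv_hol_descends[OF assms])
  have "\<theta> V f = g" using \<theta>_pullback[OF g(1)] unfolding g(2) .
  then show "\<theta> V f \<in> carrier (hol V)" "pullback V (\<theta> V f) = f" using g by (simp_all only:)
qed

section \<open>Related operators\<close>

lemma perm_fun_carrier:
  assumes w: "w permutes UNIV" and V: "open V" and f: "f \<in> carrier (hol V)"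
  shows "perm_fun w f \<in> carrier (hol (perm_vec w ` V))"
proof -
  have eq: "perm_fun w f = (\<lambda>x. f (perm_vec (inv_into UNIV w) x))"
    by (simp only: perm_fun_def comp_def)
  have "perm_fun w f \<in> extensional (perm_vec w ` V)"
  proof (unfold extensional_def, intro CollectI allI impI)
    fix x assume "x \<notin> perm_vec w ` V"
    then have "perm_vec (inv_into UNIV w) x \<notin> V" unfolding perm_vec_image_eq_vimage[OF w] by simp
    then show "perm_fun w f x = undefined"
      unfolding eq by (rule extensional_arb[OF carrier_hol_extensional[OF f]])
  qed
  moreover have "perm_fun w f hol_on perm_vec w ` V"
    unfolding hol_on_def
  proof
    fix x assume "x \<in> perm_vec w ` V"
    then have "perm_vec (inv_into UNIV w) x \<in> V" unfolding perm_vec_image_eq_vimage[OF w] by simp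
    then have f': "complex_differentiable_at f (perm_vec (inv_into UNIV w) x)"
      using carrier_hol_hol_on[OF f] by (simp add: hol_on_def)
    have smult: "perm_vec u (c *s v) = c *s perm_vec u v" for u c v
      by (simp add: perm_vec_def vec_eq_iff)
    show "complex_differentiable_at (perm_fun w f) x"
      unfolding eq
      by (rule complex_differentiable_compose[OF bounded_linear_imp_has_derivative[OF bounded_linear_perm_vec] smult f'])
  qed
  ultimately show ?thesis by (simp only: carrier_hol_iff)
qed

lemma perm_fun_inverse:
  assumes "w permutes UNIV"
  shows "perm_fun w (perm_fun (inv_into UNIV w) f) = f"
  unfolding perm_fun_def comp_def permutes_inv_inv[OF assms] perm_vec_inverse[OF assms] ..

lemma perm_fun_restrict:
  assumes "w permutes UNIV"
  shows "perm_fun w (restrict f W) = restrict (perm_fun w f) (perm_vec w ` W)"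
  unfolding perm_vec_image_eq_vimage[OF assms] perm_fun_def restrict_def comp_def vimage_eq ..

lemma sheaf_endo_perm_op:
  assumes w: "w permutes UNIV" and P: "sheaf_endo (elem_sym -` U) P"
  shows "sheaf_endo (elem_sym -` U) (perm_op w P)"
proof -
  let ?v = "inv_into UNIV w"
  have v: "?v permutes UNIV" using w by (rule permutes_inv)
  have img: "perm_vec w ` perm_vec ?v ` V = V" for V
    by (simp add: image_image perm_vec_inverse[OF w])
  have sub: "perm_vec u ` V \<subseteq> elem_sym -` U" if "u permutes UNIV" "V \<subseteq> elem_sym -` U" for u V
    using image_mono[OF that(2), of "perm_vec u"] perm_vec_vimage_elem_sym[OF that(1), of U] by simp
  have carrier: "P (perm_vec ?v ` V) (perm_fun ?v f) \<in> carrier (hol (perm_vec ?v ` V))"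
    if "open V" "V \<subseteq> elem_sym -` U" "f \<in> carrier (hol V)" for V f
    by (rule sheaf_endo_carrier[OF P open_perm_vec_image[OF v that(1)] sub[OF v that(2)] perm_fun_carrier[OF v that(1,3)]])
  have "sheaf_endo (elem_sym -` U) (op_restrict (elem_sym -` U) (perm_op w P))"
  proof (rule sheaf_endo_op_restrictI)
    fix V f assume V: "open V" "V \<subseteq> elem_sym -` U" and f: "f \<in> carrier (hol V)"
    show "perm_op w P V f \<in> carrier (hol V)"
      using perm_fun_carrier[OF w open_perm_vec_image[OF v V(1)] carrier[OF V f]]
      unfolding perm_op_def img .
    fix W assume W: "open W" "W \<subseteq> V"
    have "P (perm_vec ?v ` W) (perm_fun ?v (restrict f W)) = restrict (P (perm_vec ?v ` V) (perm_fun ?v f)) (perm_vec ?v ` W)"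
      unfolding perm_fun_restrict[OF v]
      by (rule sheaf_endo_restrict[OF P open_perm_vec_image[OF v V(1)] sub[OF v V(2)] perm_fun_carrier[OF v V(1) f]
            open_perm_vec_image[OF v W(1)] image_mono[OF W(2)]])
    then show "perm_op w P W (restrict f W) = restrict (perm_op w P V f) W"
      unfolding perm_op_def by (simp only: perm_fun_restrict[OF w] img)
  qed
  moreover have "op_restrict (elem_sym -` U) (perm_op w P) = perm_op w P"
  proof (intro ext)
    fix V f x
    show "op_restrict (elem_sym -` U) (perm_op w P) V f x = perm_op w P V f x"
    proof (cases "open V \<and> V \<subseteq> elem_sym -` U \<and> f \<in> carrier (hol V)")
      case True
      then show ?thesis by (simp only: op_restrict_def if_True simp_thms)
    next
      case False
      have "\<not> (open (perm_vec ?v ` V) \<and> perm_vec ?v ` V \<subseteq> elem_sym -` U \<and> perm_fun ?v f \<in> carrier (hol (perm_vec ?v ` V)))"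
      proof
        assume "open (perm_vec ?v ` V) \<and> perm_vec ?v ` V \<subseteq> elem_sym -` U \<and> perm_fun ?v f \<in> carrier (hol (perm_vec ?v ` V))"
        then have "open (perm_vec w ` perm_vec ?v ` V)" "perm_vec w ` perm_vec ?v ` V \<subseteq> elem_sym -` U"
          "perm_fun w (perm_fun ?v f) \<in> carrier (hol (perm_vec w ` perm_vec ?v ` V))"
          using open_perm_vec_image[OF w] sub[OF w] perm_fun_carrier[OF w] by blast+
        then show False using False unfolding img perm_fun_inverse[OF w] by blast
      qed
      then have "op_restrict (elem_sym -` U) P (perm_vec ?v ` V) (perm_fun ?v f) = (\<lambda>_. undefined)"
        by (simp only: op_restrict_def if_False)
      moreover have "op_restrict (elem_sym -` U) P = P" using P unfolding sheaf_endo_def by (rule conjunct1)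
      ultimately have "perm_op w P V f x = undefined"
        by (simp add: perm_op_def perm_fun_def)
      moreover have "op_restrict (elem_sym -` U) (perm_op w P) V f x = undefined"
        using False by (simp only: op_restrict_def if_False)
      ultimately show ?thesis by simp
    qed
  qed
  ultimately show ?thesis by simp
qed

text \<open>
  Sheaf endomorphisms intertwined by the pull-back. Each of them determines the other, so all
  structure can be transported along this relation.
\<close>

definition related :: "('k::{finite,linorder} space) set \<Rightarrow> 'k op \<Rightarrow> 'k op \<Rightarrow> bool" where
  "related U P Q \<longleftrightarrow> sheaf_endo (elem_sym -` U) P \<and> sheaf_endo U Q \<and>
     (\<forall>V g. open V \<and> V \<subseteq> U \<and> g \<in> carrier (hol V) \<longrightarrow> P (elem_sym -` V) (pullback V g) = pullback V (Q V g))"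

lemma relatedI:
  assumes "sheaf_endo (elem_sym -` U) P" "sheaf_endo U Q"
    "\<And>V g. open V \<Longrightarrow> V \<subseteq> U \<Longrightarrow> g \<in> carrier (hol V) \<Longrightarrow> P (elem_sym -` V) (pullback V g) = pullback V (Q V g)"
  shows "related U P Q"
  using assms unfolding related_def by blast

lemma relatedD:
  assumes "related U P Q"
  shows "sheaf_endo (elem_sym -` U) P" "sheaf_endo U Q"
    "open V \<Longrightarrow> V \<subseteq> U \<Longrightarrow> g \<in> carrier (hol V) \<Longrightarrow> P (elem_sym -` V) (pullback V g) = pullback V (Q V g)"
  using assms unfolding related_def by simp_all

lemma related_apply:
  assumes "related U P Q" "open V" "V \<subseteq> U" "g \<in> carrier (hol V)" "elem_sym x \<in> V"
  shows "P (elem_sym -` V) (pullback V g) x = Q V g (elem_sym x)"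
  unfolding relatedD(3)[OF assms(1-4)] using assms(5) by (simp add: pullback_apply)

text \<open>
  Pull-back is injective as the quotient map is surjective.
\<close>

lemma related_unique_right:
  assumes "related U P Q" "related U P Q'"
  shows "Q = Q'"
proof (rule sheaf_endo_eqI[OF relatedD(2)[OF assms(1)] relatedD(2)[OF assms(2)]])
  fix V g \<sigma> assume V: "open V" "V \<subseteq> U" "g \<in> carrier (hol V)" "\<sigma> \<in> V"
  obtain x where x: "elem_sym x = \<sigma>" using surj_elem_sym by blast
  show "Q V g \<sigma> = Q' V g \<sigma>"
    using related_apply[OF assms(1) V(1-3), of x] related_apply[OF assms(2) V(1-3), of x] V(4) x by simp
qed

lemma push_restrict:
  assumes W: "chart W" and W': "open W'" "W' \<subseteq> W"
  shows "push W' f = restrict (push W f) (elem_sym ` W')"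
proof (rule extensionalityI[of _ "elem_sym ` W'"])
  fix \<sigma> assume "\<sigma> \<in> elem_sym ` W'"
  then obtain x where x: "x \<in> W'" "\<sigma> = elem_sym x" by blast
  have "push W f (elem_sym x) = f x" using push_elem_sym[OF W] x W' by blast
  moreover have "push W' f (elem_sym x) = f x" using push_elem_sym[OF chart_subset[OF W W']] x by blast
  ultimately show "push W' f \<sigma> = restrict (push W f) (elem_sym ` W') \<sigma>" using x by simp
qed (simp_all only: push_def restrict_extensional)

lemma push_eqI:
  assumes W: "chart W" and h: "h \<in> extensional (elem_sym ` W)" and eq: "\<And>x. x \<in> W \<Longrightarrow> h (elem_sym x) = f x"
  shows "push W f = h"
proof (rule extensionalityI[OF _ h])
  show "push W f \<in> extensional (elem_sym ` W)" by (simp add: push_def)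
  fix \<sigma> assume "\<sigma> \<in> elem_sym ` W"
  then show "push W f \<sigma> = h \<sigma>" using push_elem_sym[OF W] eq by auto
qed

text \<open>
  On a chart every function is the restriction of a pull-back, and \<open>P\<close> commutes with restrictions.
\<close>

lemma related_chart:
  assumes rel: "related U P Q" and V: "open V" "V \<subseteq> elem_sym -` U" and f: "f \<in> carrier (hol V)"
    and W: "chart W" "x \<in> W" "W \<subseteq> V"
  shows "P V f x = Q (elem_sym ` W) (push W f) (elem_sym x)"
proof -
  let ?N = "elem_sym ` W"
  have opW: "open W" using W(1) by (simp add: chart_def)
  have N: "open ?N" "?N \<subseteq> U" using chart_open_image[OF W(1)] W(3) V(2) by auto
  have pc: "push W f \<in> carrier (hol ?N)"
    by (rule push_carrier[OF W(1) hol_on_subset[OF carrier_hol_hol_on[OF f] W(3)]])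
  have sub: "elem_sym -` ?N \<subseteq> elem_sym -` U" using N(2) by blast
  have eq: "restrict f W = restrict (pullback ?N (push W f)) W"
  proof (rule restrict_ext)
    fix y assume "y \<in> W"
    then show "f y = pullback ?N (push W f) y" using push_elem_sym[OF W(1), of y f] by (simp add: pullback_apply)
  qed
  have "P V f x = P W (restrict f W) x"
    by (rule sheaf_endo_local[OF relatedD(1)[OF rel] V f opW W(3,2), symmetric])
  also have "\<dots> = P (elem_sym -` ?N) (pullback ?N (push W f)) x"
    unfolding eq
    by (rule sheaf_endo_local[OF relatedD(1)[OF rel] open_vimage_elem_sym[OF N(1)] sub pullback_carrier[OF N(1) pc] opW _ W(2)])
      blast
  also have "\<dots> = Q ?N (push W f) (elem_sym x)"
    using W(2) by (intro related_apply[OF rel N pc]) blast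
  finally show ?thesis .
qed

text \<open>
  Along a direction with distinct coordinates, any two coordinates of a point coincide at most once.
\<close>

lemma finite_not_simple_roots_line:
  fixes x :: "'k::{finite,linorder} space"
  obtains c :: "'k space" where "finite {t. \<not> simple_roots (x + t *s c)}"
proof -
  \<comment> \<open>the ranks serve as distinct coordinates\<close>
  define c :: "'k space" where "c = (\<chi> i. of_nat (card {..i}))"
  have c: "c $ i \<noteq> c $ j" if "i \<noteq> j" for i j
    using that injD[OF rank_inj, of i j] by (auto simp: c_def)
  have "{t. \<not> simple_roots (x + t *s c)} \<subseteq> (\<lambda>(i, j). (x $ j - x $ i) / (c $ i - c $ j)) ` UNIV"
  proof
    fix t assume "t \<in> {t. \<not> simple_roots (x + t *s c)}"
    then obtain i j where ij: "i \<noteq> j" "x $ i + t * c $ i = x $ j + t * c $ j" by (auto simp: inj_def)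
    then have "t * (c $ i - c $ j) = x $ j - x $ i" by (simp add: algebra_simps)
    then have "t = (x $ j - x $ i) / (c $ i - c $ j)"
      using c[OF ij(1)] by (subst nonzero_eq_divide_eq) (simp_all only: right_minus_eq not_False_eq_True)
    then show "t \<in> (\<lambda>(i, j). (x $ j - x $ i) / (c $ i - c $ j)) ` UNIV" by auto
  qed
  then have "finite {t. \<not> simple_roots (x + t *s c)}" by (rule finite_subset) simp
  then show ?thesis by (rule that)
qed

lemma eq_if_eq_on_simple_roots:
  fixes F G :: "'k::{finite,linorder} space \<Rightarrow> complex"
  assumes V: "open V" "x \<in> V" and F: "continuous_on V F" and G: "continuous_on V G"
    and eq: "\<And>y. y \<in> V \<Longrightarrow> simple_roots y \<Longrightarrow> F y = G y"
  shows "F x = G x"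
proof -
  obtain c :: "'k space" where c: "finite {t. \<not> simple_roots (x + t *s c)}" by (rule finite_not_simple_roots_line)
  obtain d where d: "d > 0" "\<forall>t\<in>{t. \<not> simple_roots (x + t *s c)}. t \<noteq> 0 \<longrightarrow> d \<le> dist (0::complex) t"
    using finite_set_avoid[OF c, of 0] by blast
  have fin: "\<forall>\<^sub>F t in at (0::complex). simple_roots (x + t *s c)"
    unfolding eventually_at
  proof (intro exI[of _ d] conjI ballI impI d(1))
    fix t :: complex assume "t \<noteq> 0 \<and> dist t 0 < d"
    then show "simple_roots (x + t *s c)" using d(2) by (force simp: dist_commute)
  qed
  have "((\<lambda>t. x + t *s c) \<longlongrightarrow> x + 0 *s c) (at 0)"
    by (intro tendsto_intros bounded_linear.tendsto[OF bounded_linear_smult_left])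
  then have lim: "((\<lambda>t. x + t *s c) \<longlongrightarrow> x) (at 0)" by simp
  then have inV: "\<forall>\<^sub>F t in at 0. x + t *s c \<in> V" using V by (rule topological_tendstoD)
  have "isCont F x" "isCont G x" using F G V by (simp_all add: continuous_on_eq_continuous_at)
  then have "((\<lambda>t. F (x + t *s c)) \<longlongrightarrow> F x) (at 0)" "((\<lambda>t. G (x + t *s c)) \<longlongrightarrow> G x) (at 0)"
    using isCont_tendsto_compose[OF _ lim] by blast+
  then have "((\<lambda>t. F (x + t *s c) - G (x + t *s c)) \<longlongrightarrow> F x - G x) (at 0)"
    by (rule tendsto_diff)
  moreover have "\<forall>\<^sub>F t in at 0. F (x + t *s c) - G (x + t *s c) = 0"
    using fin inV by eventually_elim (simp add: eq)
  then have "((\<lambda>t. F (x + t *s c) - G (x + t *s c)) \<longlongrightarrow> 0) (at 0)"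
    by (rule tendsto_eventually)
  ultimately have "F x - G x = 0"
    by (rule tendsto_unique[OF at_neq_bot])
  then show ?thesis by simp
qed

text \<open>
  The two operators agree at points with simple roots by \<open>related_chart\<close>, and these are dense.
\<close>

lemma related_unique_left:
  assumes rel: "related U P Q" and rel': "related U P' Q"
  shows "P = P'"
proof (rule sheaf_endo_eqI[OF relatedD(1)[OF rel] relatedD(1)[OF rel']])
  fix V f x assume V: "open V" "V \<subseteq> elem_sym -` U" and f: "f \<in> carrier (hol V)" and x: "x \<in> V"
  show "P V f x = P' V f x"
  proof (rule eq_if_eq_on_simple_roots[OF V(1) x])
    show "continuous_on V (P V f)" "continuous_on V (P' V f)"
      using sheaf_endo_carrier[OF relatedD(1)[OF rel] V f] sheaf_endo_carrier[OF relatedD(1)[OF rel'] V f]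
      by (simp_all add: hol_on_continuous carrier_hol_hol_on)
    fix y assume y: "y \<in> V" "simple_roots y"
    obtain W where W: "chart W" "y \<in> W" "W \<subseteq> V" using chart_exists[OF y(2) V(1) y(1)] by blast
    show "P V f y = P' V f y"
      unfolding related_chart[OF rel V f W] related_chart[OF rel' V f W] ..
  qed
qed

lemma related_perm_op:
  assumes w: "w permutes UNIV" and rel: "related U P Q"
  shows "related U (perm_op w P) Q"
proof (rule relatedI[OF sheaf_endo_perm_op[OF w relatedD(1)[OF rel]] relatedD(2)[OF rel]])
  fix V g assume V: "open V" "V \<subseteq> U" "g \<in> carrier (hol V)"
  show "perm_op w P (elem_sym -` V) (pullback V g) = pullback V (Q V g)"
    unfolding perm_op_def
    by (simp only: perm_vec_vimage_elem_sym[OF permutes_inv[OF w]] perm_fun_pullback[OF permutes_inv[OF w]]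
        relatedD(3)[OF rel V] perm_fun_pullback[OF w])
qed

lemma pullback_restrict:
  assumes "W \<subseteq> V"
  shows "pullback W (restrict g W) = restrict (pullback V g) (elem_sym -` W)"
  using assms by (auto simp: pullback_def fun_eq_iff restrict_def)

text \<open>
  Invariance of \<open>P\<close> makes \<open>P\<close> of a pull-back an invariant function, and this one descends.
\<close>

lemma related_exists_right:
  fixes P :: "'k::{finite,linorder} op"
  assumes P: "sheaf_endo (elem_sym -` U) P" and inv: "\<And>w. w permutes UNIV \<Longrightarrow> perm_op w P = P"
  obtains Q where "related U P Q"
proof -
  define F where "F V g = P (elem_sym -` V) (pullback V g)" for V g
  have sub: "elem_sym -` V \<subseteq> elem_sym -` U" if "V \<subseteq> U" for V using that by blast
  have F: "F V g \<in> inv_hol V" if V: "open V" "V \<subseteq> U" "g \<in> carrier (hol V)" for V g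
    unfolding inv_hol_def
  proof (intro CollectI conjI allI impI)
    show "F V g \<in> carrier (hol (elem_sym -` V))"
      unfolding F_def
      by (rule sheaf_endo_carrier[OF P open_vimage_elem_sym[OF V(1)] sub[OF V(2)] pullback_carrier[OF V(1,3)]])
    fix w :: "'k \<Rightarrow> 'k" assume w: "w permutes UNIV"
    have "F V g = perm_op w P (elem_sym -` V) (pullback V g)" unfolding F_def inv[OF w] ..
    also have "\<dots> = perm_fun w (F V g)"
      unfolding perm_op_def F_def
      by (simp only: perm_vec_vimage_elem_sym[OF permutes_inv[OF w]] perm_fun_pullback[OF permutes_inv[OF w]])
    finally show "perm_fun w (F V g) = F V g" by (rule sym)
  qed
  define Q where "Q = op_restrict U (\<lambda>V g. \<theta> V (F V g))"
  have "sheaf_endo U Q"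
    unfolding Q_def
  proof (rule sheaf_endo_op_restrictI)
    fix V g assume V: "open V" "V \<subseteq> U" "g \<in> carrier (hol V)"
    show "\<theta> V (F V g) \<in> carrier (hol V)" by (rule \<theta>_inv_hol(1)[OF V(1) F[OF V]])
    fix W assume W: "open W" "W \<subseteq> V"
    have "F W (restrict g W) = restrict (F V g) (elem_sym -` W)"
      unfolding F_def pullback_restrict[OF W(2)]
      using W(2)
      by (intro sheaf_endo_restrict[OF P open_vimage_elem_sym[OF V(1)] sub[OF V(2)] pullback_carrier[OF V(1,3)]
            open_vimage_elem_sym[OF W(1)]]) blast
    also have "\<dots> = restrict (pullback V (\<theta> V (F V g))) (elem_sym -` W)"
      by (simp only: \<theta>_inv_hol(2)[OF V(1) F[OF V]])
    also have "\<dots> = pullback W (restrict (\<theta> V (F V g)) W)" by (rule pullback_restrict[OF W(2), symmetric])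
    finally show "\<theta> W (F W (restrict g W)) = restrict (\<theta> V (F V g)) W"
      by (simp only: \<theta>_pullback[OF carrier_hol_restrict[OF \<theta>_inv_hol(1)[OF V(1) F[OF V]] W]])
  qed
  then have "related U P Q"
  proof (rule relatedI[OF P])
    fix V g assume V: "open V" "V \<subseteq> U" "g \<in> carrier (hol V)"
    have "Q V g = \<theta> V (F V g)" unfolding Q_def by (rule op_restrict_apply[OF V])
    then show "P (elem_sym -` V) (pullback V g) = pullback V (Q V g)"
      using \<theta>_inv_hol(2)[OF V(1) F[OF V]] by (simp only: F_def)
  qed
  then show ?thesis by (rule that)
qed

text \<open>
  Compare both charts with their intersection.
\<close>

lemma push_independent_of_chart:
  assumes Q: "sheaf_endo U Q" and W: "chart W" "x \<in> W" "elem_sym ` W \<subseteq> U" "f hol_on W"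
    and W': "chart W'" "x \<in> W'" "elem_sym ` W' \<subseteq> U" "f hol_on W'"
  shows "Q (elem_sym ` W) (push W f) (elem_sym x) = Q (elem_sym ` W') (push W' f) (elem_sym x)"
proof -
  let ?W = "W \<inter> W'"
  have op: "open ?W" using W(1) W'(1) by (simp add: chart_def open_Int)
  have opN: "open (elem_sym ` ?W)" by (rule chart_open_image[OF chart_subset[OF W(1) op]]) blast
  have "Q (elem_sym ` ?W) (push ?W f) (elem_sym x) = Q (elem_sym ` W1) (push W1 f) (elem_sym x)"
    if W1: "chart W1" "x \<in> W1" "elem_sym ` W1 \<subseteq> U" "f hol_on W1" "?W \<subseteq> W1" for W1
    unfolding push_restrict[OF W1(1) op W1(5)]
  proof (rule sheaf_endo_local[OF Q chart_open_image[OF W1(1)] W1(3) push_carrier[OF W1(1,4)] opN])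
    show "elem_sym ` ?W \<subseteq> elem_sym ` W1" by (rule image_mono[OF W1(5)])
    show "elem_sym x \<in> elem_sym ` ?W" using W(2) W'(2) by (intro imageI IntI)
  qed
  from this[OF W Int_lower1] this[OF W' Int_lower2] show ?thesis by (rule trans[OF sym])
qed

text \<open>
  \<open>P\<close> is defined by the formula in \<open>related_chart\<close>, which is necessary; it is independent of the choice
  of the chart by \<open>push_independent_of_chart\<close>.
\<close>

lemma related_exists_left:
  fixes Q :: "'k::{finite,linorder} op"
  assumes U: "U \<subseteq> {\<sigma>. discriminant \<sigma> \<noteq> 0}" and Q: "sheaf_endo U Q"
  obtains P where "related U P Q"
proof -
  define ch where "ch V x = (SOME W. chart W \<and> x \<in> W \<and> W \<subseteq> V)" for V and x :: "'k space"
  define P0 where "P0 V f = (\<lambda>x\<in>V. Q (elem_sym ` ch V x) (push (ch V x) f) (elem_sym x))" for V f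
  have simple: "simple_roots x" if "x \<in> elem_sym -` U" for x
    using that U discriminant_nonzero_iff[of x] by auto
  have ch: "chart (ch V x)" "x \<in> ch V x" "ch V x \<subseteq> V" if "open V" "V \<subseteq> elem_sym -` U" "x \<in> V" for V x
  proof -
    have "simple_roots x" using simple that by blast
    then have "\<exists>W. chart W \<and> x \<in> W \<and> W \<subseteq> V" using chart_exists[OF _ that(1,3)] by metis
    from someI_ex[OF this] show "chart (ch V x)" "x \<in> ch V x" "ch V x \<subseteq> V" unfolding ch_def by auto
  qed
  have P0: "P0 V f x = Q (elem_sym ` W) (push W f) (elem_sym x)"
    if V: "open V" "V \<subseteq> elem_sym -` U" and f: "f hol_on V" and W: "chart W" "x \<in> W" "W \<subseteq> V" for V f W x
  proof -
    have x: "x \<in> V" using W by blast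
    have "Q (elem_sym ` ch V x) (push (ch V x) f) (elem_sym x) = Q (elem_sym ` W) (push W f) (elem_sym x)"
      using V(2) ch(3)[OF V x] W(3)
      by (intro push_independent_of_chart[OF Q ch(1,2)[OF V x] _ _ W(1,2)] hol_on_subset[OF f]) auto
    then show ?thesis using x by (simp add: P0_def)
  qed
  have img: "elem_sym ` W \<subseteq> U" if "W \<subseteq> V" "V \<subseteq> elem_sym -` U" for V W :: "'k space set" using that by blast
  define P where "P = op_restrict (elem_sym -` U) P0"
  have "sheaf_endo (elem_sym -` U) P"
    unfolding P_def
  proof (rule sheaf_endo_op_restrictI)
    fix V f assume V: "open V" "V \<subseteq> elem_sym -` U" and f: "f \<in> carrier (hol V)"
    have fh: "f hol_on V" by (rule carrier_hol_hol_on[OF f])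
    have "P0 V f hol_on V"
      unfolding hol_on_def
    proof
      fix x assume x: "x \<in> V"
      note W = ch[OF V x]
      let ?W = "ch V x"
      let ?h = "Q (elem_sym ` ?W) (push ?W f)"
      have opW: "open ?W" using W(1) by (simp add: chart_def)
      have "?h \<in> carrier (hol (elem_sym ` ?W))"
        by (rule sheaf_endo_carrier[OF Q chart_open_image[OF W(1)] img[OF W(3) V(2)]
              push_carrier[OF W(1) hol_on_subset[OF fh W(3)]]])
      then have "pullback (elem_sym ` ?W) ?h hol_on elem_sym -` (elem_sym ` ?W)"
        by (rule carrier_hol_hol_on[OF pullback_carrier[OF chart_open_image[OF W(1)]]])
      then have "pullback (elem_sym ` ?W) ?h hol_on ?W" by (rule hol_on_subset) blast
      then have "P0 V f hol_on ?W"
        by (rule hol_on_cong[OF opW, rotated]) (simp add: pullback_apply P0[OF V fh W(1) _ W(3)])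
      then show "complex_differentiable_at (P0 V f) x" using W(2) by (simp add: hol_on_def)
    qed
    then show "P0 V f \<in> carrier (hol V)" by (simp add: carrier_hol_iff P0_def)
    fix W assume W: "open W" "W \<subseteq> V"
    have WU: "W \<subseteq> elem_sym -` U" using W V by blast
    show "P0 W (restrict f W) = restrict (P0 V f) W"
    proof (rule extensionalityI[of _ W])
      fix x assume x: "x \<in> W"
      note C = ch[OF W(1) WU x]
      let ?C = "ch W x"
      have "push ?C (restrict f W) = push ?C f"
        using C(3) push_elem_sym[OF C(1)] by (intro push_eqI[OF C(1)]) (auto simp: push_def)
      then have "P0 W (restrict f W) x = Q (elem_sym ` ?C) (push ?C f) (elem_sym x)"
        using P0[OF W(1) WU carrier_hol_hol_on[OF carrier_hol_restrict[OF f W]] C] by simp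
      also have "\<dots> = P0 V f x" using P0[OF V fh C(1,2)] C(3) W(2) by simp
      finally show "P0 W (restrict f W) x = restrict (P0 V f) W x" using x by simp
    qed (simp_all only: P0_def restrict_extensional)
  qed
  then have "related U P Q"
  proof (rule relatedI[OF _ Q])
    fix V g assume V: "open V" "V \<subseteq> U" and g: "g \<in> carrier (hol V)"
    have V': "open (elem_sym -` V)" "elem_sym -` V \<subseteq> elem_sym -` U" using open_vimage_elem_sym[OF V(1)] V(2) by auto
    note pc = pullback_carrier[OF V(1) g]
    have "P (elem_sym -` V) (pullback V g) = P0 (elem_sym -` V) (pullback V g)"
      unfolding P_def by (rule op_restrict_apply[OF V' pc])
    also have "\<dots> = pullback V (Q V g)"
    proof (rule extensionalityI[of _ "elem_sym -` V"])
      fix x assume x: "x \<in> elem_sym -` V"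
      note W = ch[OF V' x]
      let ?W = "ch (elem_sym -` V) x"
      have sub: "elem_sym ` ?W \<subseteq> V" using W(3) by blast
      have "push ?W (pullback V g) = restrict g (elem_sym ` ?W)"
        using W(3) by (intro push_eqI[OF W(1)]) (auto simp: pullback_def)
      then have "P0 (elem_sym -` V) (pullback V g) x = Q (elem_sym ` ?W) (restrict g (elem_sym ` ?W)) (elem_sym x)"
        using P0[OF V' carrier_hol_hol_on[OF pc] W] by simp
      also have "\<dots> = Q V g (elem_sym x)"
        using W(2) by (intro sheaf_endo_local[OF Q V g chart_open_image[OF W(1)] sub]) blast
      finally show "P0 (elem_sym -` V) (pullback V g) x = pullback V (Q V g) x" using x by (simp add: pullback_apply)
    qed (simp_all only: P0_def pullback_def restrict_extensional)
    finally show "P (elem_sym -` V) (pullback V g) = pullback V (Q V g)" .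
  qed
  then show ?thesis by (rule that)
qed

section \<open>Compatibility with the algebra structure\<close>

lemma related_mult:
  assumes rel: "related U P Q" and rel': "related U P' Q'"
  shows "related U (P \<otimes>\<^bsub>diffops (elem_sym -` U)\<^esub> P') (Q \<otimes>\<^bsub>diffops U\<^esub> Q')"
proof -
  have endo: "sheaf_endo U' (op_restrict U' (\<lambda>V f. R V (R' V f)))"
    if R: "sheaf_endo U' R" and R': "sheaf_endo U' R'" for U' and R R' :: "'a op"
  proof (rule sheaf_endo_op_restrictI)
    fix V f assume V: "open V" "V \<subseteq> U'" "f \<in> carrier (hol V)"
    show "R V (R' V f) \<in> carrier (hol V)"
      by (rule sheaf_endo_carrier[OF R V(1,2) sheaf_endo_carrier[OF R' V]])
    fix W assume W: "open W" "W \<subseteq> V"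
    show "R W (R' W (restrict f W)) = restrict (R V (R' V f)) W"
      by (simp only: sheaf_endo_restrict[OF R' V W] sheaf_endo_restrict[OF R V(1,2) sheaf_endo_carrier[OF R' V] W])
  qed
  show ?thesis
    unfolding diffops_def monoid.simps
  proof (rule relatedI[OF endo[OF relatedD(1)[OF rel] relatedD(1)[OF rel']] endo[OF relatedD(2)[OF rel] relatedD(2)[OF rel']]])
    fix V g assume V: "open V" "V \<subseteq> U" "g \<in> carrier (hol V)"
    have V': "open (elem_sym -` V)" "elem_sym -` V \<subseteq> elem_sym -` U"
      using open_vimage_elem_sym[OF V(1)] V(2) by auto
    show "op_restrict (elem_sym -` U) (\<lambda>V f. P V (P' V f)) (elem_sym -` V) (pullback V g) =
        pullback V (op_restrict U (\<lambda>V f. Q V (Q' V f)) V g)"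
      by (simp only: op_restrict_apply[OF V' pullback_carrier[OF V(1,3)]] op_restrict_apply[OF V]
          relatedD(3)[OF rel' V] relatedD(3)[OF rel V(1,2) sheaf_endo_carrier[OF relatedD(2)[OF rel'] V]])
  qed
qed

lemma related_add:
  assumes rel: "related U P Q" and rel': "related U P' Q'"
  shows "related U (P \<oplus>\<^bsub>diffops (elem_sym -` U)\<^esub> P') (Q \<oplus>\<^bsub>diffops U\<^esub> Q')"
proof -
  have endo: "sheaf_endo U' (op_restrict U' (\<lambda>V f. \<lambda>x\<in>V. R V f x + R' V f x))"
    if R: "sheaf_endo U' R" and R': "sheaf_endo U' R'" for U' and R R' :: "'a op"
  proof (rule sheaf_endo_op_restrictI)
    fix V f assume V: "open V" "V \<subseteq> U'" "f \<in> carrier (hol V)"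
    show "(\<lambda>x\<in>V. R V f x + R' V f x) \<in> carrier (hol V)"
      by (intro restrict_carrier_hol V hol_on_add carrier_hol_hol_on sheaf_endo_carrier[OF R V] sheaf_endo_carrier[OF R' V])
    fix W assume W: "open W" "W \<subseteq> V"
    show "(\<lambda>x\<in>W. R W (restrict f W) x + R' W (restrict f W) x) = restrict (\<lambda>x\<in>V. R V f x + R' V f x) W"
      using W(2) by (intro restrict_ext) (auto simp only: sheaf_endo_restrict[OF R V W] sheaf_endo_restrict[OF R' V W] restrict_apply' subsetD)
  qed
  show ?thesis
    unfolding diffops_def ring.simps
  proof (rule relatedI[OF endo[OF relatedD(1)[OF rel] relatedD(1)[OF rel']] endo[OF relatedD(2)[OF rel] relatedD(2)[OF rel']]])
    fix V g assume V: "open V" "V \<subseteq> U" "g \<in> carrier (hol V)"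
    have V': "open (elem_sym -` V)" "elem_sym -` V \<subseteq> elem_sym -` U"
      using open_vimage_elem_sym[OF V(1)] V(2) by auto
    have "(\<lambda>x\<in>elem_sym -` V. P (elem_sym -` V) (pullback V g) x + P' (elem_sym -` V) (pullback V g) x) =
        pullback V (\<lambda>x\<in>V. Q V g x + Q' V g x)"
    proof (rule extensionalityI[of _ "elem_sym -` V"])
      fix x assume "x \<in> elem_sym -` V"
      then show "(\<lambda>x\<in>elem_sym -` V. P (elem_sym -` V) (pullback V g) x + P' (elem_sym -` V) (pullback V g) x) x =
          pullback V (\<lambda>x\<in>V. Q V g x + Q' V g x) x"
        using related_apply[OF rel V, of x] related_apply[OF rel' V, of x] by (simp add: pullback_apply)
    qed (simp_all only: pullback_def restrict_extensional)
    then show "op_restrict (elem_sym -` U) (\<lambda>V f. \<lambda>x\<in>V. P V f x + P' V f x) (elem_sym -` V) (pullback V g) =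
        pullback V (op_restrict U (\<lambda>V f. \<lambda>x\<in>V. Q V f x + Q' V f x) V g)"
      by (simp only: op_restrict_apply[OF V' pullback_carrier[OF V(1,3)]] op_restrict_apply[OF V])
  qed
qed

lemma related_smult:
  assumes rel: "related U P Q" and U: "open U" and h: "h \<in> carrier (hol U)"
  shows "related U (pullback U h \<odot>\<^bsub>diffops (elem_sym -` U)\<^esub> P) (h \<odot>\<^bsub>diffops U\<^esub> Q)"
proof -
  have endo: "sheaf_endo U' (op_restrict U' (\<lambda>V f. \<lambda>x\<in>V. h x * R V f x))"
    if R: "sheaf_endo U' R" and h: "h \<in> carrier (hol U')" for U' h and R :: "'a op"
  proof (rule sheaf_endo_op_restrictI)
    fix V f assume V: "open V" "V \<subseteq> U'" "f \<in> carrier (hol V)"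
    show "(\<lambda>x\<in>V. h x * R V f x) \<in> carrier (hol V)"
      by (intro restrict_carrier_hol V hol_on_mult carrier_hol_hol_on sheaf_endo_carrier[OF R V]
          hol_on_subset[OF carrier_hol_hol_on[OF h] V(2)])
    fix W assume W: "open W" "W \<subseteq> V"
    show "(\<lambda>x\<in>W. h x * R W (restrict f W) x) = restrict (\<lambda>x\<in>V. h x * R V f x) W"
      using W(2) by (intro restrict_ext) (auto simp only: sheaf_endo_restrict[OF R V W] restrict_apply' subsetD)
  qed
  show ?thesis
    unfolding diffops_def module.simps
  proof (rule relatedI[OF endo[OF relatedD(1)[OF rel] pullback_carrier[OF U h]] endo[OF relatedD(2)[OF rel] h]])
    fix V g assume V: "open V" "V \<subseteq> U" "g \<in> carrier (hol V)"
    have V': "open (elem_sym -` V)" "elem_sym -` V \<subseteq> elem_sym -` U"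
      using open_vimage_elem_sym[OF V(1)] V(2) by auto
    have "(\<lambda>x\<in>elem_sym -` V. pullback U h x * P (elem_sym -` V) (pullback V g) x) = pullback V (\<lambda>x\<in>V. h x * Q V g x)"
    proof (rule extensionalityI[of _ "elem_sym -` V"])
      fix x assume "x \<in> elem_sym -` V"
      then show "(\<lambda>x\<in>elem_sym -` V. pullback U h x * P (elem_sym -` V) (pullback V g) x) x =
          pullback V (\<lambda>x\<in>V. h x * Q V g x) x"
        using related_apply[OF rel V, of x] V(2) pullback_apply[of x U h] by (auto simp: pullback_apply)
    qed (simp_all only: pullback_def restrict_extensional)
    then show "op_restrict (elem_sym -` U) (\<lambda>V f. \<lambda>x\<in>V. pullback U h x * P V f x) (elem_sym -` V) (pullback V g) =
        pullback V (op_restrict U (\<lambda>V f. \<lambda>x\<in>V. h x * Q V f x) V g)"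
      by (simp only: op_restrict_apply[OF V' pullback_carrier[OF V(1,3)]] op_restrict_apply[OF V])
  qed
qed

lemma related_one: "related U \<one>\<^bsub>diffops (elem_sym -` U)\<^esub> \<one>\<^bsub>diffops U\<^esub>"
proof -
  have endo: "sheaf_endo U' (op_restrict U' (\<lambda>V f. f))" for U' :: "'a space set"
    by (rule sheaf_endo_op_restrictI) (assumption | rule refl)+
  show ?thesis
    unfolding diffops_def monoid.simps
  proof (rule relatedI[OF endo endo])
    fix V g assume V: "open V" "V \<subseteq> U" "g \<in> carrier (hol V)"
    have V': "open (elem_sym -` V)" "elem_sym -` V \<subseteq> elem_sym -` U"
      using open_vimage_elem_sym[OF V(1)] V(2) by auto
    show "op_restrict (elem_sym -` U) (\<lambda>V f. f) (elem_sym -` V) (pullback V g) = pullback V (op_restrict U (\<lambda>V f. f) V g)"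
      by (simp only: op_restrict_apply[OF V' pullback_carrier[OF V(1,3)]] op_restrict_apply[OF V])
  qed
qed

lemma sheaf_endo_op_restrict:
  assumes P: "sheaf_endo U P" and V: "V \<subseteq> U"
  shows "sheaf_endo V (op_restrict V P)"
proof (rule sheaf_endo_op_restrictI)
  fix W f assume W: "open W" "W \<subseteq> V" "f \<in> carrier (hol W)"
  then have "W \<subseteq> U" using V by blast
  then show "P W f \<in> carrier (hol W)" using sheaf_endo_carrier[OF P W(1) _ W(3)] by blast
  fix W' assume "open W'" "W' \<subseteq> W"
  then show "P W' (restrict f W') = restrict (P W f) W'"
    using sheaf_endo_restrict[OF P W(1) \<open>W \<subseteq> U\<close> W(3)] by blast
qed

lemma related_op_restrict:
  assumes rel: "related U P Q" and V: "V \<subseteq> U"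
  shows "related V (op_restrict (elem_sym -` V) P) (op_restrict V Q)"
proof (rule relatedI[OF sheaf_endo_op_restrict[OF relatedD(1)[OF rel]] sheaf_endo_op_restrict[OF relatedD(2)[OF rel] V]])
  show "elem_sym -` V \<subseteq> elem_sym -` U" using V by blast
  fix W g assume W: "open W" "W \<subseteq> V" "g \<in> carrier (hol W)"
  have W': "open (elem_sym -` W)" "elem_sym -` W \<subseteq> elem_sym -` V"
    using open_vimage_elem_sym[OF W(1)] W(2) by auto
  have "W \<subseteq> U" using W(2) V by blast
  then show "op_restrict (elem_sym -` V) P (elem_sym -` W) (pullback W g) = pullback W (op_restrict V Q W g)"
    by (simp only: op_restrict_apply[OF W' pullback_carrier[OF W(1,3)]] op_restrict_apply[OF W]
        relatedD(3)[OF rel W(1) _ W(3)])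
qed

section \<open>Transfer of differential operators\<close>

text \<open>
  A zero of order greater than \<open>m\<close> of \<open>f\<close> at \<open>elem_sym z\<close> gives one of \<open>f \<circ> elem_sym\<close> at \<open>z\<close>, also if some
  coordinates of \<open>z\<close> coincide. As the quotient map is open, the image of a neighbourhood on which the order
  of \<open>P\<close> is at most \<open>m\<close> is one on which the order of \<open>Q\<close> is.
\<close>

lemma related_diffop_right:
  assumes rel: "related U P Q" and P: "diffop (elem_sym -` U) P"
  shows "diffop U Q"
proof -
  have lin: "op_linear (elem_sym -` U) P" and fin: "locally_finite_order (elem_sym -` U) P"
    using P unfolding diffop_iff by blast+
  have "op_linear U Q"
    unfolding op_linear_def
  proof (intro allI impI)
    fix V f g c \<sigma> assume A: "open V \<and> V \<subseteq> U \<and> f \<in> carrier (hol V) \<and> g \<in> carrier (hol V) \<and> \<sigma> \<in> V"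
    then have V: "open V" "V \<subseteq> U" and f: "f \<in> carrier (hol V)" and g: "g \<in> carrier (hol V)" and \<sigma>: "\<sigma> \<in> V" by auto
    obtain x where x: "elem_sym x = \<sigma>" using surj_elem_sym by blast
    then have xV: "elem_sym x \<in> V" "x \<in> elem_sym -` V" using \<sigma> by auto
    have V': "open (elem_sym -` V)" "elem_sym -` V \<subseteq> elem_sym -` U"
      using open_vimage_elem_sym[OF V(1)] V(2) by auto
    have fg: "(\<lambda>x\<in>V. f x + c * g x) \<in> carrier (hol V)"
      by (intro restrict_carrier_hol V hol_on_linear carrier_hol_hol_on f g)
    have "Q V (\<lambda>x\<in>V. f x + c * g x) \<sigma> = P (elem_sym -` V) (pullback V (\<lambda>x\<in>V. f x + c * g x)) x"
      using related_apply[OF rel V fg xV(1)] x by simp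
    also have "pullback V (\<lambda>x\<in>V. f x + c * g x) = (\<lambda>x\<in>elem_sym -` V. pullback V f x + c * pullback V g x)"
      unfolding pullback_def by (intro restrict_ext) simp
    also have "P (elem_sym -` V) \<dots> x = P (elem_sym -` V) (pullback V f) x + c * P (elem_sym -` V) (pullback V g) x"
      by (rule op_linearD[OF lin V' pullback_carrier[OF V(1) f] pullback_carrier[OF V(1) g] xV(2)])
    also have "\<dots> = Q V f \<sigma> + c * Q V g \<sigma>"
      using related_apply[OF rel V f xV(1)] related_apply[OF rel V g xV(1)] x by simp
    finally show "Q V (\<lambda>x\<in>V. f x + c * g x) \<sigma> = Q V f \<sigma> + c * Q V g \<sigma>" .
  qed
  moreover have "locally_finite_order U Q"
    unfolding locally_finite_order_def
  proof
    fix \<sigma> assume \<sigma>: "\<sigma> \<in> U"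
    obtain x where x: "elem_sym x = \<sigma>" using surj_elem_sym by blast
    then have "x \<in> elem_sym -` U" using \<sigma> by simp
    then obtain W m where W: "open W" "x \<in> W" "W \<subseteq> elem_sym -` U" and
      kill: "\<And>V f y. open V \<Longrightarrow> V \<subseteq> W \<Longrightarrow> f \<in> carrier (hol V) \<Longrightarrow> y \<in> V \<Longrightarrow> vanishes (Suc m) f y \<Longrightarrow> P V f y = 0"
      using fin unfolding locally_finite_order_def by meson
    have sW: "open (elem_sym ` W)" "\<sigma> \<in> elem_sym ` W" "elem_sym ` W \<subseteq> U"
      using open_image_elem_sym[OF W(1)] W x by auto
    have "Q V f y = 0" if V: "open V" "V \<subseteq> elem_sym ` W" and f: "f \<in> carrier (hol V)" and y: "y \<in> V"
      and van: "vanishes (Suc m) f y" for V f y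
    proof -
      have VU: "V \<subseteq> U" using V(2) sW(3) by blast
      obtain z where z: "z \<in> W" "y = elem_sym z" using V(2) y by blast
      define V1 where "V1 = elem_sym -` V \<inter> W"
      have V': "open (elem_sym -` V)" "elem_sym -` V \<subseteq> elem_sym -` U"
        using open_vimage_elem_sym[OF V(1)] VU by auto
      have V1: "open V1" "V1 \<subseteq> elem_sym -` V" "V1 \<subseteq> W" "z \<in> V1"
        using V'(1) W(1) y z by (auto simp: V1_def)
      have "vanishes (Suc m) (\<lambda>z. f (elem_sym z)) z"
        using van unfolding z(2) by (rule vanishes_compose[OF elem_sym_has_derivative])
      then have "vanishes (Suc m) (restrict (pullback V f) V1) z"
        using V1(2) by (elim vanishes_cong[OF V1(1,4), rotated]) (auto simp: pullback_apply)
      then have "P V1 (restrict (pullback V f) V1) z = 0"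
        by (rule kill[OF V1(1,3) carrier_hol_restrict[OF pullback_carrier[OF V(1) f] V1(1,2)] V1(4)])
      then have "P (elem_sym -` V) (pullback V f) z = 0"
        using sheaf_endo_local[OF relatedD(1)[OF rel] V' pullback_carrier[OF V(1) f] V1(1,2,4)] by simp
      then show ?thesis
        using related_apply[OF rel V(1) VU f, of z] y z by simp
    qed
    then show "\<exists>W m. open W \<and> \<sigma> \<in> W \<and> W \<subseteq> U \<and>
     (\<forall>V f y. open V \<and> V \<subseteq> W \<and> f \<in> carrier (hol V) \<and> y \<in> V \<and> vanishes (Suc m) f y \<longrightarrow> Q V f y = 0)"
      using sW by blast
  qed
  ultimately show ?thesis unfolding diffop_iff using relatedD(2)[OF rel] by blast
qed

text \<open>
  The same argument with the local inverses of the quotient map, which are differentiable.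
\<close>

lemma related_diffop_left:
  fixes P :: "'k::{finite,linorder} op"
  assumes U: "U \<subseteq> {\<sigma>. discriminant \<sigma> \<noteq> 0}" and rel: "related U P Q" and Q: "diffop U Q"
  shows "diffop (elem_sym -` U) P"
proof -
  have lin: "op_linear U Q" and fin: "locally_finite_order U Q"
    using Q unfolding diffop_iff by blast+
  have simple: "simple_roots x" if "x \<in> elem_sym -` U" for x
    using that U discriminant_nonzero_iff[of x] by auto
  have "op_linear (elem_sym -` U) P"
    unfolding op_linear_def
  proof (intro allI impI)
    fix V f g c x assume A: "open V \<and> V \<subseteq> elem_sym -` U \<and> f \<in> carrier (hol V) \<and> g \<in> carrier (hol V) \<and> x \<in> V"
    then have V: "open V" "V \<subseteq> elem_sym -` U" and f: "f \<in> carrier (hol V)" and g: "g \<in> carrier (hol V)" and x: "x \<in> V"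
      by auto
    have "simple_roots x" using simple V(2) x by blast
    then obtain W where W: "chart W" "x \<in> W" "W \<subseteq> V" by (rule chart_exists[OF _ V(1) x])
    let ?N = "elem_sym ` W"
    have N: "open ?N" "?N \<subseteq> U" "elem_sym x \<in> ?N" using chart_open_image[OF W(1)] W V(2) by auto
    have fg: "(\<lambda>x\<in>V. f x + c * g x) \<in> carrier (hol V)"
      by (intro restrict_carrier_hol V hol_on_linear carrier_hol_hol_on f g)
    have pc: "push W h \<in> carrier (hol ?N)" if "h \<in> carrier (hol V)" for h
      by (rule push_carrier[OF W(1) hol_on_subset[OF carrier_hol_hol_on[OF that] W(3)]])
    have push: "push W (\<lambda>x\<in>V. f x + c * g x) = (\<lambda>\<sigma>\<in>?N. push W f \<sigma> + c * push W g \<sigma>)"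
    proof (rule push_eqI[OF W(1)])
      fix y assume y: "y \<in> W"
      then have "y \<in> V" using W(3) by blast
      then show "(\<lambda>\<sigma>\<in>?N. push W f \<sigma> + c * push W g \<sigma>) (elem_sym y) = (\<lambda>x\<in>V. f x + c * g x) y"
        using y push_elem_sym[OF W(1) y] by simp
    qed simp
    have "P V (\<lambda>x\<in>V. f x + c * g x) x = Q ?N (push W (\<lambda>x\<in>V. f x + c * g x)) (elem_sym x)"
      by (rule related_chart[OF rel V fg W])
    also have "\<dots> = Q ?N (push W f) (elem_sym x) + c * Q ?N (push W g) (elem_sym x)"
      unfolding push by (rule op_linearD[OF lin N(1,2) pc[OF f] pc[OF g] N(3)])
    also have "\<dots> = P V f x + c * P V g x"
      by (simp only: related_chart[OF rel V f W] related_chart[OF rel V g W])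
    finally show "P V (\<lambda>x\<in>V. f x + c * g x) x = P V f x + c * P V g x" .
  qed
  moreover have "locally_finite_order (elem_sym -` U) P"
    unfolding locally_finite_order_def
  proof
    fix x assume x: "x \<in> elem_sym -` U"
    then have "elem_sym x \<in> U" by simp
    then obtain O' m where O': "open O'" "elem_sym x \<in> O'" "O' \<subseteq> U" and
      kill: "\<And>V f y. open V \<Longrightarrow> V \<subseteq> O' \<Longrightarrow> f \<in> carrier (hol V) \<Longrightarrow> y \<in> V \<Longrightarrow> vanishes (Suc m) f y \<Longrightarrow> Q V f y = 0"
      using fin unfolding locally_finite_order_def by meson
    have "x \<in> elem_sym -` O'" using O'(2) by simp
    then obtain W where W: "chart W" "x \<in> W" "W \<subseteq> elem_sym -` O'"
      by (rule chart_exists[OF simple[OF x] open_vimage_elem_sym[OF O'(1)]])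
    have "P V f y = 0" if V: "open V" "V \<subseteq> W" and f: "f \<in> carrier (hol V)" and y: "y \<in> V"
      and van: "vanishes (Suc m) f y" for V f y
    proof -
      have VU: "V \<subseteq> elem_sym -` U" using V(2) W(3) O'(3) by blast
      have ch: "chart V" by (rule chart_subset[OF W(1) V])
      obtain D where D: "(inv_into V elem_sym has_derivative D) (at (elem_sym y))"
        using chart_inverse_derivative[OF ch y] by blast
      have N: "open (elem_sym ` V)" "elem_sym y \<in> elem_sym ` V" "elem_sym ` V \<subseteq> O'"
        using chart_open_image[OF ch] y V(2) W(3) by auto
      have inv: "inv_into V elem_sym (elem_sym y) = y" using ch y by (simp add: chart_def)
      have "vanishes (Suc m) (\<lambda>\<sigma>. f (inv_into V elem_sym \<sigma>)) (elem_sym y)"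
        by (rule vanishes_compose[OF D]) (simp only: inv van)
      then have "vanishes (Suc m) (push V f) (elem_sym y)"
        by (rule vanishes_cong[OF N(1,2), rotated]) (simp add: push_def)
      then have "Q (elem_sym ` V) (push V f) (elem_sym y) = 0"
        by (rule kill[OF N(1,3) push_carrier[OF ch carrier_hol_hol_on[OF f]] N(2)])
      then show ?thesis by (simp only: related_chart[OF rel V(1) VU f ch y order_refl])
    qed
    moreover have "open W" "W \<subseteq> elem_sym -` U" using W O'(3) by (auto simp: chart_def)
    ultimately show "\<exists>W m. open W \<and> x \<in> W \<and> W \<subseteq> elem_sym -` U \<and>
     (\<forall>V f y. open V \<and> V \<subseteq> W \<and> f \<in> carrier (hol V) \<and> y \<in> V \<and> vanishes (Suc m) f y \<longrightarrow> P V f y = 0)"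
      using W(2) by blast
  qed
  ultimately show ?thesis unfolding diffop_iff using relatedD(1)[OF rel] by blast
qed

section \<open>The morphism and its inverse off the discriminant\<close>

definition descend_op :: "('k::{finite,linorder} space) set \<Rightarrow> 'k op \<Rightarrow> 'k op" where
  "descend_op U P = (THE Q. related U P Q)"

definition lift_op :: "('k::{finite,linorder} space) set \<Rightarrow> 'k op \<Rightarrow> 'k op" where
  "lift_op U Q = (THE P. related U P Q)"

lemma descend_op_eq: "related U P Q \<Longrightarrow> descend_op U P = Q"
  unfolding descend_op_def by (rule the_equality) (auto intro: related_unique_right)

lemma lift_op_eq: "related U P Q \<Longrightarrow> lift_op U Q = P"
  unfolding lift_op_def by (rule the_equality) (auto intro: related_unique_left)

lemma carrier_inv_diffops:
  "P \<in> carrier (inv_diffops U) \<longleftrightarrow> diffop (elem_sym -` U) P \<and> (\<forall>w. w permutes UNIV \<longrightarrow> perm_op w P = P)"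
  by (simp add: inv_diffops_def diffops_def)

lemma carrier_diffops: "Q \<in> carrier (diffops U) \<longleftrightarrow> diffop U Q"
  by (simp add: diffops_def)

lemma inv_diffops_ops:
  "x \<otimes>\<^bsub>inv_diffops U\<^esub> y = x \<otimes>\<^bsub>diffops (elem_sym -` U)\<^esub> y"
  "x \<oplus>\<^bsub>inv_diffops U\<^esub> y = x \<oplus>\<^bsub>diffops (elem_sym -` U)\<^esub> y"
  "\<one>\<^bsub>inv_diffops U\<^esub> = \<one>\<^bsub>diffops (elem_sym -` U)\<^esub>"
  "g \<odot>\<^bsub>inv_diffops U\<^esub> x = pullback U g \<odot>\<^bsub>diffops (elem_sym -` U)\<^esub> x"
  by (simp_all add: inv_diffops_def)

lemma related_descend_op:
  assumes "P \<in> carrier (inv_diffops U)"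
  shows "related U P (descend_op U P)"
proof -
  have "sheaf_endo (elem_sym -` U) P" "\<And>w. w permutes UNIV \<Longrightarrow> perm_op w P = P"
    using assms unfolding carrier_inv_diffops diffop_def by blast+
  then obtain Q where "related U P Q" using related_exists_right by blast
  then show ?thesis by (simp only: descend_op_eq)
qed

lemma related_lift_op:
  assumes "U \<subseteq> {\<sigma>. discriminant \<sigma> \<noteq> 0}" "Q \<in> carrier (diffops U)"
  shows "related U (lift_op U Q) Q"
proof -
  have "sheaf_endo U Q" using assms(2) unfolding carrier_diffops diffop_def by blast
  then obtain P where "related U P Q" using related_exists_left[OF assms(1)] by blast
  then show ?thesis by (simp only: lift_op_eq)
qed

lemma descend_op_carrier:
  assumes "P \<in> carrier (inv_diffops U)"
  shows "descend_op U P \<in> carrier (diffops U)"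
  using related_diffop_right[OF related_descend_op[OF assms]] assms
  unfolding carrier_diffops carrier_inv_diffops by blast

text \<open>
  An operator related to \<open>Q\<close> is automatically invariant: its conjugates are related to \<open>Q\<close> as well.
\<close>

lemma lift_op_carrier:
  assumes U: "U \<subseteq> {\<sigma>. discriminant \<sigma> \<noteq> 0}" and Q: "Q \<in> carrier (diffops U)"
  shows "lift_op U Q \<in> carrier (inv_diffops U)"
proof -
  note rel = related_lift_op[OF U Q]
  have "diffop (elem_sym -` U) (lift_op U Q)"
    using related_diffop_left[OF U rel] Q unfolding carrier_diffops by blast
  moreover have "perm_op w (lift_op U Q) = lift_op U Q" if "w permutes UNIV" for w
    by (rule related_unique_left[OF related_perm_op[OF that rel] rel])
  ultimately show ?thesis unfolding carrier_inv_diffops by blast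
qed

lemma algebra_sheaf_hom_descend_op:
  "algebra_sheaf_hom X hol inv_diffop_sheaf diffop_sheaf descend_op"
  unfolding algebra_sheaf_hom_def inv_diffop_sheaf_def diffop_sheaf_def algebra_sheaf.simps
proof (intro allI impI conjI ballI)
  fix U :: "'a space set" assume U: "open U \<and> U \<subseteq> X"
  show "descend_op U \<in> ring_hom (inv_diffops U) (diffops U)"
  proof (rule ring_hom_memI)
    fix P P' assume P: "P \<in> carrier (inv_diffops U)" and P': "P' \<in> carrier (inv_diffops U)"
    note rel = related_descend_op[OF P] and rel' = related_descend_op[OF P']
    show "descend_op U P \<in> carrier (diffops U)" by (rule descend_op_carrier[OF P])
    show "descend_op U (P \<otimes>\<^bsub>inv_diffops U\<^esub> P') = descend_op U P \<otimes>\<^bsub>diffops U\<^esub> descend_op U P'"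
      unfolding inv_diffops_ops by (rule descend_op_eq[OF related_mult[OF rel rel']])
    show "descend_op U (P \<oplus>\<^bsub>inv_diffops U\<^esub> P') = descend_op U P \<oplus>\<^bsub>diffops U\<^esub> descend_op U P'"
      unfolding inv_diffops_ops by (rule descend_op_eq[OF related_add[OF rel rel']])
  next
    show "descend_op U \<one>\<^bsub>inv_diffops U\<^esub> = \<one>\<^bsub>diffops U\<^esub>"
      unfolding inv_diffops_ops by (rule descend_op_eq[OF related_one])
  qed
  fix P assume P: "P \<in> carrier (inv_diffops U)"
  show "descend_op U (g \<odot>\<^bsub>inv_diffops U\<^esub> P) = g \<odot>\<^bsub>diffops U\<^esub> descend_op U P" if "g \<in> carrier (hol U)" for g
    unfolding inv_diffops_ops
    using U that by (intro descend_op_eq related_smult[OF related_descend_op[OF P]]) simp_all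
  fix V assume "open V \<and> V \<subseteq> U"
  then show "descend_op V (op_restrict (elem_sym -` V) P) = op_restrict V (descend_op U P)"
    by (intro descend_op_eq related_op_restrict[OF related_descend_op[OF P]]) simp
qed

lemma algebra_sheaf_hom_lift_op:
  assumes X: "X \<subseteq> {\<sigma>. discriminant \<sigma> \<noteq> 0}"
  shows "algebra_sheaf_hom X hol diffop_sheaf inv_diffop_sheaf lift_op"
  unfolding algebra_sheaf_hom_def inv_diffop_sheaf_def diffop_sheaf_def algebra_sheaf.simps
proof (intro allI impI conjI ballI)
  fix U :: "'a space set" assume U: "open U \<and> U \<subseteq> X"
  then have UX: "U \<subseteq> {\<sigma>. discriminant \<sigma> \<noteq> 0}" using X by blast
  show "lift_op U \<in> ring_hom (diffops U) (inv_diffops U)"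
  proof (rule ring_hom_memI)
    fix Q Q' assume Q: "Q \<in> carrier (diffops U)" and Q': "Q' \<in> carrier (diffops U)"
    note rel = related_lift_op[OF UX Q] and rel' = related_lift_op[OF UX Q']
    show "lift_op U Q \<in> carrier (inv_diffops U)" by (rule lift_op_carrier[OF UX Q])
    show "lift_op U (Q \<otimes>\<^bsub>diffops U\<^esub> Q') = lift_op U Q \<otimes>\<^bsub>inv_diffops U\<^esub> lift_op U Q'"
      unfolding inv_diffops_ops by (rule lift_op_eq[OF related_mult[OF rel rel']])
    show "lift_op U (Q \<oplus>\<^bsub>diffops U\<^esub> Q') = lift_op U Q \<oplus>\<^bsub>inv_diffops U\<^esub> lift_op U Q'"
      unfolding inv_diffops_ops by (rule lift_op_eq[OF related_add[OF rel rel']])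
  next
    show "lift_op U \<one>\<^bsub>diffops U\<^esub> = \<one>\<^bsub>inv_diffops U\<^esub>"
      unfolding inv_diffops_ops by (rule lift_op_eq[OF related_one])
  qed
  fix Q assume Q: "Q \<in> carrier (diffops U)"
  show "lift_op U (g \<odot>\<^bsub>diffops U\<^esub> Q) = g \<odot>\<^bsub>inv_diffops U\<^esub> lift_op U Q" if "g \<in> carrier (hol U)" for g
    unfolding inv_diffops_ops
    using U that by (intro lift_op_eq related_smult[OF related_lift_op[OF UX Q]]) simp_all
  fix V assume "open V \<and> V \<subseteq> U"
  then show "lift_op V (op_restrict V Q) = op_restrict (elem_sym -` V) (lift_op U Q)"
    by (intro lift_op_eq related_op_restrict[OF related_lift_op[OF UX Q]]) simp
qed

theorem theorem3p2p1:
  shows "\<exists>\<Xi> :: ('k::{finite,linorder} space) set \<Rightarrow> 'k op \<Rightarrow> 'k op.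
    algebra_sheaf_hom UNIV hol inv_diffop_sheaf diffop_sheaf \<Xi> \<and>
    (\<forall>U V. open U \<and> open V \<and> V \<subseteq> U \<longrightarrow>
       (\<forall>P\<in>carrier (sections inv_diffop_sheaf U). \<forall>f\<in>inv_hol V.
          \<theta> V (P (elem_sym -` V) f) = \<Xi> U P V (\<theta> V f))) \<and>
    sheaf_hom_inj inv_diffop_sheaf \<Xi> \<and>
    algebra_sheaf_iso {\<sigma>. discriminant \<sigma> \<noteq> 0} hol inv_diffop_sheaf diffop_sheaf \<Xi>"
proof (rule exI[of _ descend_op], intro conjI)
  have secs: "sections inv_diffop_sheaf = inv_diffops" "sections diffop_sheaf = diffops"
    by (simp_all add: inv_diffop_sheaf_def diffop_sheaf_def)
  show "algebra_sheaf_hom UNIV hol inv_diffop_sheaf diffop_sheaf (descend_op :: 'k space set \<Rightarrow> 'k op \<Rightarrow> 'k op)"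
    by (rule algebra_sheaf_hom_descend_op)
  show "\<forall>U V. open U \<and> open V \<and> V \<subseteq> U \<longrightarrow>
       (\<forall>P\<in>carrier (sections inv_diffop_sheaf U). \<forall>f\<in>inv_hol V.
          \<theta> V (P (elem_sym -` V) f) = descend_op U P V (\<theta> V (f :: 'k space \<Rightarrow> complex)))"
  proof (intro allI impI ballI)
    fix U V :: "'k space set" and P f
    assume UV: "open U \<and> open V \<and> V \<subseteq> U" and P: "P \<in> carrier (sections inv_diffop_sheaf U)" and f: "f \<in> inv_hol V"
    have rel: "related U P (descend_op U P)" using P unfolding secs by (rule related_descend_op)
    have V: "open V" "V \<subseteq> U" using UV by auto
    note g = \<theta>_inv_hol[OF V(1) f]
    have "\<theta> V (P (elem_sym -` V) (pullback V (\<theta> V f))) = descend_op U P V (\<theta> V f)"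
      unfolding relatedD(3)[OF rel V g(1)] by (rule \<theta>_pullback[OF sheaf_endo_carrier[OF relatedD(2)[OF rel] V g(1)]])
    then show "\<theta> V (P (elem_sym -` V) f) = descend_op U P V (\<theta> V f)" unfolding g(2) .
  qed
  show "sheaf_hom_inj inv_diffop_sheaf (descend_op :: 'k space set \<Rightarrow> 'k op \<Rightarrow> 'k op)"
    unfolding sheaf_hom_inj_def secs
  proof (intro allI impI inj_onI)
    fix U :: "'k space set" and P P'
    assume P: "P \<in> carrier (inv_diffops U)" and P': "P' \<in> carrier (inv_diffops U)"
      and eq: "descend_op U P = descend_op U P'"
    show "P = P'"
      by (rule related_unique_left[OF related_descend_op[OF P, unfolded eq] related_descend_op[OF P']])
  qed
  show "algebra_sheaf_iso {\<sigma>. discriminant \<sigma> \<noteq> 0} hol inv_diffop_sheaf diffop_sheaf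
      (descend_op :: 'k space set \<Rightarrow> 'k op \<Rightarrow> 'k op)"
    unfolding algebra_sheaf_iso_def secs
  proof (intro conjI exI[of _ lift_op] allI impI ballI)
    show "algebra_sheaf_hom {\<sigma>. discriminant \<sigma> \<noteq> 0} hol inv_diffop_sheaf diffop_sheaf
        (descend_op :: 'k space set \<Rightarrow> 'k op \<Rightarrow> 'k op)"
      by (rule algebra_sheaf_hom_descend_op)
    show "algebra_sheaf_hom {\<sigma>. discriminant \<sigma> \<noteq> 0} hol diffop_sheaf inv_diffop_sheaf
        (lift_op :: 'k space set \<Rightarrow> 'k op \<Rightarrow> 'k op)"
      by (rule algebra_sheaf_hom_lift_op) (rule order_refl)
    fix U :: "'k space set" assume "open U \<and> U \<subseteq> {\<sigma>. discriminant \<sigma> \<noteq> 0}"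
    then have U: "U \<subseteq> {\<sigma>. discriminant \<sigma> \<noteq> 0}" by simp
    show "lift_op U (descend_op U P) = P" if "P \<in> carrier (inv_diffops U)" for P
      by (rule lift_op_eq[OF related_descend_op[OF that]])
    show "descend_op U (lift_op U Q) = Q" if "Q \<in> carrier (diffops U)" for Q
      by (rule descend_op_eq[OF related_lift_op[OF U that]])
  qed
qed

end
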